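(* Let $\mathfrak{g}$ be a finite-dimensional nilpotent Lie algebra over $\mathbb{C}$ and let $V$ be a finite-dimensional left $\mathfrak{g}$-module. Then the Taylor spectrum $\sigma_{\mathfrak{g}}(V)$ coincides with the set of isomorphism classes of one-dimensional submodules of $V$.
   Context: All Lie algebras are over $\mathbb{C}$. For a finite-dimensional Lie algebra $\mathfrak{g}$, $U\mathfrak{g}$ is its universal enveloping algebra and $\hat{\mathfrak{g}}$ is the set of isomorphism classes of simple finite-dimensional left $\mathfrak{g}$-modules (a simple module and its class are denoted by the same letter; for nilpotent $\mathfrak{g}$ all of them are one-dimensional). The Taylor spectrum of a left $\mathfrak{g}$-module $V$ is $$\sigma_{\mathfrak{g}}(V)=\{ S\in \hat{\mathfrak{g}} : \operatorname{Tor}^{U\mathfrak{g}}_k(S^*,V)\neq 0 \text{ for some } k\geq 0 \},$$ where $S^*$ is the dual vector space of $S$ with the right $\mathfrak{g}$-action $(f\cdot x)(s)=f(x\cdot s)$ for $f\in S^*$, $x\in\mathfrak{g}$, $s\in S$. *)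

theory Defs
  imports Complex_Main "HOL-Algebra.QuotRing" "HOL-Algebra.Module"
    "HOL-Algebra.Free_Abelian_Groups" "HOL-Library.Poly_Mapping"
begin

section \<open>Complex Lie algebras\<close>

text \<open>As in \<^theory>\<open>HOL.Vector_Spaces\<close>, a Lie algebra lives on a whole type, whose
  addition comes from the class \<^class>\<open>ab_group_add\<close>; no dimension is fixed by the type.\<close>

record 'g lie_algebra =
  lscale :: "complex \<Rightarrow> 'g \<Rightarrow> 'g"
  bracket :: "'g \<Rightarrow> 'g \<Rightarrow> 'g"

locale lie_algebra = vector_space "lscale L"
  for L :: "'g::ab_group_add lie_algebra" +
  assumes bracket_linear_left: "\<And>y. Vector_Spaces.linear (lscale L) (lscale L) (\<lambda>x. bracket L x y)"
    and bracket_linear_right: "\<And>x. Vector_Spaces.linear (lscale L) (lscale L) (bracket L x)"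
    and bracket_self: "\<And>x. bracket L x x = 0"
    and jacobi: "\<And>x y z.
      bracket L x (bracket L y z) + bracket L y (bracket L z x) + bracket L z (bracket L x y) = 0"

definition lie_finite_dim :: "'g::ab_group_add lie_algebra \<Rightarrow> bool" where
  "lie_finite_dim L \<longleftrightarrow> (\<exists>B. finite B \<and> module.span (lscale L) B = UNIV)"

fun lower_central :: "'g::ab_group_add lie_algebra \<Rightarrow> nat \<Rightarrow> 'g set" where
  "lower_central L 0 = UNIV"
| "lower_central L (Suc n) = module.span (lscale L) {bracket L x y | x y. y \<in> lower_central L n}"

definition lie_nilpotent :: "'g::ab_group_add lie_algebra \<Rightarrow> bool" where
  "lie_nilpotent L \<longleftrightarrow> (\<exists>n. lower_central L n = {0})"

section \<open>Modules over a Lie algebra\<close>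

text \<open>A left module is carried by a subspace of an ambient vector space, so that its
  submodules are modules of the same type. The values of the action outside
  the carrier are irrelevant.\<close>

record ('g, 'v) lie_module =
  mspace :: "'v set"
  mscale :: "complex \<Rightarrow> 'v \<Rightarrow> 'v"
  mact :: "'g \<Rightarrow> 'v \<Rightarrow> 'v"

locale lie_module = lie_algebra L + V: vector_space "mscale V"
  for L :: "'g::ab_group_add lie_algebra" and V :: "('g, 'v::ab_group_add) lie_module" +
  assumes subspace_mspace: "module.subspace (mscale V) (mspace V)"
    and act_closed: "v \<in> mspace V \<Longrightarrow> mact V x v \<in> mspace V"
    and act_add_left: "v \<in> mspace V \<Longrightarrow> mact V (x + y) v = mact V x v + mact V y v"
    and act_scale_left: "v \<in> mspace V \<Longrightarrow> mact V (lscale L c x) v = mscale V c (mact V x v)"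
    and act_add_right: "\<lbrakk>v \<in> mspace V; w \<in> mspace V\<rbrakk> \<Longrightarrow> mact V x (v + w) = mact V x v + mact V x w"
    and act_scale_right: "v \<in> mspace V \<Longrightarrow> mact V x (mscale V c v) = mscale V c (mact V x v)"
    and act_bracket: "v \<in> mspace V \<Longrightarrow>
      mact V (bracket L x y) v = mact V x (mact V y v) - mact V y (mact V x v)"

definition module_finite_dim :: "('g, 'v::ab_group_add) lie_module \<Rightarrow> bool" where
  "module_finite_dim V \<longleftrightarrow> (\<exists>B. finite B \<and> module.span (mscale V) B = mspace V)"

definition lie_submodule :: "('g, 'v::ab_group_add) lie_module \<Rightarrow> 'v set \<Rightarrow> bool" where
  "lie_submodule V W \<longleftrightarrow> W \<subseteq> mspace V \<and> module.subspace (mscale V) W \<and> (\<forall>x. \<forall>w\<in>W. mact V x w \<in> W)"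

definition lie_simple :: "('g, 'v::ab_group_add) lie_module \<Rightarrow> bool" where
  "lie_simple V \<longleftrightarrow> mspace V \<noteq> {0} \<and> (\<forall>W. lie_submodule V W \<longrightarrow> W = {0} \<or> W = mspace V)"

definition lie_isomorphic ::
  "('g, 'v::ab_group_add) lie_module \<Rightarrow> ('g, 'w::ab_group_add) lie_module \<Rightarrow> bool" where
  "lie_isomorphic V W \<longleftrightarrow> (\<exists>f. bij_betw f (mspace V) (mspace W) \<and>
     (\<forall>u\<in>mspace V. \<forall>v\<in>mspace V. f (u + v) = f u + f v) \<and>
     (\<forall>c. \<forall>v\<in>mspace V. f (mscale V c v) = mscale W c (f v)) \<and>
     (\<forall>x. \<forall>v\<in>mspace V. f (mact V x v) = mact W x (f v)))"

text \<open>Isomorphism classes are formed in one fixed universe, the modules carried by subspaces of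
  spaces on the type \<open>nat \<Rightarrow>\<^sub>0 complex\<close>. Every module of countable dimension, in particular every
  finite-dimensional one, has an isomorphic copy in it.\<close>

type_synonym 'g std_module = "('g, nat \<Rightarrow>\<^sub>0 complex) lie_module"

definition iso_class ::
  "'g::ab_group_add lie_algebra \<Rightarrow> ('g, 'v::ab_group_add) lie_module \<Rightarrow> 'g std_module set" where
  "iso_class L V = {S. lie_module L S \<and> lie_isomorphic S V}"

section \<open>The universal enveloping algebra\<close>

text \<open>Words over \<open>'g\<close> under concatenation, written additively: then finitely supported functions
  on words, with the convolution product of \<^theory>\<open>HOL-Library.Poly_Mapping\<close>, form the free
  associative algebra on the set \<open>'g\<close>.\<close>

datatype 'g free_word = Letters (letters: "'g list")

instantiation free_word :: (type) monoid_add
begin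

definition zero_free_word :: "'a free_word" where
  "zero_free_word = Letters []"

definition plus_free_word :: "'a free_word \<Rightarrow> 'a free_word \<Rightarrow> 'a free_word" where
  "plus_free_word u v = Letters (letters u @ letters v)"

instance
  by standard (simp_all add: zero_free_word_def plus_free_word_def)

end

type_synonym 'g free_alg = "'g free_word \<Rightarrow>\<^sub>0 complex"

definition free_algebra :: "'g free_alg ring" where
  "free_algebra = \<lparr>carrier = UNIV, monoid.mult = (*), one = 1, ring.zero = 0, add = (+)\<rparr>"

definition gen :: "'g \<Rightarrow> 'g free_alg" where
  "gen x = Poly_Mapping.single (Letters [x]) 1"

text \<open>The first two families of relations cut the free algebra on the set \<open>'g\<close> down to the
  tensor algebra of the vector space \<open>'g\<close>. The element \<open>Poly_Mapping.single 0 c\<close> is the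
  scalar \<open>c\<close>.\<close>

definition uea_relations :: "'g::ab_group_add lie_algebra \<Rightarrow> 'g free_alg set" where
  "uea_relations L =
     {gen (x + y) - gen x - gen y | x y. True} \<union>
     {gen (lscale L c x) - Poly_Mapping.single 0 c * gen x | c x. True} \<union>
     {gen x * gen y - gen y * gen x - gen (bracket L x y) | x y. True}"

definition uea :: "'g::ab_group_add lie_algebra \<Rightarrow> 'g free_alg set ring" where
  "uea L = free_algebra Quot (Idl\<^bsub>free_algebra\<^esub> (uea_relations L))"

text \<open>Modules over a not necessarily commutative ring \<open>R\<close> use the record type
  \<^typ>\<open>('r, 'm) module\<close>, whose fields \<^const>\<open>monoid.mult\<close> and \<^const>\<open>one\<close> play no role. For a
  right module, \<^term>\<open>smult N r n\<close> stands for \<open>n \<cdot> r\<close>.\<close>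

definition free_alg_act ::
  "('g, 'v::ab_group_add) lie_module \<Rightarrow> 'g free_alg \<Rightarrow> 'v \<Rightarrow> 'v" where
  "free_alg_act V p v =
     (\<Sum>w\<in>Poly_Mapping.keys p. mscale V (Poly_Mapping.lookup p w) (foldr (mact V) (letters w) v))"

text \<open>An element \<open>a\<close> of \<^term>\<open>uea L\<close> is a coset of elements of the free algebra, all of which
  act on \<open>V\<close> in the same way.\<close>

definition uea_act ::
  "('g, 'v::ab_group_add) lie_module \<Rightarrow> 'g free_alg set \<Rightarrow> 'v \<Rightarrow> 'v" where
  "uea_act V a v = the_elem ((\<lambda>p. free_alg_act V p v) ` a)"

definition uea_left_module ::
  "('g, 'v::ab_group_add) lie_module \<Rightarrow> ('g free_alg set, 'v) module" where
  "uea_left_module V =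
     \<lparr>carrier = mspace V, monoid.mult = undefined, one = undefined, ring.zero = 0, add = (+),
      smult = uea_act V\<rparr>"

text \<open>The dual space consists of the linear functionals on \<^term>\<open>mspace V\<close>, extended by \<open>0\<close> to
  the ambient type in order to be determined by their values on \<^term>\<open>mspace V\<close>. The right action
  is \<open>(f \<cdot> a) v = f (a \<cdot> v)\<close>, the extension of the action of the Lie algebra to the enveloping
  algebra.\<close>

definition dual_right_module ::
  "('g, 'v::ab_group_add) lie_module \<Rightarrow> ('g free_alg set, 'v \<Rightarrow> complex) module" where
  "dual_right_module V =
     \<lparr>carrier = {f. (\<forall>u\<in>mspace V. \<forall>v\<in>mspace V. f (u + v) = f u + f v) \<and>
                    (\<forall>c. \<forall>v\<in>mspace V. f (mscale V c v) = c * f v) \<and>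
                    (\<forall>v. v \<notin> mspace V \<longrightarrow> f v = 0)},
      monoid.mult = undefined, one = undefined,
      ring.zero = (\<lambda>_. 0), add = (\<lambda>f g v. f v + g v),
      smult = (\<lambda>a f v. if v \<in> mspace V then f (uea_act V a v) else 0)\<rparr>"

section \<open>Tor over a ring\<close>

definition free_left_module :: "('r, 'x) ring_scheme \<Rightarrow> 'i set \<Rightarrow> ('r, 'i \<Rightarrow> 'r) module" where
  "free_left_module R I =
     \<lparr>carrier = {f. (\<forall>i\<in>I. f i \<in> carrier R) \<and> (\<forall>i. i \<notin> I \<longrightarrow> f i = \<zero>\<^bsub>R\<^esub>) \<and>
                    finite {i. f i \<noteq> \<zero>\<^bsub>R\<^esub>}},
      monoid.mult = undefined, one = undefined,
      ring.zero = (\<lambda>_. \<zero>\<^bsub>R\<^esub>), add = (\<lambda>f g i. f i \<oplus>\<^bsub>R\<^esub> g i),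
      smult = (\<lambda>r f i. r \<otimes>\<^bsub>R\<^esub> f i)\<rparr>"

definition left_module_hom ::
  "('r, 'x) ring_scheme \<Rightarrow> ('r, 'm) module \<Rightarrow> ('r, 'n) module \<Rightarrow> ('m \<Rightarrow> 'n) set" where
  "left_module_hom R M N =
     {f \<in> hom (add_monoid M) (add_monoid N).
        \<forall>r\<in>carrier R. \<forall>m\<in>carrier M. f (r \<odot>\<^bsub>M\<^esub> m) = r \<odot>\<^bsub>N\<^esub> f m}"

text \<open>A resolution \<open>\<dots> \<rightarrow> P\<^sub>1 \<rightarrow> P\<^sub>0 \<rightarrow> M \<rightarrow> 0\<close> by free left modules: \<open>B k\<close> is the basis of
  \<open>P\<^sub>k\<close>, \<open>d k\<close> is the differential from \<open>P\<^bsub>k+1\<^esub>\<close> to \<open>P\<^sub>k\<close>, and \<open>e\<close> is the augmentation.\<close>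

definition free_resolution ::
  "('r, 'x) ring_scheme \<Rightarrow> ('r, 'm) module \<Rightarrow> (nat \<Rightarrow> 'i set) \<Rightarrow>
     (nat \<Rightarrow> ('i \<Rightarrow> 'r) \<Rightarrow> ('i \<Rightarrow> 'r)) \<Rightarrow> (('i \<Rightarrow> 'r) \<Rightarrow> 'm) \<Rightarrow> bool" where
  "free_resolution R M B d e \<longleftrightarrow>
     (let P = (\<lambda>k. free_left_module R (B k)) in
       e \<in> left_module_hom R (P 0) M \<and>
       (\<forall>k. d k \<in> left_module_hom R (P (Suc k)) (P k)) \<and>
       e ` carrier (P 0) = carrier M \<and>
       d 0 ` carrier (P 1) = {p \<in> carrier (P 0). e p = \<zero>\<^bsub>M\<^esub>} \<and>
       (\<forall>k. d (Suc k) ` carrier (P (Suc (Suc k))) =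
            {p \<in> carrier (P (Suc k)). d k p = \<zero>\<^bsub>P k\<^esub>}))"

text \<open>The tensor product of a right module \<open>N\<close> and a left module \<open>M\<close>: the free abelian group on
  the pairs modulo biadditivity and \<open>n \<cdot> r \<otimes> m = n \<otimes> r \<cdot> m\<close>.\<close>

definition tensor_relations ::
  "('r, 'x) ring_scheme \<Rightarrow> ('r, 'n) module \<Rightarrow> ('r, 'm) module \<Rightarrow> ('n \<times> 'm \<Rightarrow>\<^sub>0 int) set" where
  "tensor_relations R N M =
     generate (free_Abelian_group (carrier N \<times> carrier M))
      ({frag_of (n \<oplus>\<^bsub>N\<^esub> n', m) - frag_of (n, m) - frag_of (n', m) | n n' m.
          n \<in> carrier N \<and> n' \<in> carrier N \<and> m \<in> carrier M} \<union>
       {frag_of (n, m \<oplus>\<^bsub>M\<^esub> m') - frag_of (n, m) - frag_of (n, m') | n m m'.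
          n \<in> carrier N \<and> m \<in> carrier M \<and> m' \<in> carrier M} \<union>
       {frag_of (r \<odot>\<^bsub>N\<^esub> n, m) - frag_of (n, r \<odot>\<^bsub>M\<^esub> m) | n r m.
          n \<in> carrier N \<and> r \<in> carrier R \<and> m \<in> carrier M})"

definition tensor_product ::
  "('r, 'x) ring_scheme \<Rightarrow> ('r, 'n) module \<Rightarrow> ('r, 'm) module \<Rightarrow> ('n \<times> 'm \<Rightarrow>\<^sub>0 int) set monoid" where
  "tensor_product R N M =
     free_Abelian_group (carrier N \<times> carrier M) Mod tensor_relations R N M"

text \<open>The map \<open>id \<otimes> f\<close> from \<^term>\<open>tensor_product R N M\<close> to \<^term>\<open>tensor_product R N M'\<close>,
  on cosets.\<close>

definition tensor_map ::
  "('r, 'x) ring_scheme \<Rightarrow> ('r, 'n) module \<Rightarrow> ('r, 'm') module \<Rightarrow> ('m \<Rightarrow> 'm') \<Rightarrow>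
     ('n \<times> 'm \<Rightarrow>\<^sub>0 int) set \<Rightarrow> ('n \<times> 'm' \<Rightarrow>\<^sub>0 int) set" where
  "tensor_map R N M' f X =
     the_elem ((\<lambda>c. tensor_relations R N M' #>\<^bsub>free_Abelian_group (carrier N \<times> carrier M')\<^esub>
                     frag_extend (\<lambda>(n, m). frag_of (n, f m)) c) ` X)"

text \<open>Degree \<open>k\<close> homology of \<open>\<dots> \<rightarrow> N \<otimes> P\<^sub>1 \<rightarrow> N \<otimes> P\<^sub>0 \<rightarrow> 0\<close>, with \<open>P\<close> given by \<open>B\<close> and \<open>d\<close> as above.\<close>

definition tensor_cycles ::
  "('r, 'x) ring_scheme \<Rightarrow> ('r, 'n) module \<Rightarrow> (nat \<Rightarrow> 'i set) \<Rightarrow>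
     (nat \<Rightarrow> ('i \<Rightarrow> 'r) \<Rightarrow> ('i \<Rightarrow> 'r)) \<Rightarrow> nat \<Rightarrow> ('n \<times> ('i \<Rightarrow> 'r) \<Rightarrow>\<^sub>0 int) set set" where
  "tensor_cycles R N B d k =
     (let P = (\<lambda>k. free_left_module R (B k)) in
      case k of
        0 \<Rightarrow> carrier (tensor_product R N (P 0))
      | Suc j \<Rightarrow> kernel (tensor_product R N (P (Suc j))) (tensor_product R N (P j))
                   (tensor_map R N (P j) (d j)))"

definition tensor_homology ::
  "('r, 'x) ring_scheme \<Rightarrow> ('r, 'n) module \<Rightarrow> (nat \<Rightarrow> 'i set) \<Rightarrow>
     (nat \<Rightarrow> ('i \<Rightarrow> 'r) \<Rightarrow> ('i \<Rightarrow> 'r)) \<Rightarrow> nat \<Rightarrow> ('n \<times> ('i \<Rightarrow> 'r) \<Rightarrow>\<^sub>0 int) set set monoid" where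
  "tensor_homology R N B d k =
     (let P = (\<lambda>k. free_left_module R (B k)) in
      (tensor_product R N (P k))\<lparr>carrier := tensor_cycles R N B d k\<rparr> Mod
        (tensor_map R N (P k) (d k) ` carrier (tensor_product R N (P (Suc k)))))"

text \<open>Tor is computed from an arbitrarily chosen free resolution of \<open>M\<close>; up to isomorphism the
  choice does not matter. Basis elements are taken from the type \<open>('r \<times> 'm) list\<close>, which is large
  enough: it is infinite and has at least as many elements as \<open>'r\<close> and \<open>'m\<close>, hence also at least as
  many as any free module with basis in it, so that each kernel in the construction of a resolution
  can be covered by a free module of this kind.\<close>

definition Tor ::
  "('r, 'x) ring_scheme \<Rightarrow> nat \<Rightarrow> ('r, 'n) module \<Rightarrow> ('r, 'm) module \<Rightarrow>
     ('n \<times> (('r \<times> 'm) list \<Rightarrow> 'r) \<Rightarrow>\<^sub>0 int) set set monoid" where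
  "Tor R k N M =
     (case (SOME (B, d, e). free_resolution R M B d e) of
        (B, d, e) \<Rightarrow> tensor_homology R N B d k)"

section \<open>The Taylor spectrum\<close>

definition taylor_spectrum ::
  "'g::ab_group_add lie_algebra \<Rightarrow> ('g, 'v::ab_group_add) lie_module \<Rightarrow> 'g std_module set set" where
  "taylor_spectrum L V =
     {iso_class L S | S :: 'g std_module.
        lie_module L S \<and> module_finite_dim S \<and> lie_simple S \<and>
        (\<exists>k. let T = Tor (uea L) k (dual_right_module S) (uea_left_module V)
             in carrier T \<noteq> {\<one>\<^bsub>T\<^esub>})}"

definition one_dim_submodule_classes ::
  "'g::ab_group_add lie_algebra \<Rightarrow> ('g, 'v::ab_group_add) lie_module \<Rightarrow> 'g std_module set set" where
  "one_dim_submodule_classes L V =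
     {iso_class L (V\<lparr>mspace := W\<rparr>) | W.
        lie_submodule V W \<and> vector_space.dim (mscale V) W = 1}"

end

theory Submission
  imports Defs "HOL-Computational_Algebra.Fundamental_Theorem_Algebra"
begin

text \<open>
  Let \<open>\<chi>\<close> be the character of \<open>U\<close> given by a one-dimensional module of weight \<open>\<kappa>\<close>. Tensoring a
  free resolution of \<open>V\<close> with \<open>\<complex>\<^sub>\<chi>\<close> amounts to applying \<open>\<chi>\<close> to coordinates.

  If \<open>\<kappa>\<close> is not a weight of \<open>V\<close>, then \<open>a = x - \<kappa> x\<close> acts bijectively on \<open>V\<close> for some \<open>x\<close>, and
  \<open>ad a\<close> is locally nilpotent on \<open>U\<close>. In the resolution that covers each kernel \<open>K\<close> by the free
  module on the set \<open>K\<close>, the action of \<open>a\<close> on \<open>V\<close> lifts to bijective additive maps, which are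
  \<open>ad a\<close> on coordinates plus the permutation of the basis \<open>K\<close> by the previous lift. Their difference
  to multiplication by \<open>a\<close> is \<open>U\<close>-linear and covers \<open>0\<close>, hence is null-homotopic. As \<open>\<chi> a = 0\<close>, a
  bijective map on the tensored complex induces \<open>0\<close> in homology, so that all \<open>Tor\<close> vanish. This
  replaces the Chevalley-Eilenberg complex and avoids the Poincare-Birkhoff-Witt theorem.

  If \<open>\<kappa>\<close> is a weight of \<open>V\<close>, then it is also the weight of a one-dimensional quotient of \<open>V\<close>,
  since \<open>V\<close> is the direct sum of its generalized weight spaces, and \<open>Tor\<^sub>0\<close> is nonzero.
\<close>

section \<open>Modules over a noncommutative ring\<close>

locale left_module = ring R + M: abelian_group M
  for R :: "('r, 'x) ring_scheme" (structure) and M :: "('r, 'm) module" +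
  assumes smult_closed [simp, intro]:
      "\<lbrakk>r \<in> carrier R; m \<in> carrier M\<rbrakk> \<Longrightarrow> r \<odot>\<^bsub>M\<^esub> m \<in> carrier M"
    and smult_l_distr: "\<lbrakk>r \<in> carrier R; s \<in> carrier R; m \<in> carrier M\<rbrakk> \<Longrightarrow>
      (r \<oplus> s) \<odot>\<^bsub>M\<^esub> m = r \<odot>\<^bsub>M\<^esub> m \<oplus>\<^bsub>M\<^esub> s \<odot>\<^bsub>M\<^esub> m"
    and smult_r_distr: "\<lbrakk>r \<in> carrier R; m \<in> carrier M; n \<in> carrier M\<rbrakk> \<Longrightarrow>
      r \<odot>\<^bsub>M\<^esub> (m \<oplus>\<^bsub>M\<^esub> n) = r \<odot>\<^bsub>M\<^esub> m \<oplus>\<^bsub>M\<^esub> r \<odot>\<^bsub>M\<^esub> n"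
    and smult_assoc: "\<lbrakk>r \<in> carrier R; s \<in> carrier R; m \<in> carrier M\<rbrakk> \<Longrightarrow>
      (r \<otimes> s) \<odot>\<^bsub>M\<^esub> m = r \<odot>\<^bsub>M\<^esub> (s \<odot>\<^bsub>M\<^esub> m)"
    and smult_one [simp]: "m \<in> carrier M \<Longrightarrow> \<one> \<odot>\<^bsub>M\<^esub> m = m"
begin

lemma smult_l_null [simp]: "m \<in> carrier M \<Longrightarrow> \<zero> \<odot>\<^bsub>M\<^esub> m = \<zero>\<^bsub>M\<^esub>"
  by (metis M.add.l_cancel_one' smult_closed smult_l_distr l_zero zero_closed)

lemma smult_r_null [simp]: "r \<in> carrier R \<Longrightarrow> r \<odot>\<^bsub>M\<^esub> \<zero>\<^bsub>M\<^esub> = \<zero>\<^bsub>M\<^esub>"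
  by (metis M.add.l_cancel_one' M.l_zero M.zero_closed smult_closed smult_r_distr)

lemma smult_r_minus:
  "\<lbrakk>r \<in> carrier R; m \<in> carrier M\<rbrakk> \<Longrightarrow> r \<odot>\<^bsub>M\<^esub> (\<ominus>\<^bsub>M\<^esub> m) = \<ominus>\<^bsub>M\<^esub> (r \<odot>\<^bsub>M\<^esub> m)"
  by (metis M.a_inv_closed M.minus_equality M.l_neg smult_closed smult_r_distr smult_r_null)

lemma finsum_smult:
  assumes "finite S" "r \<in> carrier R" "\<And>i. i \<in> S \<Longrightarrow> g i \<in> carrier M"
  shows "finsum M (\<lambda>i. r \<odot>\<^bsub>M\<^esub> g i) S = r \<odot>\<^bsub>M\<^esub> finsum M g S"
  using assms(1,3)
proof (induction S rule: finite_induct)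
  case (insert i S)
  then have "finsum M g S \<in> carrier M" by (intro M.finsum_closed) auto
  with insert show ?case
    using assms(2) by (simp add: Pi_def smult_r_distr)
qed (simp add: assms(2))

end

context
  fixes R :: "('r, 'x) ring_scheme" (structure) and M :: "('r, 'm) module" and N :: "('r, 'n) module"
  assumes lm: "left_module R M" "left_module R N"
begin

interpretation M: left_module R M by (rule lm)
interpretation N: left_module R N by (rule lm)

lemma left_module_homI:
  assumes "\<And>m. m \<in> carrier M \<Longrightarrow> f m \<in> carrier N"
    and "\<And>m n. \<lbrakk>m \<in> carrier M; n \<in> carrier M\<rbrakk> \<Longrightarrow> f (m \<oplus>\<^bsub>M\<^esub> n) = f m \<oplus>\<^bsub>N\<^esub> f n"
    and "\<And>r m. \<lbrakk>r \<in> carrier R; m \<in> carrier M\<rbrakk> \<Longrightarrow> f (r \<odot>\<^bsub>M\<^esub> m) = r \<odot>\<^bsub>N\<^esub> f m"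
  shows "f \<in> left_module_hom R M N"
  using assms unfolding left_module_hom_def hom_def by auto

lemma left_module_homD:
  assumes "f \<in> left_module_hom R M N"
  shows "m \<in> carrier M \<Longrightarrow> f m \<in> carrier N"
    and "\<lbrakk>m \<in> carrier M; n \<in> carrier M\<rbrakk> \<Longrightarrow> f (m \<oplus>\<^bsub>M\<^esub> n) = f m \<oplus>\<^bsub>N\<^esub> f n"
    and "\<lbrakk>r \<in> carrier R; m \<in> carrier M\<rbrakk> \<Longrightarrow> f (r \<odot>\<^bsub>M\<^esub> m) = r \<odot>\<^bsub>N\<^esub> f m"
    and "f \<zero>\<^bsub>M\<^esub> = \<zero>\<^bsub>N\<^esub>"
    and "m \<in> carrier M \<Longrightarrow> f (\<ominus>\<^bsub>M\<^esub> m) = \<ominus>\<^bsub>N\<^esub> f m"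
    and "\<lbrakk>m \<in> carrier M; n \<in> carrier M\<rbrakk> \<Longrightarrow> f (m \<ominus>\<^bsub>M\<^esub> n) = f m \<ominus>\<^bsub>N\<^esub> f n"
proof -
  show cl: "f m \<in> carrier N" if "m \<in> carrier M" for m
    using assms that unfolding left_module_hom_def hom_def by auto
  show add: "f (m \<oplus>\<^bsub>M\<^esub> n) = f m \<oplus>\<^bsub>N\<^esub> f n" if "m \<in> carrier M" "n \<in> carrier M" for m n
    using assms that unfolding left_module_hom_def hom_def by auto
  show "\<lbrakk>r \<in> carrier R; m \<in> carrier M\<rbrakk> \<Longrightarrow> f (r \<odot>\<^bsub>M\<^esub> m) = r \<odot>\<^bsub>N\<^esub> f m"
    using assms unfolding left_module_hom_def hom_def by auto
  show z: "f \<zero>\<^bsub>M\<^esub> = \<zero>\<^bsub>N\<^esub>"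
    by (metis M.M.l_zero M.M.zero_closed N.M.add.l_cancel_one' add cl)
  show mi: "f (\<ominus>\<^bsub>M\<^esub> m) = \<ominus>\<^bsub>N\<^esub> f m" if "m \<in> carrier M" for m
    using that by (metis M.M.a_inv_closed M.M.l_neg N.M.minus_equality add cl z)
  show "f (m \<ominus>\<^bsub>M\<^esub> n) = f m \<ominus>\<^bsub>N\<^esub> f n" if "m \<in> carrier M" "n \<in> carrier M"
    using that by (simp add: M.M.minus_eq N.M.minus_eq add mi)
qed

lemma left_module_hom_minus:
  assumes "f \<in> left_module_hom R M N" "g \<in> left_module_hom R M N"
  shows "(\<lambda>m. f m \<ominus>\<^bsub>N\<^esub> g m) \<in> left_module_hom R M N"
  using left_module_homD[OF assms(1)] left_module_homD[OF assms(2)]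
  by (intro left_module_homI)
    (auto simp: N.M.minus_eq N.M.minus_add N.smult_r_distr N.smult_r_minus N.M.a_ac)

lemma left_module_kernel:
  assumes "f \<in> left_module_hom R M N"
  shows "left_module R (M\<lparr>carrier := {m \<in> carrier M. f m = \<zero>\<^bsub>N\<^esub>}\<rparr>)"
proof -
  note f = left_module_homD[OF assms]
  let ?K = "M\<lparr>carrier := {m \<in> carrier M. f m = \<zero>\<^bsub>N\<^esub>}\<rparr>"
  have "abelian_group ?K"
  proof (rule abelian_groupI)
    fix x assume "x \<in> carrier ?K"
    then show "\<exists>y\<in>carrier ?K. y \<oplus>\<^bsub>?K\<^esub> x = \<zero>\<^bsub>?K\<^esub>"
      by (intro bexI[of _ "\<ominus>\<^bsub>M\<^esub> x"]) (auto simp: f M.M.l_neg)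
  qed (auto simp: f M.M.a_ac)
  then show ?thesis
    by (intro left_module.intro left_module_axioms.intro M.ring_axioms)
      (auto simp: f M.smult_l_distr M.smult_r_distr M.smult_assoc)
qed

end

lemma left_module_hom_comp:
  assumes "f \<in> left_module_hom R M N" "g \<in> left_module_hom R N Q"
  shows "(\<lambda>m. g (f m)) \<in> left_module_hom R M Q"
  using assms unfolding left_module_hom_def hom_def by (auto simp: Pi_iff)

section \<open>Free modules\<close>

definition monomial :: "('r, 'x) ring_scheme \<Rightarrow> 'r \<Rightarrow> 'i \<Rightarrow> 'i \<Rightarrow> 'r" where
  "monomial R r i = (\<lambda>j. if j = i then r else \<zero>\<^bsub>R\<^esub>)"

definition lin_ext :: "('r, 'x) ring_scheme \<Rightarrow> ('r, 'm) module \<Rightarrow> ('i \<Rightarrow> 'm) \<Rightarrow> ('i \<Rightarrow> 'r) \<Rightarrow> 'm" where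
  "lin_ext R M \<phi> f = finsum M (\<lambda>i. f i \<odot>\<^bsub>M\<^esub> \<phi> i) {i. f i \<noteq> \<zero>\<^bsub>R\<^esub>}"

lemma carrier_free:
  "f \<in> carrier (free_left_module R I) \<longleftrightarrow>
     (\<forall>i\<in>I. f i \<in> carrier R) \<and> (\<forall>i. i \<notin> I \<longrightarrow> f i = \<zero>\<^bsub>R\<^esub>) \<and> finite {i. f i \<noteq> \<zero>\<^bsub>R\<^esub>}"
  and add_free [simp]: "f \<oplus>\<^bsub>free_left_module R I\<^esub> g = (\<lambda>i. f i \<oplus>\<^bsub>R\<^esub> g i)"
  and smult_free [simp]: "r \<odot>\<^bsub>free_left_module R I\<^esub> f = (\<lambda>i. r \<otimes>\<^bsub>R\<^esub> f i)"
  and zero_free [simp]: "\<zero>\<^bsub>free_left_module R I\<^esub> = (\<lambda>_. \<zero>\<^bsub>R\<^esub>)"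
  by (simp_all add: free_left_module_def)

context ring
begin

abbreviation F :: "'i set \<Rightarrow> ('a, 'i \<Rightarrow> 'a) module" where
  "F I \<equiv> free_left_module R I"

lemma free_coord [simp]: "f \<in> carrier (F I) \<Longrightarrow> f i \<in> carrier R"
  by (cases "i \<in> I") (auto simp: carrier_free)

lemma free_finite: "f \<in> carrier (F I) \<Longrightarrow> finite {i. f i \<noteq> \<zero>}"
  by (auto simp: carrier_free)

lemma left_module_free: "left_module R (F I)"
proof -
  let ?P = "F I"
  have cl: "(\<lambda>i. f i \<oplus> g i) \<in> carrier ?P" if "f \<in> carrier ?P" "g \<in> carrier ?P" for f g
    using that by (auto simp: carrier_free
        intro: finite_subset[of _ "{i. f i \<noteq> \<zero>} \<union> {i. g i \<noteq> \<zero>}"])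
  have "abelian_group ?P"
  proof (rule abelian_groupI)
    fix f assume f: "f \<in> carrier ?P"
    have "(\<lambda>i. \<ominus> f i) \<in> carrier ?P"
      using f by (auto simp: carrier_free elim!: finite_subset[rotated])
    moreover have "(\<lambda>i. \<ominus> f i \<oplus> f i) = (\<lambda>_. \<zero>)"
      using f by (auto simp: l_neg)
    ultimately show "\<exists>g\<in>carrier ?P. g \<oplus>\<^bsub>?P\<^esub> f = \<zero>\<^bsub>?P\<^esub>"
      by auto
  qed (use cl in \<open>auto simp: a_ac carrier_free\<close>)
  then show ?thesis
    by (intro left_module.intro left_module_axioms.intro ring_axioms)
      (auto simp: l_distr r_distr m_assoc carrier_free elim!: finite_subset[rotated])
qed

lemma minus_free:
  assumes "f \<in> carrier (F I)" "g \<in> carrier (F I)"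
  shows "f \<ominus>\<^bsub>F I\<^esub> g = (\<lambda>i. f i \<ominus> g i)"
proof -
  interpret P: left_module R "F I" by (rule left_module_free)
  have n: "(\<lambda>i. \<ominus> g i) \<in> carrier (F I)"
    using assms(2) by (auto simp: carrier_free elim!: finite_subset[rotated])
  have "(\<lambda>i. \<ominus> g i) \<oplus>\<^bsub>F I\<^esub> g = \<zero>\<^bsub>F I\<^esub>"
    using assms(2) by (auto simp: l_neg)
  then have "\<ominus>\<^bsub>F I\<^esub> g = (\<lambda>i. \<ominus> g i)"
    using P.M.minus_equality[OF _ assms(2) n] by simp
  then show ?thesis
    by (simp add: P.M.minus_eq minus_eq)
qed

lemma monomial_closed [simp]:
  "\<lbrakk>r \<in> carrier R; i \<in> I\<rbrakk> \<Longrightarrow> monomial R r i \<in> carrier (F I)"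
  by (auto simp: carrier_free monomial_def)

lemma monomial_eq_smult: "r \<in> carrier R \<Longrightarrow> monomial R r i = r \<odot>\<^bsub>F I\<^esub> monomial R \<one> i"
  by (auto simp: monomial_def)

lemma free_induct [consumes 1, case_names zero add]:
  assumes "f \<in> carrier (F I)"
    and "Q (\<lambda>_. \<zero>)"
    and add: "\<And>f r i. \<lbrakk>f \<in> carrier (F I); r \<in> carrier R; i \<in> I; f i = \<zero>; Q f\<rbrakk> \<Longrightarrow>
      Q (f \<oplus>\<^bsub>F I\<^esub> monomial R r i)"
  shows "Q f"
proof -
  have "Q f" if "finite S" "f \<in> carrier (F I)" "{i. f i \<noteq> \<zero>} \<subseteq> S" for S f
    using that
  proof (induction S arbitrary: f rule: finite_induct)
    case empty
    then have "f = (\<lambda>_. \<zero>)" by auto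
    then show ?case using assms(2) by simp
  next
    case (insert i S)
    show ?case
    proof (cases "f i = \<zero>")
      case True
      then show ?thesis using insert by auto
    next
      case False
      then have i: "i \<in> I" using insert.prems by (auto simp: carrier_free)
      have g: "f(i := \<zero>) \<in> carrier (F I)"
        using insert.prems(1) by (auto simp: carrier_free elim!: finite_subset[rotated])
      have "Q (f(i := \<zero>))"
        using insert.prems by (intro insert.IH g) auto
      from add[OF g _ i _ this, of "f i"] insert.prems(1)
      have "Q (f(i := \<zero>) \<oplus>\<^bsub>F I\<^esub> monomial R (f i) i)"
        by simp
      moreover have "f(i := \<zero>) \<oplus>\<^bsub>F I\<^esub> monomial R (f i) i = f"
        using insert.prems(1) by (auto simp: monomial_def fun_eq_iff)
      ultimately show ?thesis by simp
    qed
  qed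
  then show ?thesis using assms(1) free_finite by blast
qed

lemma lin_ext_hom:
  assumes "left_module R M" and \<phi>: "\<And>i. i \<in> I \<Longrightarrow> \<phi> i \<in> carrier M"
  shows "lin_ext R M \<phi> \<in> left_module_hom R (F I) M"
    and "i \<in> I \<Longrightarrow> lin_ext R M \<phi> (monomial R \<one> i) = \<phi> i"
proof -
  interpret M: left_module R M by fact
  let ?P = "F I"
  interpret P: left_module R ?P by (rule left_module_free)
  have sm: "f i \<odot>\<^bsub>M\<^esub> \<phi> i \<in> carrier M" if "f \<in> carrier ?P" "f i \<noteq> \<zero>" for f i
    using that \<phi> by (auto simp: carrier_free)
  have ext: "lin_ext R M \<phi> f = finsum M (\<lambda>i. f i \<odot>\<^bsub>M\<^esub> \<phi> i) S"
    if "f \<in> carrier ?P" "finite S" "{i. f i \<noteq> \<zero>} \<subseteq> S" "S \<subseteq> I" for f S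
    unfolding lin_ext_def using that \<phi>
    by (intro M.M.add.finprod_mono_neutral_cong_left) (auto simp: carrier_free)
  show "lin_ext R M \<phi> \<in> left_module_hom R ?P M"
  proof (intro left_module_homI left_module_free assms(1))
    fix f assume f: "f \<in> carrier ?P"
    show "lin_ext R M \<phi> f \<in> carrier M"
      unfolding lin_ext_def using sm[OF f] by (intro M.M.finsum_closed) auto
    fix r assume r: "r \<in> carrier R"
    let ?S = "{i. f i \<noteq> \<zero>}"
    have S: "finite ?S" "?S \<subseteq> I" using f by (auto simp: carrier_free)
    have rf: "(\<lambda>i. r \<otimes> f i) \<in> carrier ?P"
      using left_module.smult_closed[OF left_module_free r f] by simp
    have "lin_ext R M \<phi> (\<lambda>i. r \<otimes> f i) = finsum M (\<lambda>i. (r \<otimes> f i) \<odot>\<^bsub>M\<^esub> \<phi> i) ?S"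
      using rf S r f by (intro ext) auto
    also have "\<dots> = finsum M (\<lambda>i. r \<odot>\<^bsub>M\<^esub> (f i \<odot>\<^bsub>M\<^esub> \<phi> i)) ?S"
      using S f r \<phi> by (intro M.M.finsum_cong') (auto simp: M.smult_assoc)
    also have "\<dots> = r \<odot>\<^bsub>M\<^esub> finsum M (\<lambda>i. f i \<odot>\<^bsub>M\<^esub> \<phi> i) ?S"
      using S f r \<phi> by (intro M.finsum_smult) (auto simp: carrier_free)
    finally show "lin_ext R M \<phi> (r \<odot>\<^bsub>?P\<^esub> f) = r \<odot>\<^bsub>M\<^esub> lin_ext R M \<phi> f"
      by (simp add: lin_ext_def)
  next
    fix f g assume f: "f \<in> carrier ?P" and g: "g \<in> carrier ?P"
    let ?S = "{i. f i \<noteq> \<zero>} \<union> {i. g i \<noteq> \<zero>}"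
    have S: "finite ?S" "?S \<subseteq> I" using f g by (auto simp: carrier_free)
    have fg: "(\<lambda>i. f i \<oplus> g i) \<in> carrier ?P"
      using P.M.a_closed[OF f g] by simp
    have "lin_ext R M \<phi> (\<lambda>i. f i \<oplus> g i) = finsum M (\<lambda>i. (f i \<oplus> g i) \<odot>\<^bsub>M\<^esub> \<phi> i) ?S"
      using fg S f g by (intro ext) auto
    also have "\<dots> = finsum M (\<lambda>i. f i \<odot>\<^bsub>M\<^esub> \<phi> i \<oplus>\<^bsub>M\<^esub> g i \<odot>\<^bsub>M\<^esub> \<phi> i) ?S"
      using S f g \<phi> by (intro M.M.finsum_cong') (auto simp: M.smult_l_distr subset_iff)
    also have "\<dots> = finsum M (\<lambda>i. f i \<odot>\<^bsub>M\<^esub> \<phi> i) ?S \<oplus>\<^bsub>M\<^esub> finsum M (\<lambda>i. g i \<odot>\<^bsub>M\<^esub> \<phi> i) ?S"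
      using S f g \<phi> by (intro M.M.finsum_addf) (auto simp: subset_iff)
    also have "\<dots> = lin_ext R M \<phi> f \<oplus>\<^bsub>M\<^esub> lin_ext R M \<phi> g"
      using ext[OF f S(1) _ S(2)] ext[OF g S(1) _ S(2)] by auto
    finally show "lin_ext R M \<phi> (f \<oplus>\<^bsub>?P\<^esub> g) = lin_ext R M \<phi> f \<oplus>\<^bsub>M\<^esub> lin_ext R M \<phi> g"
      by simp
  qed
  show "lin_ext R M \<phi> (monomial R \<one> i) = \<phi> i" if i: "i \<in> I"
  proof -
    have "lin_ext R M \<phi> (monomial R \<one> i) = finsum M (\<lambda>j. monomial R \<one> i j \<odot>\<^bsub>M\<^esub> \<phi> j) {i}"
      using monomial_closed[OF one_closed i] i by (intro ext) (auto simp: monomial_def)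
    then show ?thesis using i \<phi> by (simp add: monomial_def)
  qed
qed

end

context ring
begin

lemma left_module_hom_eqI:
  assumes "left_module R M"
    and "f \<in> left_module_hom R (F I) M"
    and "g \<in> left_module_hom R (F I) M"
    and "\<And>i. i \<in> I \<Longrightarrow> f (monomial R \<one> i) = g (monomial R \<one> i)"
    and "p \<in> carrier (F I)"
  shows "f p = g p"
proof -
  interpret M: left_module R M by fact
  interpret P: left_module R "F I" by (rule left_module_free)
  note f = left_module_homD[OF left_module_free assms(1) assms(2)]
  note g = left_module_homD[OF left_module_free assms(1) assms(3)]
  show ?thesis
    using assms(5)
  proof (induction rule: free_induct)
    case zero
    show ?case using f(4) g(4) by simp
  next
    case (add p r i)
    have "f (monomial R r i) = g (monomial R r i)"
      using add(2,3) assms(4)[OF add(3)]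
      by (simp add: monomial_eq_smult[of r i I] f(3) g(3) del: smult_free)
    then show ?case
      using add f(2)[OF add(1), of "monomial R r i"] g(2)[OF add(1), of "monomial R r i"] by simp
  qed
qed

lemma free_projective:
  assumes "left_module R N" "left_module R Q"
    and \<beta>: "\<beta> \<in> left_module_hom R N Q"
    and \<alpha>: "\<alpha> \<in> left_module_hom R (F I) Q"
    and sub: "\<And>i. i \<in> I \<Longrightarrow> \<alpha> (monomial R \<one> i) \<in> \<beta> ` carrier N"
  obtains \<gamma> where "\<gamma> \<in> left_module_hom R (F I) N"
    and "\<And>p. p \<in> carrier (F I) \<Longrightarrow> \<beta> (\<gamma> p) = \<alpha> p"
proof -
  have "\<forall>i\<in>I. \<exists>y\<in>carrier N. \<beta> y = \<alpha> (monomial R \<one> i)"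
    using sub by (metis imageE)
  then obtain y where y: "\<And>i. i \<in> I \<Longrightarrow> y i \<in> carrier N \<and> \<beta> (y i) = \<alpha> (monomial R \<one> i)"
    by metis
  let ?\<gamma> = "lin_ext R N y"
  have \<gamma>: "?\<gamma> \<in> left_module_hom R (F I) N"
    using y by (intro lin_ext_hom assms(1)) auto
  have "\<beta> (?\<gamma> p) = \<alpha> p" if "p \<in> carrier (F I)" for p
    using left_module_hom_comp[OF \<gamma> \<beta>] \<alpha>
    by (rule left_module_hom_eqI[OF assms(2)]) (use that y lin_ext_hom(2)[OF assms(1), of I y] in auto)
  with \<gamma> that show ?thesis by blast
qed

end

section \<open>Comparison of resolutions\<close>

locale resolution = ring R + M: left_module R M
  for R :: "('r, 'x) ring_scheme" (structure) and M :: "('r, 'm) module" +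
  fixes B :: "nat \<Rightarrow> 'i set" and d :: "nat \<Rightarrow> ('i \<Rightarrow> 'r) \<Rightarrow> 'i \<Rightarrow> 'r" and e :: "('i \<Rightarrow> 'r) \<Rightarrow> 'm"
  assumes free_resolution: "free_resolution R M B d e"
begin

abbreviation P :: "nat \<Rightarrow> ('r, 'i \<Rightarrow> 'r) module" where
  "P k \<equiv> F (B k)"

sublocale P: left_module R "P k" for k
  by (rule left_module_free)

lemma e_hom: "e \<in> left_module_hom R (P 0) M"
  and d_hom: "d k \<in> left_module_hom R (P (Suc k)) (P k)"
  and e_surj: "e ` carrier (P 0) = carrier M"
  and exact_0: "d 0 ` carrier (P (Suc 0)) = {p \<in> carrier (P 0). e p = \<zero>\<^bsub>M\<^esub>}"
  and exact_Suc: "d (Suc k) ` carrier (P (Suc (Suc k))) = {p \<in> carrier (P (Suc k)). d k p = (\<lambda>_. \<zero>)}"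
  using free_resolution unfolding free_resolution_def Let_def by auto

lemmas e_rules = left_module_homD[OF P.left_module_axioms M.left_module_axioms e_hom]
lemmas d_rules = left_module_homD[OF P.left_module_axioms P.left_module_axioms d_hom]

lemma e_d: "p \<in> carrier (P (Suc 0)) \<Longrightarrow> e (d 0 p) = \<zero>\<^bsub>M\<^esub>"
  using exact_0 by blast

lemma d_d: "p \<in> carrier (P (Suc (Suc k))) \<Longrightarrow> d k (d (Suc k) p) = (\<lambda>_. \<zero>)"
  using exact_Suc by blast

lemma chain_map_exists:
  assumes "resolution R M B' d' e'"
  obtains f where "\<And>k. f k \<in> left_module_hom R (P k) (F (B' k))"
    and "\<And>p. p \<in> carrier (P 0) \<Longrightarrow> e' (f 0 p) = e p"
    and "\<And>k p. p \<in> carrier (P (Suc k)) \<Longrightarrow> d' k (f (Suc k) p) = f k (d k p)"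
proof -
  interpret Q: resolution R M B' d' e' by fact
  define Inv where "Inv k f \<longleftrightarrow> f \<in> left_module_hom R (P k) (Q.P k) \<and>
     (\<forall>p\<in>carrier (P (Suc k)). f (d k p) \<in> d' k ` carrier (Q.P (Suc k))) \<and>
     (k = 0 \<longrightarrow> (\<forall>p\<in>carrier (P 0). e' (f p) = e p))" for k f
  have "\<exists>f. Inv 0 f"
  proof -
    obtain f where f: "f \<in> left_module_hom R (P 0) (Q.P 0)"
      "\<And>p. p \<in> carrier (P 0) \<Longrightarrow> e' (f p) = e p"
      by (rule free_projective[OF Q.P.left_module_axioms M.left_module_axioms Q.e_hom e_hom])
        (use Q.e_surj e_rules(1) in \<open>auto\<close>)
    note fr = left_module_homD[OF P.left_module_axioms Q.P.left_module_axioms f(1)]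
    have "Inv 0 f"
      unfolding Inv_def using f fr Q.exact_0 d_rules(1) e_d by auto
    then show ?thesis by blast
  qed
  moreover have "\<exists>g. Inv (Suc k) g \<and> (\<forall>p\<in>carrier (P (Suc k)). d' k (g p) = f (d k p))"
    if "Inv k f" for f k
  proof -
    from that have f: "f \<in> left_module_hom R (P k) (Q.P k)"
      "\<And>p. p \<in> carrier (P (Suc k)) \<Longrightarrow> f (d k p) \<in> d' k ` carrier (Q.P (Suc k))"
      by (auto simp: Inv_def)
    obtain g where g: "g \<in> left_module_hom R (P (Suc k)) (Q.P (Suc k))"
      "\<And>p. p \<in> carrier (P (Suc k)) \<Longrightarrow> d' k (g p) = f (d k p)"
      by (rule free_projective[OF Q.P.left_module_axioms Q.P.left_module_axioms Q.d_hom
            left_module_hom_comp[OF d_hom f(1)]]) (use f(2) in auto)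
    note fr = left_module_homD[OF P.left_module_axioms Q.P.left_module_axioms f(1)]
    note gr = left_module_homD[OF P.left_module_axioms Q.P.left_module_axioms g(1)]
    have "g (d (Suc k) p) \<in> d' (Suc k) ` carrier (Q.P (Suc (Suc k)))"
      if "p \<in> carrier (P (Suc (Suc k)))" for p
      using g(2)[OF d_rules(1)[OF that]] d_d[OF that] fr(4) gr(1)[OF d_rules(1)[OF that]]
      by (simp add: Q.exact_Suc)
    with g show ?thesis by (auto simp: Inv_def)
  qed
  ultimately obtain f where "\<And>k. Inv k (f k)"
    and "\<And>k. \<forall>p\<in>carrier (P (Suc k)). d' k (f (Suc k) p) = f k (d k p)"
    using dependent_nat_choice[of Inv "\<lambda>k f g. \<forall>p\<in>carrier (P (Suc k)). d' k (g p) = f (d k p)"]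
    by metis
  then show ?thesis by (intro that[of f]) (auto simp: Inv_def)
qed

lemma homotopy_exists:
  assumes "resolution R M' B' d' e'"
    and h: "\<And>k. h k \<in> left_module_hom R (P k) (F (B' k))"
    and h0: "\<And>p. p \<in> carrier (P 0) \<Longrightarrow> e' (h 0 p) = \<zero>\<^bsub>M'\<^esub>"
    and hS: "\<And>k p. p \<in> carrier (P (Suc k)) \<Longrightarrow> d' k (h (Suc k) p) = h k (d k p)"
  obtains s where "\<And>k. s k \<in> left_module_hom R (P k) (F (B' (Suc k)))"
    and "\<And>p. p \<in> carrier (P 0) \<Longrightarrow> d' 0 (s 0 p) = h 0 p"
    and "\<And>k p. p \<in> carrier (P (Suc k)) \<Longrightarrow>
      h (Suc k) p = d' (Suc k) (s (Suc k) p) \<oplus>\<^bsub>F (B' (Suc k))\<^esub> s k (d k p)"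
proof -
  interpret Q: resolution R M' B' d' e' by fact
  note hr = left_module_homD[OF P.left_module_axioms Q.P.left_module_axioms h]
  define Inv where "Inv k s \<longleftrightarrow> s \<in> left_module_hom R (P k) (Q.P (Suc k)) \<and>
     (\<forall>p\<in>carrier (P (Suc k)). d' k (s (d k p)) = h k (d k p)) \<and>
     (k = 0 \<longrightarrow> (\<forall>p\<in>carrier (P 0). d' 0 (s p) = h 0 p))" for k s
  define Rel where "Rel k s t \<longleftrightarrow> (\<forall>p\<in>carrier (P (Suc k)).
     h (Suc k) p = d' (Suc k) (t p) \<oplus>\<^bsub>Q.P (Suc k)\<^esub> s (d k p))" for k s t
  have "\<exists>s. Inv 0 s"
  proof -
    obtain s where s: "s \<in> left_module_hom R (P 0) (Q.P (Suc 0))"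
      "\<And>p. p \<in> carrier (P 0) \<Longrightarrow> d' 0 (s p) = h 0 p"
      by (rule free_projective[OF Q.P.left_module_axioms Q.P.left_module_axioms Q.d_hom h])
        (use Q.exact_0 hr(1) h0 in \<open>auto\<close>)
    then have "Inv 0 s"
      unfolding Inv_def using d_rules(1) by auto
    then show ?thesis by blast
  qed
  moreover have "\<exists>t. Inv (Suc k) t \<and> Rel k s t" if "Inv k s" for s k
  proof -
    from that have s: "s \<in> left_module_hom R (P k) (Q.P (Suc k))"
      "\<And>p. p \<in> carrier (P (Suc k)) \<Longrightarrow> d' k (s (d k p)) = h k (d k p)"
      by (auto simp: Inv_def)
    note sr = left_module_homD[OF P.left_module_axioms Q.P.left_module_axioms s(1)]
    let ?\<alpha> = "\<lambda>p. h (Suc k) p \<ominus>\<^bsub>Q.P (Suc k)\<^esub> s (d k p)"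
    have \<alpha>: "?\<alpha> \<in> left_module_hom R (P (Suc k)) (Q.P (Suc k))"
      by (intro left_module_hom_minus P.left_module_axioms Q.P.left_module_axioms h
          left_module_hom_comp[OF d_hom s(1)])
    have \<alpha>': "?\<alpha> p \<in> d' (Suc k) ` carrier (Q.P (Suc (Suc k)))" if p: "p \<in> carrier (P (Suc k))" for p
    proof -
      have c: "h (Suc k) p \<in> carrier (Q.P (Suc k))" "s (d k p) \<in> carrier (Q.P (Suc k))"
        "h k (d k p) \<in> carrier (Q.P k)"
        using p hr(1) sr(1) d_rules(1) by auto
      have "d' k (?\<alpha> p) = h k (d k p) \<ominus>\<^bsub>Q.P k\<^esub> h k (d k p)"
        using c p by (simp add: Q.d_rules(6) hS s(2))
      also have "\<dots> = (\<lambda>_. \<zero>)"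
        using Q.P.M.r_neg[OF c(3)] by (simp add: Q.P.M.minus_eq)
      finally show ?thesis
        using c by (simp add: Q.exact_Suc Q.P.M.minus_closed del: add_free)
    qed
    obtain t where t: "t \<in> left_module_hom R (P (Suc k)) (Q.P (Suc (Suc k)))"
      "\<And>p. p \<in> carrier (P (Suc k)) \<Longrightarrow> d' (Suc k) (t p) = ?\<alpha> p"
      by (rule free_projective[OF Q.P.left_module_axioms Q.P.left_module_axioms Q.d_hom \<alpha>])
        (use \<alpha>' in auto)
    have "Rel k s t"
      unfolding Rel_def
    proof
      fix p assume p: "p \<in> carrier (P (Suc k))"
      have c: "h (Suc k) p \<in> carrier (Q.P (Suc k))" "s (d k p) \<in> carrier (Q.P (Suc k))"
        using p hr(1) sr(1) d_rules(1) by auto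
      then show "h (Suc k) p = d' (Suc k) (t p) \<oplus>\<^bsub>Q.P (Suc k)\<^esub> s (d k p)"
        using p by (simp add: t(2) Q.P.M.minus_eq Q.P.M.a_assoc Q.P.M.l_neg del: add_free zero_free)
    qed
    moreover have "d' (Suc k) (t (d (Suc k) p)) = h (Suc k) (d (Suc k) p)"
      if p: "p \<in> carrier (P (Suc (Suc k)))" for p
    proof -
      have c: "h (Suc k) (d (Suc k) p) \<in> carrier (Q.P (Suc k))"
        using p hr(1) d_rules(1) by auto
      have "d' (Suc k) (t (d (Suc k) p)) = h (Suc k) (d (Suc k) p) \<ominus>\<^bsub>Q.P (Suc k)\<^esub> \<zero>\<^bsub>Q.P (Suc k)\<^esub>"
        using t(2)[OF d_rules(1)[OF p]] sr(4) by (simp add: d_d[OF p])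
      then show ?thesis
        using c by (simp add: Q.P.M.minus_eq del: add_free zero_free)
    qed
    ultimately show ?thesis
      using t by (auto simp: Inv_def)
  qed
  ultimately obtain s where s: "\<And>k. Inv k (s k)" "\<And>k. Rel k (s k) (s (Suc k))"
    using dependent_nat_choice[of Inv Rel] by metis
  then show ?thesis by (intro that[of s]) (auto simp: Inv_def Rel_def)
qed

end

section \<open>Derivations of resolutions\<close>

inductive_set iter_zero :: "'a set \<Rightarrow> ('a \<Rightarrow> 'a) \<Rightarrow> 'a \<Rightarrow> 'a set" for C T z where
  zero: "z \<in> iter_zero C T z"
| step: "\<lbrakk>x \<in> C; T x \<in> iter_zero C T z\<rbrakk> \<Longrightarrow> x \<in> iter_zero C T z"

lemma (in abelian_group) add_minus_cancel:
  "\<lbrakk>x \<in> carrier G; y \<in> carrier G\<rbrakk> \<Longrightarrow> x \<oplus> y \<ominus> x = y"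
  by (simp add: minus_eq a_comm[of x y] a_assoc r_neg)

lemma (in abelian_group) minus_add_cancel:
  "\<lbrakk>x \<in> carrier G; y \<in> carrier G\<rbrakk> \<Longrightarrow> x \<ominus> y \<oplus> y = x"
  by (simp add: minus_eq a_assoc l_neg)

lemma (in abelian_group) minus_eq_zeroD:
  "\<lbrakk>x \<ominus> y = \<zero>; x \<in> carrier G; y \<in> carrier G\<rbrakk> \<Longrightarrow> x = y"
  using minus_equality[of x "\<ominus> y"] minus_minus[of y] by (simp add: minus_eq)

lemma (in abelian_group) iter_zero_add:
  assumes T: "\<And>x. x \<in> carrier G \<Longrightarrow> T x \<in> carrier G"
    "\<And>x y. \<lbrakk>x \<in> carrier G; y \<in> carrier G\<rbrakk> \<Longrightarrow> T (x \<oplus> y) = T x \<oplus> T y"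
    and "x \<in> iter_zero (carrier G) T \<zero>" "y \<in> iter_zero (carrier G) T \<zero>"
  shows "x \<oplus> y \<in> iter_zero (carrier G) T \<zero>"
proof -
  have sub: "z \<in> carrier G" if "z \<in> iter_zero (carrier G) T \<zero>" for z
    using that by cases auto
  have T0: "T \<zero> = \<zero>"
    by (metis T add.l_cancel_one' l_zero zero_closed)
  show ?thesis
    using assms(3,4)
  proof (induction arbitrary: y)
    case zero
    then show ?case using sub by simp
  next
    case (step x)
    note x = step
    show ?case
      using step.prems
    proof (induction)
      case zero
      show ?case using x(1) iter_zero.step[OF x(1,2)] by simp
    next
      case (step y)
      have "T (x \<oplus> y) \<in> iter_zero (carrier G) T \<zero>"
        using x(3)[of "T y"] step x(1) by (simp add: T)
      with x(1) step(1) show ?case by (intro iter_zero.step[of "x \<oplus> y"] a_closed)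
    qed
  qed
qed

definition ad :: "('r, 'x) ring_scheme \<Rightarrow> 'r \<Rightarrow> 'r \<Rightarrow> 'r" where
  "ad R a r = a \<otimes>\<^bsub>R\<^esub> r \<ominus>\<^bsub>R\<^esub> r \<otimes>\<^bsub>R\<^esub> a"

definition ad_nilpotent :: "('r, 'x) ring_scheme \<Rightarrow> 'r \<Rightarrow> bool" where
  "ad_nilpotent R a \<longleftrightarrow> carrier R \<subseteq> iter_zero (carrier R) (ad R a) \<zero>\<^bsub>R\<^esub>"

context ring
begin

lemma ad_closed [simp]: "\<lbrakk>a \<in> carrier R; r \<in> carrier R\<rbrakk> \<Longrightarrow> ad R a r \<in> carrier R"
  by (simp add: ad_def)

lemma ad_add: "\<lbrakk>a \<in> carrier R; r \<in> carrier R; s \<in> carrier R\<rbrakk> \<Longrightarrow> ad R a (r \<oplus> s) = ad R a r \<oplus> ad R a s"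
  unfolding ad_def by algebra

lemma ad_mult: "\<lbrakk>a \<in> carrier R; r \<in> carrier R; s \<in> carrier R\<rbrakk> \<Longrightarrow>
  ad R a (r \<otimes> s) = ad R a r \<otimes> s \<oplus> r \<otimes> ad R a s"
  unfolding ad_def by algebra

lemma ad_zero [simp]: "a \<in> carrier R \<Longrightarrow> ad R a \<zero> = \<zero>"
  unfolding ad_def by algebra

lemma iter_zero_ad_mult:
  assumes a: "a \<in> carrier R"
    and "r \<in> iter_zero (carrier R) (ad R a) \<zero>" "s \<in> iter_zero (carrier R) (ad R a) \<zero>"
  shows "r \<otimes> s \<in> iter_zero (carrier R) (ad R a) \<zero>"
proof -
  have sub: "z \<in> carrier R" if "z \<in> iter_zero (carrier R) (ad R a) \<zero>" for z
    using that by cases auto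
  show ?thesis
    using assms(2,3)
  proof (induction arbitrary: s)
    case zero
    then show ?case using sub by (simp add: iter_zero.zero)
  next
    case (step r)
    note r = step
    show ?case
      using step.prems
    proof (induction)
      case zero
      show ?case using r(1) by (simp add: iter_zero.zero)
    next
      case (step s)
      have "s \<in> iter_zero (carrier R) (ad R a) \<zero>"
        using step(1,2) by (rule iter_zero.step)
      then have "ad R a r \<otimes> s \<oplus> r \<otimes> ad R a s \<in> iter_zero (carrier R) (ad R a) \<zero>"
        using r step a by (intro iter_zero_add) (auto simp: ad_add)
      then have "ad R a (r \<otimes> s) \<in> iter_zero (carrier R) (ad R a) \<zero>"
        using r(1) step(1) a by (simp add: ad_mult)
      with r(1) step(1) show ?case by (intro iter_zero.step[of "r \<otimes> s"] m_closed)
    qed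
  qed
qed

end

definition derivation ::
  "('r, 'x) ring_scheme \<Rightarrow> 'r \<Rightarrow> ('r, 'm) module \<Rightarrow> ('m \<Rightarrow> 'm) \<Rightarrow> bool" where
  "derivation R a M D \<longleftrightarrow> D \<in> carrier M \<rightarrow> carrier M \<and>
     (\<forall>m\<in>carrier M. \<forall>n\<in>carrier M. D (m \<oplus>\<^bsub>M\<^esub> n) = D m \<oplus>\<^bsub>M\<^esub> D n) \<and>
     (\<forall>r\<in>carrier R. \<forall>m\<in>carrier M. D (r \<odot>\<^bsub>M\<^esub> m) = ad R a r \<odot>\<^bsub>M\<^esub> m \<oplus>\<^bsub>M\<^esub> r \<odot>\<^bsub>M\<^esub> D m)"

lemma (in left_module) derivationD:
  assumes "derivation R a M D"
  shows "m \<in> carrier M \<Longrightarrow> D m \<in> carrier M"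
    and "\<lbrakk>m \<in> carrier M; n \<in> carrier M\<rbrakk> \<Longrightarrow> D (m \<oplus>\<^bsub>M\<^esub> n) = D m \<oplus>\<^bsub>M\<^esub> D n"
    and "\<lbrakk>r \<in> carrier R; m \<in> carrier M\<rbrakk> \<Longrightarrow> D (r \<odot>\<^bsub>M\<^esub> m) = ad R a r \<odot>\<^bsub>M\<^esub> m \<oplus>\<^bsub>M\<^esub> r \<odot>\<^bsub>M\<^esub> D m"
    and "D \<zero>\<^bsub>M\<^esub> = \<zero>\<^bsub>M\<^esub>"
    and "\<lbrakk>m \<in> carrier M; n \<in> carrier M\<rbrakk> \<Longrightarrow> D (m \<ominus>\<^bsub>M\<^esub> n) = D m \<ominus>\<^bsub>M\<^esub> D n"
proof -
  show cl: "D m \<in> carrier M" if "m \<in> carrier M" for m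
    using assms that unfolding derivation_def by auto
  show add: "D (m \<oplus>\<^bsub>M\<^esub> n) = D m \<oplus>\<^bsub>M\<^esub> D n" if "m \<in> carrier M" "n \<in> carrier M" for m n
    using assms that unfolding derivation_def by auto
  show "\<lbrakk>r \<in> carrier R; m \<in> carrier M\<rbrakk> \<Longrightarrow> D (r \<odot>\<^bsub>M\<^esub> m) = ad R a r \<odot>\<^bsub>M\<^esub> m \<oplus>\<^bsub>M\<^esub> r \<odot>\<^bsub>M\<^esub> D m"
    using assms unfolding derivation_def by auto
  show z: "D \<zero>\<^bsub>M\<^esub> = \<zero>\<^bsub>M\<^esub>"
    by (metis M.l_zero M.zero_closed M.add.l_cancel_one' add cl)
  have mi: "D (\<ominus>\<^bsub>M\<^esub> m) = \<ominus>\<^bsub>M\<^esub> D m" if "m \<in> carrier M" for m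
    using that by (metis M.a_inv_closed M.l_neg M.minus_equality add cl z)
  show "D (m \<ominus>\<^bsub>M\<^esub> n) = D m \<ominus>\<^bsub>M\<^esub> D n" if "m \<in> carrier M" "n \<in> carrier M"
    using that by (simp add: M.minus_eq add mi)
qed

lemma (in left_module) derivation_smult:
  assumes "a \<in> carrier R"
  shows "derivation R a M (\<lambda>m. a \<odot>\<^bsub>M\<^esub> m)"
proof -
  have "a \<odot>\<^bsub>M\<^esub> (r \<odot>\<^bsub>M\<^esub> m) = ad R a r \<odot>\<^bsub>M\<^esub> m \<oplus>\<^bsub>M\<^esub> r \<odot>\<^bsub>M\<^esub> (a \<odot>\<^bsub>M\<^esub> m)"
    if r: "r \<in> carrier R" "m \<in> carrier M" for r m
  proof -
    have "a \<otimes> r = ad R a r \<oplus> r \<otimes> a"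
      using assms r unfolding ad_def by algebra
    then show ?thesis
      using assms r by (simp add: smult_assoc[symmetric] smult_l_distr)
  qed
  then show ?thesis
    using assms by (auto simp: derivation_def smult_r_distr)
qed

locale ring_character = ring R for R :: "('r, 'x) ring_scheme" (structure) +
  fixes \<chi> :: "'r \<Rightarrow> complex"
  assumes chi_add: "\<lbrakk>r \<in> carrier R; s \<in> carrier R\<rbrakk> \<Longrightarrow> \<chi> (r \<oplus> s) = \<chi> r + \<chi> s"
    and chi_mult: "\<lbrakk>r \<in> carrier R; s \<in> carrier R\<rbrakk> \<Longrightarrow> \<chi> (r \<otimes> s) = \<chi> r * \<chi> s"
    and chi_one [simp]: "\<chi> \<one> = 1"
begin

lemma chi_zero [simp]: "\<chi> \<zero> = 0"
  using chi_add[of \<zero> \<zero>] by simp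

lemma chi_uminus: "r \<in> carrier R \<Longrightarrow> \<chi> (\<ominus> r) = - \<chi> r"
  using chi_add[of r "\<ominus> r"] by (simp add: r_neg add_eq_0_iff)

lemma chi_minus: "\<lbrakk>r \<in> carrier R; s \<in> carrier R\<rbrakk> \<Longrightarrow> \<chi> (r \<ominus> s) = \<chi> r - \<chi> s"
  by (simp add: minus_eq chi_add chi_uminus)

lemma chi_ad [simp]: "\<lbrakk>a \<in> carrier R; r \<in> carrier R\<rbrakk> \<Longrightarrow> \<chi> (ad R a r) = 0"
  by (simp add: ad_def chi_minus chi_mult)

lemma free_induct_chi_zero [consumes 1, case_names chi zero add]:
  assumes "p \<in> carrier (F I)" and "\<And>i. \<chi> (p i) = 0"
    and "Q (\<lambda>_. \<zero>)"
    and add: "\<And>p r i. \<lbrakk>p \<in> carrier (F I); r \<in> carrier R; \<chi> r = 0; i \<in> I; Q p\<rbrakk> \<Longrightarrow>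
      Q (p \<oplus>\<^bsub>F I\<^esub> monomial R r i)"
  shows "Q p"
  using assms(1,2)
proof (induction rule: free_induct)
  case zero
  show ?case by fact
next
  case (add p r i)
  have \<chi>: "\<chi> (p k) + \<chi> (monomial R r i k) = 0" for k
    using add.prems[of k] add.hyps by (simp add: chi_add monomial_def split: if_splits)
  have r: "\<chi> r = 0"
    using \<chi>[of i] add.hyps by (simp add: monomial_def)
  have "\<chi> (p k) = 0" for k
    using \<chi>[of k] r by (simp add: monomial_def split: if_splits)
  then have "Q p" by (rule add.IH)
  with add.hyps r show ?case by (intro assms(4))
qed

lemma chi_hom:
  assumes h: "h \<in> left_module_hom R (F I) (F J)"
    and "p \<in> carrier (F I)" and "\<And>i. \<chi> (p i) = 0"
  shows "\<chi> (h p j) = 0"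
  using assms(2)
proof (induction arbitrary: j rule: free_induct_chi_zero)
  case (chi i)
  show ?case by fact
next
  case zero
  show ?case using left_module_homD(4)[OF left_module_free left_module_free h] by simp
next
  case (add p r i)
  note hr = left_module_homD[OF left_module_free left_module_free h]
  have m1: "h (monomial R r i) j = r \<otimes> h (monomial R \<one> i) j"
    using hr(3)[of r "monomial R \<one> i"] monomial_eq_smult[of r i I] add.hyps by simp
  have "h (monomial R r i) \<in> carrier (F J)"
    "h (monomial R \<one> i) \<in> carrier (F J)" "h p \<in> carrier (F J)"
    using hr(1) add.hyps by auto
  then show ?case
    using add.IH hr(2)[of p "monomial R r i"] m1 add.hyps
    by (simp add: chi_add chi_mult)
qed

lemma chi_hom_eq:
  assumes h: "h \<in> left_module_hom R (F I) (F J)"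
    and p: "p \<in> carrier (F I)" and q: "q \<in> carrier (F I)"
    and eq: "\<And>i. \<chi> (p i) = \<chi> (q i)"
  shows "\<chi> (h p j) = \<chi> (h q j)"
proof -
  interpret I: left_module R "F I" by (rule left_module_free)
  note hr = left_module_homD[OF left_module_free left_module_free h]
  have "\<chi> (h (p \<ominus>\<^bsub>F I\<^esub> q) j) = 0"
    using I.M.minus_closed[OF p q] p q eq by (intro chi_hom[OF h]) (auto simp: minus_free chi_minus)
  moreover have "h (p \<ominus>\<^bsub>F I\<^esub> q) = (\<lambda>i. h p i \<ominus> h q i)"
    using hr(6)[OF p q] minus_free[OF hr(1)[OF p] hr(1)[OF q]] by simp
  ultimately show ?thesis
    using free_coord[OF hr(1)[OF p], of j] free_coord[OF hr(1)[OF q], of j] by (simp add: chi_minus)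
qed

definition derivation_cover ::
  "'r \<Rightarrow> ('r, 'm) module \<Rightarrow> ('m \<Rightarrow> 'm) \<Rightarrow> 'i set \<Rightarrow> (('i \<Rightarrow> 'r) \<Rightarrow> 'm) \<Rightarrow>
     (('i \<Rightarrow> 'r) \<Rightarrow> 'i \<Rightarrow> 'r) \<Rightarrow> bool" where
  "derivation_cover a M D I e D' \<longleftrightarrow> (let P = F I in
     e \<in> left_module_hom R P M \<and> e ` carrier P = carrier M \<and> derivation R a P D' \<and>
     bij_betw D' {p \<in> carrier P. e p = \<zero>\<^bsub>M\<^esub>} {p \<in> carrier P. e p = \<zero>\<^bsub>M\<^esub>} \<and>
     (\<forall>p\<in>carrier P. e (D' p) = D (e p)) \<and>
     (\<forall>p\<in>carrier P. (\<forall>i. \<chi> (D' p i) = 0) \<longrightarrow> (\<forall>i. \<chi> (p i) = 0)) \<and>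
     (\<forall>p\<in>carrier P. \<exists>q\<in>carrier P. \<forall>i. \<chi> (D' q i) = \<chi> (p i)))"

lemma derivation_coverD:
  assumes "derivation_cover a M D I e D'"
  shows "e \<in> left_module_hom R (F I) M"
    and "e ` carrier (F I) = carrier M"
    and "derivation R a (F I) D'"
    and "bij_betw D' {p \<in> carrier (F I). e p = \<zero>\<^bsub>M\<^esub>}
           {p \<in> carrier (F I). e p = \<zero>\<^bsub>M\<^esub>}"
    and "p \<in> carrier (F I) \<Longrightarrow> e (D' p) = D (e p)"
    and "\<lbrakk>p \<in> carrier (F I); \<And>i. \<chi> (D' p i) = 0\<rbrakk> \<Longrightarrow> \<chi> (p i) = 0"
    and "p \<in> carrier (F I) \<Longrightarrow>
           \<exists>q\<in>carrier (F I). \<forall>i. \<chi> (D' q i) = \<chi> (p i)"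
  using assms unfolding derivation_cover_def Let_def by blast+

lemma derivation_cover_exists:
  fixes enc :: "'m \<Rightarrow> 'i"
  assumes "left_module R M" and a: "a \<in> carrier R" "ad_nilpotent R a"
    and D: "derivation R a M D" "bij_betw D (carrier M) (carrier M)"
    and enc: "inj_on enc (carrier M)"
  obtains I :: "'i set" and e D' where "derivation_cover a M D I e D'"
proof -
  interpret M: left_module R M by fact
  define I where "I = enc ` carrier M"
  let ?P = "F I"
  interpret P: left_module R ?P by (rule left_module_free)
  define dec where "dec = inv_into (carrier M) enc"
  have dec: "dec i \<in> carrier M" "enc (dec i) = i" if "i \<in> I" for i
    using that unfolding I_def dec_def by (auto intro: inv_into_into f_inv_into_f)
  have dec_enc: "dec (enc m) = m" if "m \<in> carrier M" for m
    using that enc unfolding dec_def by simp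
  note Dr = M.derivationD[OF D(1)]
  define E where "E = inv_into (carrier M) D"
  have E: "E m \<in> carrier M" "D (E m) = m" "E (D m) = m" if "m \<in> carrier M" for m
    using that D(2) unfolding E_def bij_betw_def by (auto intro: inv_into_into f_inv_into_f)
  define e where "e = lin_ext R M dec"
  define \<pi> where "\<pi> i = enc (D (dec i))" for i
  define \<pi>' where "\<pi>' i = enc (E (dec i))" for i
  have \<pi>: "\<pi> i \<in> I" "\<pi>' i \<in> I" "\<pi> (\<pi>' i) = i" "\<pi>' (\<pi> i) = i" if "i \<in> I" for i
    using dec[OF that] Dr(1) E unfolding \<pi>_def \<pi>'_def by (auto simp: I_def dec_enc)
  have \<pi>_eq: "\<pi>' j = i \<longleftrightarrow> j = \<pi> i" if "i \<in> I" "j \<in> I" for i j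
    using \<pi> that by metis
  define T where "T f = (\<lambda>i. ad R a (f i))" for f :: "'i \<Rightarrow> 'r"
  define D' where "D' f = (\<lambda>i. if i \<in> I then ad R a (f i) \<oplus> f (\<pi>' i) else \<zero>)" for f :: "'i \<Rightarrow> 'r"
  have e_hom: "e \<in> left_module_hom R ?P M" and e_mon: "\<And>i. i \<in> I \<Longrightarrow> e (monomial R \<one> i) = dec i"
    unfolding e_def by (intro lin_ext_hom assms dec; assumption)+
  note er = left_module_homD[OF left_module_free assms(1) e_hom]
  have e_mon': "e (monomial R r i) = r \<odot>\<^bsub>M\<^esub> dec i" if "r \<in> carrier R" "i \<in> I" for r i
    using er(3)[of r "monomial R \<one> i"] monomial_eq_smult[of r i I] that e_mon by simp
  have e_surj: "e ` carrier ?P = carrier M"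
  proof
    show "carrier M \<subseteq> e ` carrier ?P"
    proof
      fix m assume m: "m \<in> carrier M"
      then have "e (monomial R \<one> (enc m)) = m"
        using e_mon by (simp add: I_def dec_enc)
      moreover have "monomial R \<one> (enc m) \<in> carrier ?P"
        using m by (simp add: I_def)
      ultimately show "m \<in> e ` carrier ?P" by (metis imageI)
    qed
  qed (use er(1) in auto)
  have T_closed: "T f \<in> carrier ?P" if "f \<in> carrier ?P" for f
    using that a unfolding T_def
    by (auto simp: carrier_free elim!: finite_subset[rotated])
  have D'_closed: "D' f \<in> carrier ?P" if f: "f \<in> carrier ?P" for f
  proof -
    have "{i. D' f i \<noteq> \<zero>} \<subseteq> {i. f i \<noteq> \<zero>} \<union> \<pi> ` {i. f i \<noteq> \<zero>}"
    proof
      fix i assume i: "i \<in> {i. D' f i \<noteq> \<zero>}"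
      then have iI: "i \<in> I" by (auto simp: D'_def split: if_splits)
      then have "f i \<noteq> \<zero> \<or> f (\<pi>' i) \<noteq> \<zero>"
        using i a by (auto simp: D'_def)
      then show "i \<in> {i. f i \<noteq> \<zero>} \<union> \<pi> ` {i. f i \<noteq> \<zero>}"
        using \<pi>(3)[OF iI] by (metis (mono_tags) Un_iff imageI mem_Collect_eq)
    qed
    then have "finite {i. D' f i \<noteq> \<zero>}"
      using free_finite[OF f] by (meson finite_UnI finite_imageI finite_subset)
    then show ?thesis
      using f a \<pi> by (auto simp: carrier_free D'_def)
  qed
  have D'_add: "D' (\<lambda>i. f i \<oplus> g i) = (\<lambda>i. D' f i \<oplus> D' g i)"
    if "f \<in> carrier ?P" "g \<in> carrier ?P" for f g
    using that a by (auto simp: D'_def fun_eq_iff ad_add a_ac)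
  have D'_deriv: "derivation R a ?P D'"
    unfolding derivation_def
  proof (intro conjI ballI)
    fix r f assume r: "r \<in> carrier R" "f \<in> carrier ?P"
    have "ad R a (r \<otimes> f i) \<oplus> r \<otimes> f (\<pi>' i) = (ad R a r \<otimes> f i) \<oplus> r \<otimes> (ad R a (f i) \<oplus> f (\<pi>' i))" for i
      using r a by (simp add: ad_mult r_distr a_assoc)
    moreover have "f i = \<zero>" if "i \<notin> I" for i
      using r that by (simp add: carrier_free)
    ultimately show "D' (r \<odot>\<^bsub>?P\<^esub> f) = ad R a r \<odot>\<^bsub>?P\<^esub> f \<oplus>\<^bsub>?P\<^esub> r \<odot>\<^bsub>?P\<^esub> D' f"
      using r a by (auto simp: D'_def fun_eq_iff)
  qed (use D'_closed D'_add in auto)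
  note D'r = P.derivationD[OF D'_deriv]
  have D'_mon: "D' (monomial R r i) = monomial R (ad R a r) i \<oplus>\<^bsub>?P\<^esub> monomial R r (\<pi> i)"
    if "r \<in> carrier R" "i \<in> I" for r i
    using that a \<pi>_eq \<pi>(1) by (auto simp: D'_def monomial_def fun_eq_iff)
  have eD': "e (D' p) = D (e p)" if "p \<in> carrier ?P" for p
    using that
  proof (induction rule: free_induct)
    case zero
    show ?case using D'r(4) er(4) Dr(4) by simp
  next
    case (add f r i)
    have "e (D' (monomial R r i)) = ad R a r \<odot>\<^bsub>M\<^esub> dec i \<oplus>\<^bsub>M\<^esub> r \<odot>\<^bsub>M\<^esub> dec (\<pi> i)"
      using add.hyps a \<pi> by (simp add: D'_mon er(2) e_mon' del: add_free)
    also have "\<dots> = D (e (monomial R r i))"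
      using add.hyps dec Dr(1,3) by (simp add: e_mon' \<pi>_def dec_enc)
    finally have m: "e (D' (monomial R r i)) = D (e (monomial R r i))" .
    have "e (D' (f \<oplus>\<^bsub>?P\<^esub> monomial R r i)) = e (D' f) \<oplus>\<^bsub>M\<^esub> e (D' (monomial R r i))"
      using add.hyps by (simp add: D'r(1,2) er(2) del: add_free)
    also have "\<dots> = D (e (f \<oplus>\<^bsub>?P\<^esub> monomial R r i))"
      using add.hyps by (simp add: m add.IH er(1,2) Dr(2) del: add_free)
    finally show ?case .
  qed
  have nil: "r \<in> iter_zero (carrier R) (ad R a) \<zero>" if "r \<in> carrier R" for r
    using a(2) that by (auto simp: ad_nilpotent_def)
  have T_add: "T (f \<oplus>\<^bsub>?P\<^esub> g) = T f \<oplus>\<^bsub>?P\<^esub> T g" if "f \<in> carrier ?P" "g \<in> carrier ?P" for f g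
    using that a by (auto simp: T_def ad_add)
  have nil_mon: "monomial R r i \<in> iter_zero (carrier ?P) T \<zero>\<^bsub>?P\<^esub>"
    if "r \<in> carrier R" and i: "i \<in> I" for r i
    using nil[OF that(1)]
  proof induction
    case zero
    have "monomial R \<zero> i = \<zero>\<^bsub>?P\<^esub>" by (auto simp: monomial_def)
    then show ?case by (simp add: iter_zero.zero)
  next
    case (step r)
    have "T (monomial R r i) = monomial R (ad R a r) i"
      using a by (auto simp: T_def monomial_def)
    then show ?case using step i by (intro iter_zero.step[of "monomial R r i"]) auto
  qed
  have nilP: "f \<in> iter_zero (carrier ?P) T \<zero>\<^bsub>?P\<^esub>" if "f \<in> carrier ?P" for f
    using that
  proof (induction rule: free_induct)
    case zero
    show ?case using iter_zero.zero[of "\<zero>\<^bsub>?P\<^esub>"] by simp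
  next
    case (add f r i)
    then show ?case
      by (intro P.M.iter_zero_add T_closed T_add nil_mon)
  qed
  have TD': "D' (T f) = T (D' f)" if "f \<in> carrier ?P" for f
    using that a by (auto simp: T_def D'_def fun_eq_iff ad_add)
  have D'_inj0: "f = \<zero>\<^bsub>?P\<^esub>" if "f \<in> carrier ?P" "D' f = \<zero>\<^bsub>?P\<^esub>" for f
    using nilP[OF that(1)] that(2)
  proof induction
    case (step f)
    have "T \<zero>\<^bsub>?P\<^esub> = \<zero>\<^bsub>?P\<^esub>" using a by (simp add: T_def)
    then have "T f = \<zero>\<^bsub>?P\<^esub>" using step TD' by metis
    then have T0: "ad R a (f i) = \<zero>" for i by (auto simp: T_def dest: fun_cong)
    have "f i = \<zero>" for i
    proof (cases "i \<in> I")
      case True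
      have "D' f (\<pi> i) = \<zero>" using step by simp
      then show ?thesis using True \<pi> step(1) by (simp add: D'_def T0)
    next
      case False
      then show ?thesis using step(1) by (simp add: carrier_free)
    qed
    then show ?case by auto
  qed simp
  have D'_inj: "f = g" if "f \<in> carrier ?P" "g \<in> carrier ?P" "D' f = D' g" for f g
  proof -
    have "f \<ominus>\<^bsub>?P\<^esub> g = \<zero>\<^bsub>?P\<^esub>"
    proof (rule D'_inj0[OF P.M.minus_closed])
      show "D' (f \<ominus>\<^bsub>?P\<^esub> g) = \<zero>\<^bsub>?P\<^esub>"
        using D'r(5)[OF that(1,2)] that(3) P.M.r_neg[OF D'r(1)[OF that(2)]]
        by (simp add: P.M.minus_eq)
    qed (use that in auto)
    then show ?thesis using that(1,2) by (rule P.M.minus_eq_zeroD)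
  qed
  have surj_mon: "\<forall>i\<in>I. monomial R r i \<in> D' ` carrier ?P" if "r \<in> carrier R" for r
    using nil[OF that]
  proof induction
    case zero
    have "monomial R \<zero> i = D' \<zero>\<^bsub>?P\<^esub>" for i using D'r(4) by (auto simp: monomial_def)
    then show ?case by blast
  next
    case (step r)
    show ?case
    proof
      fix i assume i: "i \<in> I"
      obtain y where y: "y \<in> carrier ?P" "monomial R (ad R a r) (\<pi>' i) = D' y"
        using step.IH \<pi>(2)[OF i] by auto
      have m: "monomial R r (\<pi>' i) \<in> carrier ?P" "monomial R r i \<in> carrier ?P" using step(1) \<pi> i by auto
      have "D' (monomial R r (\<pi>' i) \<ominus>\<^bsub>?P\<^esub> y) = (D' y \<oplus>\<^bsub>?P\<^esub> monomial R r i) \<ominus>\<^bsub>?P\<^esub> D' y"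
        using m y(1) D'r(5) D'_mon[OF step(1) \<pi>(2)[OF i]] \<pi>(3)[OF i] y(2) by simp
      also have "\<dots> = monomial R r i"
        by (rule P.M.add_minus_cancel[OF D'r(1)[OF y(1)] m(2)])
      finally show "monomial R r i \<in> D' ` carrier ?P"
        using P.M.minus_closed[OF m(1) y(1)] by (metis imageI)
    qed
  qed
  have D'_surj: "f \<in> D' ` carrier ?P" if "f \<in> carrier ?P" for f
    using that
  proof (induction rule: free_induct)
    case zero
    show ?case using imageI[OF P.M.zero_closed, of D'] D'r(4) by simp
  next
    case (add f r i)
    obtain g where g: "g \<in> carrier ?P" "f = D' g" using add.IH by blast
    obtain h where h: "h \<in> carrier ?P" "monomial R r i = D' h"
      using surj_mon[OF add.hyps(2)] add.hyps(3) by blast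
    from g h show ?case
      using D'r(2)[of g h] imageI[OF P.M.a_closed[of g h], of D'] by simp
  qed
  let ?K = "{p \<in> carrier ?P. e p = \<zero>\<^bsub>M\<^esub>}"
  have "bij_betw D' ?K ?K"
    unfolding bij_betw_def
  proof
    show "inj_on D' ?K" using D'_inj by (auto intro: inj_onI)
    show "D' ` ?K = ?K"
    proof
      show "?K \<subseteq> D' ` ?K"
      proof
        fix k assume k: "k \<in> ?K"
        then obtain f where f: "f \<in> carrier ?P" "k = D' f" using D'_surj by blast
        have "D (e f) = D \<zero>\<^bsub>M\<^esub>" using f k eD' Dr(4) by auto
        then have "e f = \<zero>\<^bsub>M\<^esub>"
          using inj_onD[OF bij_betw_imp_inj_on[OF D(2)] _ er(1)[OF f(1)] M.M.zero_closed] by simp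
        then show "k \<in> D' ` ?K" using f by blast
      qed
    qed (use D'r(1) eD' Dr(4) in auto)
  qed
  moreover have "\<chi> (p i) = 0" if p: "p \<in> carrier ?P" "\<And>i. \<chi> (D' p i) = 0" for p i
  proof (cases "i \<in> I")
    case True
    have "\<chi> (D' p (\<pi> i)) = 0" using p by blast
    then show ?thesis using True \<pi> p a by (simp add: D'_def chi_add)
  next
    case False
    then show ?thesis using p by (simp add: carrier_free)
  qed
  moreover have "\<exists>q\<in>carrier ?P. \<forall>i. \<chi> (D' q i) = \<chi> (p i)" if p: "p \<in> carrier ?P" for p
  proof -
    let ?q = "\<lambda>i. if i \<in> I then p (\<pi> i) else \<zero>"
    have "{i. ?q i \<noteq> \<zero>} \<subseteq> \<pi>' ` {i. p i \<noteq> \<zero>}"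
      using \<pi> by (force split: if_splits)
    then have "finite {i. ?q i \<noteq> \<zero>}"
      using free_finite[OF p] by (meson finite_imageI finite_subset)
    then have q: "?q \<in> carrier ?P"
      using p \<pi> by (auto simp: carrier_free)
    have "\<chi> (D' ?q i) = \<chi> (p i)" for i
      using p q a \<pi> by (auto simp: D'_def chi_add carrier_free)
    with q show ?thesis by blast
  qed
  ultimately have "derivation_cover a M D I e D'"
    unfolding derivation_cover_def Let_def using e_hom e_surj D'_deriv eD' by blast
  then show ?thesis by (rule that)
qed

end

lemma inj_on_finite_support:
  fixes z :: 'r
  obtains enc :: "(('r \<times> 'm) list \<Rightarrow> 'r) \<Rightarrow> ('r \<times> 'm) list"
  where "inj_on enc {f. finite {i. f i \<noteq> z}}"
proof -
  let ?F = "{f :: ('r \<times> 'm) list \<Rightarrow> 'r. finite {i. f i \<noteq> z}}"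
  let ?L = "UNIV :: ('r \<times> 'm) list set"
  have infL: "infinite ?L" by (rule infinite_UNIV_listI)
  have "inj_on (\<lambda>f. {(i, f i) |i. f i \<noteq> z}) ?F"
  proof (rule inj_onI)
    fix f g assume "{(i, f i) |i. f i \<noteq> z} = {(i, g i) |i. g i \<noteq> z}"
    then have *: "(i, x) \<in> {(i, f i) |i. f i \<noteq> z} \<longleftrightarrow> (i, x) \<in> {(i, g i) |i. g i \<noteq> z}" for i x
      by simp
    show "f = g"
    proof
      fix i
      show "f i = g i"
        using *[of i "f i"] *[of i "g i"] by auto
    qed
  qed
  moreover have "(\<lambda>f. {(i, f i) |i. f i \<noteq> z}) ` ?F \<subseteq> Fpow (?L \<times> UNIV)"
    by (auto simp: Fpow_def)
  ultimately have 1: "?F \<lesssim> Fpow (?L \<times> (UNIV :: 'r set))"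
    by (auto simp: lepoll_def)
  have "infinite (?L \<times> (UNIV :: 'r set))"
    using infL by (metis UNIV_not_empty finite_cartesian_productD1)
  then have 2: "Fpow (?L \<times> (UNIV :: 'r set)) \<approx> ?L \<times> (UNIV :: 'r set)"
    by (rule eqpoll_Fpow)
  have "inj_on (\<lambda>r. [(r, undefined :: 'm)]) (UNIV :: 'r set)"
    by (auto intro: inj_onI)
  then have "(UNIV :: 'r set) \<lesssim> ?L"
    unfolding lepoll_def by blast
  then have 3: "?L \<times> (UNIV :: 'r set) \<lesssim> ?L \<times> ?L"
    by (intro times_lepoll_mono lepoll_refl)
  have "?L \<times> ?L \<approx> ?L"
    using card_of_Times_same_infinite[OF infL] by (simp add: eqpoll_iff_card_of_ordIso)
  with 1 2 3 have "?F \<lesssim> ?L"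
    by (meson eqpoll_imp_lepoll lepoll_trans)
  then show ?thesis
    using that unfolding lepoll_def by blast
qed

context ring_character
begin

lemma derivation_resolution:
  fixes M :: "('r, 'm) module"
  assumes "left_module R M" and a: "a \<in> carrier R" "ad_nilpotent R a"
    and D: "derivation R a M D" "bij_betw D (carrier M) (carrier M)"
  obtains B :: "nat \<Rightarrow> ('r \<times> 'm) list set" and d e \<Delta> where "resolution R M B d e"
    and "\<And>k. derivation R a (F (B k)) (\<Delta> k)"
    and "\<And>p. p \<in> carrier (F (B 0)) \<Longrightarrow> e (\<Delta> 0 p) = D (e p)"
    and "\<And>k p. p \<in> carrier (F (B (Suc k))) \<Longrightarrow> d k (\<Delta> (Suc k) p) = \<Delta> k (d k p)"
    and "\<And>k p i. \<lbrakk>p \<in> carrier (F (B k)); \<And>i. \<chi> (\<Delta> k p i) = 0\<rbrakk> \<Longrightarrow> \<chi> (p i) = 0"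
    and "\<And>k p. p \<in> carrier (F (B k)) \<Longrightarrow>
           \<exists>q\<in>carrier (F (B k)). \<forall>i. \<chi> (\<Delta> k q i) = \<chi> (p i)"
proof -
  let ?P = "\<lambda>I :: ('r \<times> 'm) list set. F I"
  obtain enc :: "(('r \<times> 'm) list \<Rightarrow> 'r) \<Rightarrow> ('r \<times> 'm) list"
    where enc: "inj_on enc {f. finite {i. f i \<noteq> \<zero>}}"
    by (rule inj_on_finite_support)
  define good where "good = (\<lambda>(I, K, \<Delta>). left_module R (?P I\<lparr>carrier := K\<rparr>) \<and>
     K \<subseteq> carrier (?P I) \<and> derivation R a (?P I) \<Delta> \<and> bij_betw \<Delta> K K)"
  define start where "start = (\<lambda>(e, I, K, \<Delta>). derivation_cover a M D I e \<Delta> \<and>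
     K = {p \<in> carrier (?P I). e p = \<zero>\<^bsub>M\<^esub>})"
  define rel where "rel = (\<lambda>\<delta> (I, K, \<Delta>) (I', K', \<Delta>').
     \<delta> \<in> left_module_hom R (?P I') (?P I) \<and>
     derivation_cover a (?P I\<lparr>carrier := K\<rparr>) \<Delta> I' \<delta> \<Delta>' \<and>
     K' = {p \<in> carrier (?P I'). \<delta> p = (\<lambda>_. \<zero>)})"
  have "inj_on (\<lambda>m. [(\<zero>, m)]) (carrier M)"
    by (auto intro: inj_onI)
  then obtain I0 :: "('r \<times> 'm) list set" and e0 \<Delta>0 where c0: "derivation_cover a M D I0 e0 \<Delta>0"
    by (rule derivation_cover_exists[OF assms])
  let ?s0 = "(I0, {p \<in> carrier (?P I0). e0 p = \<zero>\<^bsub>M\<^esub>}, \<Delta>0)"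
  have s0: "start (e0, ?s0)"
    using c0 unfolding start_def by simp
  have g0: "good ?s0"
    using derivation_coverD(3,4)[OF c0]
      left_module_kernel[OF left_module_free assms(1) derivation_coverD(1)[OF c0]]
    unfolding good_def by simp
  have step: "\<exists>t. good t \<and> (\<exists>\<delta>. rel \<delta> s t)" if "good s" for s
  proof -
    obtain I K \<Delta> where s: "s = (I, K, \<Delta>)" by (cases s)
    let ?K = "?P I\<lparr>carrier := K\<rparr>"
    have gd: "left_module R ?K" "K \<subseteq> carrier (?P I)" "derivation R a (?P I) \<Delta>" "bij_betw \<Delta> K K"
      using that unfolding s good_def by auto
    have "derivation R a ?K \<Delta>"
      using gd(2,3,4) unfolding derivation_def by (auto simp: bij_betw_def subset_iff)
    moreover have "bij_betw \<Delta> (carrier ?K) (carrier ?K)"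
      using gd(4) by simp
    moreover have "inj_on enc (carrier ?K)"
      using gd(2) free_finite by (intro inj_on_subset[OF enc]) auto
    ultimately obtain I' :: "('r \<times> 'm) list set" and \<delta> \<Delta>'
      where c: "derivation_cover a ?K \<Delta> I' \<delta> \<Delta>'"
      by (rule derivation_cover_exists[OF gd(1) a])
    have \<delta>: "\<delta> \<in> left_module_hom R (?P I') (?P I)"
      using derivation_coverD(1)[OF c] gd(2) unfolding left_module_hom_def hom_def by auto
    have "good (I', {p \<in> carrier (?P I'). \<delta> p = (\<lambda>_. \<zero>)}, \<Delta>')"
      using derivation_coverD(3,4)[OF c]
        left_module_kernel[OF left_module_free left_module_free \<delta>] unfolding good_def by simp
    moreover have "rel \<delta> s (I', {p \<in> carrier (?P I'). \<delta> p = (\<lambda>_. \<zero>)}, \<Delta>')"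
      using c \<delta> unfolding rel_def s by simp
    ultimately show ?thesis by blast
  qed
  obtain S where S0: "start (e0, S 0)" and S: "\<And>k. \<exists>\<delta>. rel \<delta> (S k) (S (Suc k))"
  proof -
    have "\<exists>f. \<forall>n. (good (f n) \<and> (n = 0 \<longrightarrow> start (e0, f n))) \<and> (\<exists>\<delta>. rel \<delta> (f n) (f (Suc n)))"
    proof (rule dependent_nat_choice)
      show "\<exists>s. good s \<and> (0 = (0::nat) \<longrightarrow> start (e0, s))"
        using s0 g0 by blast
    qed (use step in blast)
    then show thesis using that by blast
  qed
  obtain d where d: "\<And>k. rel (d k) (S k) (S (Suc k))" using S by metis
  define B where "B k = fst (S k)" for k
  define K where "K k = fst (snd (S k))" for k
  define \<Delta> where "\<Delta> k = snd (snd (S k))" for k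
  have S_eq: "S k = (B k, K k, \<Delta> k)" for k by (simp add: B_def K_def \<Delta>_def)
  have st: "derivation_cover a M D (B 0) e0 (\<Delta> 0)" "K 0 = {p \<in> carrier (?P (B 0)). e0 p = \<zero>\<^bsub>M\<^esub>}"
    using S0 unfolding S_eq start_def by auto
  have rl: "d k \<in> left_module_hom R (?P (B (Suc k))) (?P (B k))"
    "derivation_cover a (?P (B k)\<lparr>carrier := K k\<rparr>) (\<Delta> k) (B (Suc k)) (d k) (\<Delta> (Suc k))"
    "K (Suc k) = {p \<in> carrier (?P (B (Suc k))). d k p = (\<lambda>_. \<zero>)}" for k
    using d[of k] unfolding S_eq rel_def by auto
  note c0 = derivation_coverD[OF st(1)]
  note cS = derivation_coverD[OF rl(2)]
  have im: "d k ` carrier (?P (B (Suc k))) = K k" for k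
    using cS(2)[of k] by simp
  have "free_resolution R M B d e0"
    using c0(1,2) rl(1) im st(2) rl(3) unfolding free_resolution_def Let_def by simp
  then have "resolution R M B d e0"
    using assms(1) by (intro resolution.intro resolution_axioms.intro ring_axioms)
  then show ?thesis
  proof (rule that)
    show "e0 (\<Delta> 0 p) = D (e0 p)" if "p \<in> carrier (?P (B 0))" for p
      using that by (rule c0(5))
    fix k
    show "d k (\<Delta> (Suc k) p) = \<Delta> k (d k p)" if "p \<in> carrier (?P (B (Suc k)))" for p
      using that by (rule cS(5))
    show "derivation R a (?P (B k)) (\<Delta> k)"
      by (cases k) (use c0(3) cS(3) in auto)
    show "\<chi> (p i) = 0" if "p \<in> carrier (?P (B k))" "\<And>i. \<chi> (\<Delta> k p i) = 0" for p i
    proof (cases k)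
      case 0
      then show ?thesis using c0(6)[of p i] that by simp
    next
      case (Suc j)
      then show ?thesis using cS(6)[of p j i] that by simp
    qed
    show "\<exists>q\<in>carrier (?P (B k)). \<forall>i. \<chi> (\<Delta> k q i) = \<chi> (p i)" if "p \<in> carrier (?P (B k))" for p
    proof (cases k)
      case 0
      then show ?thesis using c0(7)[of p] that by simp
    next
      case (Suc j)
      then show ?thesis using cS(7)[of p j] that by simp
    qed
  qed
qed

lemma free_resolution_exists:
  fixes M :: "('r, 'm) module"
  assumes "left_module R M"
  obtains B :: "nat \<Rightarrow> ('r \<times> 'm) list set" and d e where "resolution R M B d e"
proof -
  interpret M: left_module R M by fact
  have ad0: "ad R \<zero> r = \<zero>" if "r \<in> carrier R" for r
    using that unfolding ad_def by algebra
  then have 1: "derivation R \<zero> M (\<lambda>m. m)"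
    by (auto simp: derivation_def)
  have 2: "ad_nilpotent R \<zero>"
    unfolding ad_nilpotent_def
    by (auto simp: ad0 iter_zero.zero intro: iter_zero.step[of _ "carrier R" "ad R \<zero>" \<zero>])
  show ?thesis
    by (rule derivation_resolution[OF assms zero_closed 2 1 bij_betw_id[unfolded id_def]]) (erule that)
qed

text \<open>The functions \<open>\<chi> \<circ> p\<close>, for \<open>p\<close> in a free module \<open>P\<close>, represent the elements of
  \<open>\<complex>\<^sub>\<chi> \<otimes> P\<close>.\<close>

definition chi_exact ::
  "(nat \<Rightarrow> 'i set) \<Rightarrow> (nat \<Rightarrow> ('i \<Rightarrow> 'r) \<Rightarrow> 'i \<Rightarrow> 'r) \<Rightarrow> nat \<Rightarrow> bool" where
  "chi_exact B d k \<longleftrightarrow> (\<forall>p\<in>carrier (F (B k)).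
     (\<forall>j i. k = Suc j \<longrightarrow> \<chi> (d j p i) = 0) \<longrightarrow>
     (\<exists>q\<in>carrier (F (B (Suc k))). \<forall>i. \<chi> (d k q i) = \<chi> (p i)))"

lemma chi_exact_transfer:
  assumes "resolution R M B d e" "resolution R M B' d' e'" and exact: "chi_exact B' d' k"
  shows "chi_exact B d k"
proof -
  interpret P: resolution R M B d e by fact
  interpret Q: resolution R M B' d' e' by fact
  obtain f where f: "\<And>k. f k \<in> left_module_hom R (P.P k) (Q.P k)"
    "\<And>p. p \<in> carrier (P.P 0) \<Longrightarrow> e' (f 0 p) = e p"
    "\<And>k p. p \<in> carrier (P.P (Suc k)) \<Longrightarrow> d' k (f (Suc k) p) = f k (d k p)"
    by (rule P.chain_map_exists[OF assms(2)]) blast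
  obtain g where g: "\<And>k. g k \<in> left_module_hom R (Q.P k) (P.P k)"
    "\<And>p. p \<in> carrier (Q.P 0) \<Longrightarrow> e (g 0 p) = e' p"
    "\<And>k p. p \<in> carrier (Q.P (Suc k)) \<Longrightarrow> d k (g (Suc k) p) = g k (d' k p)"
    by (rule Q.chain_map_exists[OF assms(1)]) blast
  note fr = left_module_homD[OF P.P.left_module_axioms Q.P.left_module_axioms f(1)]
  note gr = left_module_homD[OF Q.P.left_module_axioms P.P.left_module_axioms g(1)]
  define h where "h k p = g k (f k p) \<ominus>\<^bsub>P.P k\<^esub> p" for k p
  have h: "h k \<in> left_module_hom R (P.P k) (P.P k)" for k
    unfolding h_def
    by (intro left_module_hom_minus P.P.left_module_axioms left_module_hom_comp[OF f(1) g(1)])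
      (simp add: left_module_hom_def hom_def)
  obtain s where s: "\<And>k. s k \<in> left_module_hom R (P.P k) (P.P (Suc k))"
    "\<And>p. p \<in> carrier (P.P 0) \<Longrightarrow> d 0 (s 0 p) = h 0 p"
    "\<And>k p. p \<in> carrier (P.P (Suc k)) \<Longrightarrow>
      h (Suc k) p = d (Suc k) (s (Suc k) p) \<oplus>\<^bsub>P.P (Suc k)\<^esub> s k (d k p)"
  proof (rule P.homotopy_exists[OF assms(1) h])
    show "e (h 0 p) = \<zero>\<^bsub>M\<^esub>" if "p \<in> carrier (P.P 0)" for p
      using that fr(1)[of p 0] gr(1)[of "f 0 p" 0] P.e_rules(1)
      by (simp add: h_def P.e_rules(6) f(2) g(2) P.M.M.minus_eq P.M.M.r_neg)
    show "d k (h (Suc k) p) = h k (d k p)" if "p \<in> carrier (P.P (Suc k))" for k p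
      using that fr(1) gr(1) P.d_rules(1)[of p k]
      by (simp add: h_def P.d_rules(6) f(3) g(3))
  qed blast
  note sr = left_module_homD[OF P.P.left_module_axioms P.P.left_module_axioms s(1)]
  show ?thesis
    unfolding chi_exact_def
  proof (intro ballI impI)
    fix p assume p: "p \<in> carrier (P.P k)" and cyc: "\<forall>j i. k = Suc j \<longrightarrow> \<chi> (d j p i) = 0"
    have "\<forall>j i. k = Suc j \<longrightarrow> \<chi> (d' j (f k p) i) = 0"
      using p cyc by (auto simp: f(3) intro!: chi_hom[OF f(1)] P.d_rules(1))
    then obtain q where q: "q \<in> carrier (Q.P (Suc k))" "\<And>i. \<chi> (d' k q i) = \<chi> (f k p i)"
      using exact fr(1)[OF p] unfolding chi_exact_def by blast
    have gf: "g k (f k p) \<in> carrier (P.P k)" using p fr(1) gr(1) by blast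
    have gq: "\<chi> (d k (g (Suc k) q) i) = \<chi> (g k (f k p) i)" for i
      using q by (simp add: g(3) chi_hom_eq[OF g(1) Q.d_rules(1) fr(1)[OF p] q(2)])
    have hs: "\<chi> (h k p i) = \<chi> (d k (s k p) i)" for i
    proof (cases k)
      case 0
      then show ?thesis using s(2) p by simp
    next
      case (Suc j)
      have "\<chi> (s j (d j p) i) = 0" for i
        using p cyc Suc by (intro chi_hom[OF s(1)] P.d_rules(1)) auto
      moreover have "d k (s k p) \<in> carrier (P.P k)" "s j (d j p) \<in> carrier (P.P k)"
        using p P.d_rules(1) sr(1) unfolding Suc by auto
      ultimately show ?thesis
        using s(3)[of p j] p Suc by (simp add: chi_add)
    qed
    let ?q = "g (Suc k) q \<ominus>\<^bsub>P.P (Suc k)\<^esub> s k p"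
    have c: "g (Suc k) q \<in> carrier (P.P (Suc k))" "s k p \<in> carrier (P.P (Suc k))"
      using p q(1) gr(1) sr(1) by auto
    have "\<chi> (d k ?q i) = \<chi> (p i)" for i
    proof -
      have "\<chi> (d k ?q i) = \<chi> (d k (g (Suc k) q) i) - \<chi> (d k (s k p) i)"
        using P.d_rules(6)[OF c] minus_free[OF P.d_rules(1)[OF c(1)] P.d_rules(1)[OF c(2)]]
          free_coord[OF P.d_rules(1)[OF c(1)]] free_coord[OF P.d_rules(1)[OF c(2)]]
        by (simp add: chi_minus)
      also have "\<dots> = \<chi> (g k (f k p) i) - \<chi> (h k p i)"
        by (simp add: gq hs)
      also have "\<chi> (h k p i) = \<chi> (g k (f k p) i) - \<chi> (p i)"
        using minus_free[OF gf p] free_coord[OF gf] free_coord[OF p] by (simp add: h_def chi_minus)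
      finally show ?thesis by simp
    qed
    then show "\<exists>q\<in>carrier (P.P (Suc k)). \<forall>i. \<chi> (d k q i) = \<chi> (p i)"
      using P.P.M.minus_closed[OF c] by blast
  qed
qed

text \<open>With \<open>\<Delta>\<close> as in \<open>derivation_resolution\<close>, the difference of \<open>a\<close> and \<open>\<Delta>\<close> is linear and
  covers \<open>0\<close>, hence is null-homotopic; but \<open>a\<close> vanishes and \<open>\<Delta>\<close> is bijective after tensoring
  with \<open>\<complex>\<^sub>\<chi>\<close>.\<close>

lemma chi_exact_if_bij:
  fixes M :: "('r, 'm) module"
  assumes "resolution R M B d e" and a: "a \<in> carrier R" "ad_nilpotent R a" "\<chi> a = 0"
    and bij: "bij_betw (\<lambda>m. a \<odot>\<^bsub>M\<^esub> m) (carrier M) (carrier M)"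
  shows "chi_exact B d k"
proof -
  interpret M: left_module R M using assms(1) by (rule resolution.axioms)
  show ?thesis
  proof (rule derivation_resolution[OF M.left_module_axioms a(1,2) M.derivation_smult[OF a(1)] bij])
    fix B' :: "nat \<Rightarrow> ('r \<times> 'm) list set" and d' e' \<Delta>
    assume res: "resolution R M B' d' e'"
      and \<Delta>: "\<And>k. derivation R a (F (B' k)) (\<Delta> k)"
      and \<Delta>0: "\<And>p. p \<in> carrier (F (B' 0)) \<Longrightarrow> e' (\<Delta> 0 p) = a \<odot>\<^bsub>M\<^esub> (e' p)"
      and \<Delta>d: "\<And>k p. p \<in> carrier (F (B' (Suc k))) \<Longrightarrow> d' k (\<Delta> (Suc k) p) = \<Delta> k (d' k p)"
      and inj: "\<And>k p i. \<lbrakk>p \<in> carrier (F (B' k)); \<And>i. \<chi> (\<Delta> k p i) = 0\<rbrakk> \<Longrightarrow> \<chi> (p i) = 0"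
      and surj: "\<And>k p. p \<in> carrier (F (B' k)) \<Longrightarrow>
             \<exists>q\<in>carrier (F (B' k)). \<forall>i. \<chi> (\<Delta> k q i) = \<chi> (p i)"
    interpret Q: resolution R M B' d' e' by (rule res)
    note \<Delta>r = Q.P.derivationD[OF \<Delta>]
    note ar = Q.P.derivationD[OF Q.P.derivation_smult[OF a(1)]]
    define h where "h k p = a \<odot>\<^bsub>Q.P k\<^esub> p \<ominus>\<^bsub>Q.P k\<^esub> \<Delta> k p" for k p
    have h: "h k \<in> left_module_hom R (Q.P k) (Q.P k)" for k
    proof (rule left_module_homI[OF Q.P.left_module_axioms Q.P.left_module_axioms])
      fix p assume p: "p \<in> carrier (Q.P k)"
      show "h k p \<in> carrier (Q.P k)"
        using p a(1) \<Delta>r(1) unfolding h_def by (intro Q.P.M.minus_closed Q.P.smult_closed)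
      fix r assume r: "r \<in> carrier R"
      have "\<Delta> k (r \<odot>\<^bsub>Q.P k\<^esub> p) = ad R a r \<odot>\<^bsub>Q.P k\<^esub> p \<oplus>\<^bsub>Q.P k\<^esub> r \<odot>\<^bsub>Q.P k\<^esub> \<Delta> k p"
        "a \<odot>\<^bsub>Q.P k\<^esub> (r \<odot>\<^bsub>Q.P k\<^esub> p) = ad R a r \<odot>\<^bsub>Q.P k\<^esub> p \<oplus>\<^bsub>Q.P k\<^esub> r \<odot>\<^bsub>Q.P k\<^esub> (a \<odot>\<^bsub>Q.P k\<^esub> p)"
        using \<Delta>r(3)[OF r p] ar(3)[OF r p] by auto
      moreover have "x \<oplus>\<^bsub>Q.P k\<^esub> y \<ominus>\<^bsub>Q.P k\<^esub> (x \<oplus>\<^bsub>Q.P k\<^esub> z) = y \<ominus>\<^bsub>Q.P k\<^esub> z"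
        if "x \<in> carrier (Q.P k)" "y \<in> carrier (Q.P k)" "z \<in> carrier (Q.P k)" for x y z
        using that Q.P.M.add_minus_cancel[OF that(1), of "y \<ominus>\<^bsub>Q.P k\<^esub> z"]
        by (simp add: Q.P.M.minus_eq Q.P.M.minus_add Q.P.M.a_ac del: add_free)
      ultimately have "h k (r \<odot>\<^bsub>Q.P k\<^esub> p) = r \<odot>\<^bsub>Q.P k\<^esub> (a \<odot>\<^bsub>Q.P k\<^esub> p) \<ominus>\<^bsub>Q.P k\<^esub> r \<odot>\<^bsub>Q.P k\<^esub> \<Delta> k p"
        using r p a(1) \<Delta>r(1) unfolding h_def by (simp del: add_free smult_free)
      then show "h k (r \<odot>\<^bsub>Q.P k\<^esub> p) = r \<odot>\<^bsub>Q.P k\<^esub> h k p"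
        using r p a(1) \<Delta>r(1)
        by (simp add: h_def Q.P.M.minus_eq Q.P.smult_r_distr Q.P.smult_r_minus del: add_free smult_free)
    next
      fix p q assume pq: "p \<in> carrier (Q.P k)" "q \<in> carrier (Q.P k)"
      then show "h k (p \<oplus>\<^bsub>Q.P k\<^esub> q) = h k p \<oplus>\<^bsub>Q.P k\<^esub> h k q"
        using a(1) \<Delta>r(1)
        by (simp add: h_def \<Delta>r(2) Q.P.smult_r_distr Q.P.M.minus_eq Q.P.M.minus_add Q.P.M.a_ac
            del: add_free smult_free)
    qed
    obtain s where s: "\<And>k. s k \<in> left_module_hom R (Q.P k) (Q.P (Suc k))"
      "\<And>p. p \<in> carrier (Q.P 0) \<Longrightarrow> d' 0 (s 0 p) = h 0 p"
      "\<And>k p. p \<in> carrier (Q.P (Suc k)) \<Longrightarrow>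
        h (Suc k) p = d' (Suc k) (s (Suc k) p) \<oplus>\<^bsub>Q.P (Suc k)\<^esub> s k (d' k p)"
    proof (rule Q.homotopy_exists[OF res h])
      show "e' (h 0 p) = \<zero>\<^bsub>M\<^esub>" if "p \<in> carrier (Q.P 0)" for p
        using that \<Delta>r(1)[of p 0] a(1) Q.e_rules(1)[of p]
        by (simp add: h_def Q.e_rules(3,6) \<Delta>0 M.M.minus_eq M.M.r_neg del: add_free smult_free)
      show "d' k (h (Suc k) p) = h k (d' k p)" if "p \<in> carrier (Q.P (Suc k))" for k p
        using that \<Delta>r(1) a(1)
        by (simp add: h_def Q.d_rules(3,6) \<Delta>d del: add_free smult_free)
    qed blast
    note sr = left_module_homD[OF Q.P.left_module_axioms Q.P.left_module_axioms s(1)]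
    have "chi_exact B' d' k"
      unfolding chi_exact_def
    proof (intro ballI impI)
      fix p assume p: "p \<in> carrier (Q.P k)" and cyc: "\<forall>j i. k = Suc j \<longrightarrow> \<chi> (d' j p i) = 0"
      obtain q where q: "q \<in> carrier (Q.P k)" "\<And>i. \<chi> (\<Delta> k q i) = \<chi> (p i)"
        using surj[OF p] by blast
      have hq: "\<chi> (h k q i) = - \<chi> (p i)" for i
        using minus_free[OF Q.P.smult_closed[OF a(1) q(1)] \<Delta>r(1)[OF q(1)]]
          free_coord[OF \<Delta>r(1)[OF q(1)]] free_coord[OF q(1)] a
        by (simp add: h_def chi_minus chi_mult q(2))
      have hs: "\<chi> (h k q i) = \<chi> (d' k (s k q) i)" for i
      proof (cases k)
        case 0
        then show ?thesis using s(2) q(1) by simp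
      next
        case (Suc j)
        have "\<chi> (\<Delta> j (d' j q) i) = 0" for i
        proof -
          have "\<chi> (d' j (\<Delta> k q) i) = \<chi> (d' j p i)"
            using p q \<Delta>r(1)[OF q(1)] unfolding Suc by (intro chi_hom_eq[OF Q.d_hom]) auto
          then show ?thesis using cyc Suc \<Delta>d[of q j] q(1) by simp
        qed
        then have "\<chi> (d' j q i) = 0" for i
          using q(1) Suc by (intro inj[OF Q.d_rules(1)]) auto
        then have "\<chi> (s j (d' j q) i) = 0" for i
          using q(1) Suc by (intro chi_hom[OF s(1)] Q.d_rules(1)) auto
        moreover have "d' k (s k q) \<in> carrier (Q.P k)" "s j (d' j q) \<in> carrier (Q.P k)"
          using q(1) Q.d_rules(1) sr(1) unfolding Suc by auto
        ultimately show ?thesis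
          using s(3)[of q j] q(1) Suc by (simp add: chi_add)
      qed
      let ?q = "\<ominus>\<^bsub>Q.P (Suc k)\<^esub> s k q"
      have sq: "s k q \<in> carrier (Q.P (Suc k))" using q(1) sr(1) by blast
      have "\<chi> (d' k ?q i) = \<chi> (p i)" for i
      proof -
        have z: "\<zero>\<^bsub>Q.P k\<^esub> \<in> carrier (Q.P k)" by (rule Q.P.M.zero_closed)
        have "d' k ?q = \<zero>\<^bsub>Q.P k\<^esub> \<ominus>\<^bsub>Q.P k\<^esub> d' k (s k q)"
          using Q.d_rules(1,5)[OF sq] by (simp add: Q.P.M.minus_eq del: add_free zero_free)
        then have "d' k ?q i = \<zero> \<ominus> d' k (s k q) i"
          using minus_free[OF z Q.d_rules(1)[OF sq]] by simp
        then show ?thesis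
          using free_coord[OF Q.d_rules(1)[OF sq], of i] hs[of i, symmetric] hq[of i] by (simp add: chi_minus)
      qed
      then show "\<exists>q\<in>carrier (Q.P (Suc k)). \<forall>i. \<chi> (d' k q i) = \<chi> (p i)"
        using Q.P.M.a_inv_closed[OF sq] by blast
    qed
    with assms(1) res show "chi_exact B d k"
      by (rule chi_exact_transfer)
  qed
qed

end

section \<open>Tensor products with a one-dimensional right module\<close>

lemma image_eq_singletonI: "\<lbrakk>\<And>x. x \<in> A \<Longrightarrow> f x = y; a \<in> A\<rbrakk> \<Longrightarrow> f ` A = {y}"
  by auto

locale one_dim_right_module = ring_character R \<chi>
  for R :: "('r, 'x) ring_scheme" (structure) and \<chi> :: "'r \<Rightarrow> complex" +
  fixes N :: "('r, 'n) module" and n0 :: 'n and \<psi> :: "'n \<Rightarrow> complex"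
  assumes chi_surj: "\<exists>r\<in>carrier R. \<chi> r = c"
    and n0_closed [simp]: "n0 \<in> carrier N" and psi_n0 [simp]: "\<psi> n0 = 1"
    and N_add_closed: "\<lbrakk>n \<in> carrier N; n' \<in> carrier N\<rbrakk> \<Longrightarrow> n \<oplus>\<^bsub>N\<^esub> n' \<in> carrier N"
    and N_smult_closed: "\<lbrakk>r \<in> carrier R; n \<in> carrier N\<rbrakk> \<Longrightarrow> r \<odot>\<^bsub>N\<^esub> n \<in> carrier N"
    and psi_add: "\<lbrakk>n \<in> carrier N; n' \<in> carrier N\<rbrakk> \<Longrightarrow> \<psi> (n \<oplus>\<^bsub>N\<^esub> n') = \<psi> n + \<psi> n'"
    and psi_smult: "\<lbrakk>r \<in> carrier R; n \<in> carrier N\<rbrakk> \<Longrightarrow> \<psi> (r \<odot>\<^bsub>N\<^esub> n) = \<chi> r * \<psi> n"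
    and psi_inj: "\<lbrakk>n \<in> carrier N; n' \<in> carrier N; \<psi> n = \<psi> n'\<rbrakk> \<Longrightarrow> n = n'"
begin

abbreviation G :: "'i set \<Rightarrow> ('n \<times> ('i \<Rightarrow> 'r) \<Rightarrow>\<^sub>0 int) monoid" where
  "G I \<equiv> free_Abelian_group (carrier N \<times> carrier (F I))"

abbreviation rels :: "'i set \<Rightarrow> ('n \<times> ('i \<Rightarrow> 'r) \<Rightarrow>\<^sub>0 int) set" where
  "rels I \<equiv> tensor_relations R N (F I)"

definition cls :: "'i set \<Rightarrow> ('i \<Rightarrow> 'r) \<Rightarrow> ('n \<times> ('i \<Rightarrow> 'r) \<Rightarrow>\<^sub>0 int) set" where
  "cls I p = rels I #>\<^bsub>G I\<^esub> frag_of (n0, p)"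

lemma smult_n0: assumes "n \<in> carrier N" obtains r where "r \<in> carrier R" "n = r \<odot>\<^bsub>N\<^esub> n0"
proof -
  obtain r where r: "r \<in> carrier R" "\<chi> r = \<psi> n" using chi_surj by blast
  then have "n = r \<odot>\<^bsub>N\<^esub> n0"
    using assms by (intro psi_inj) (simp_all add: psi_smult N_smult_closed)
  with r that show ?thesis by blast
qed

lemma rels_add_left:
  "\<lbrakk>n \<in> carrier N; n' \<in> carrier N; p \<in> carrier (F I)\<rbrakk> \<Longrightarrow>
    frag_of (n \<oplus>\<^bsub>N\<^esub> n', p) - frag_of (n, p) - frag_of (n', p) \<in> rels I"
  unfolding tensor_relations_def by (rule generate.incl) blast

lemma rels_add_right:
  "\<lbrakk>n \<in> carrier N; p \<in> carrier (F I); q \<in> carrier (F I)\<rbrakk> \<Longrightarrow>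
    frag_of (n, p \<oplus>\<^bsub>F I\<^esub> q) - frag_of (n, p) - frag_of (n, q) \<in> rels I"
  unfolding tensor_relations_def by (rule generate.incl) blast

lemma rels_smult:
  "\<lbrakk>n \<in> carrier N; r \<in> carrier R; p \<in> carrier (F I)\<rbrakk> \<Longrightarrow>
    frag_of (r \<odot>\<^bsub>N\<^esub> n, p) - frag_of (n, r \<odot>\<^bsub>F I\<^esub> p) \<in> rels I"
  unfolding tensor_relations_def by (rule generate.incl) blast

lemma rels_subgroup: "subgroup (rels I) (G I)"
proof -
  interpret F: left_module R "F I" by (rule left_module_free)
  show ?thesis
    unfolding tensor_relations_def
    by (rule group.generate_is_subgroup)
      (auto simp: N_add_closed N_smult_closed simp del: add_free smult_free
        dest!: subsetD[OF keys_diff])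
qed

lemma rels_keys: "c \<in> rels I \<Longrightarrow> Poly_Mapping.keys c \<subseteq> carrier N \<times> carrier (F I)"
  using subsetD[OF subgroup.subset[OF rels_subgroup], of c I] by simp

lemma rels_zero [simp]: "0 \<in> rels I"
  using subgroup.one_closed[OF rels_subgroup] by simp

lemma rels_add: "\<lbrakk>a \<in> rels I; b \<in> rels I\<rbrakk> \<Longrightarrow> a + b \<in> rels I"
  using subgroup.m_closed[OF rels_subgroup] by simp

lemma rels_uminus: "a \<in> rels I \<Longrightarrow> - a \<in> rels I"
  using subgroup.m_inv_closed[OF rels_subgroup] rels_keys by force

lemma rels_diff: "\<lbrakk>a \<in> rels I; b \<in> rels I\<rbrakk> \<Longrightarrow> a - b \<in> rels I"
  using rels_add[OF _ rels_uminus] by force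

lemma r_coset_frag: "X #>\<^bsub>G I\<^esub> c = (\<lambda>h. h + c) ` X"
  by (auto simp: r_coset_def)

lemma r_coset_rels_eq_iff: "rels I #>\<^bsub>G I\<^esub> a = rels I #>\<^bsub>G I\<^esub> b \<longleftrightarrow> a - b \<in> rels I"
proof
  assume "rels I #>\<^bsub>G I\<^esub> a = rels I #>\<^bsub>G I\<^esub> b"
  then have "0 + a \<in> (\<lambda>h. h + b) ` rels I"
    unfolding r_coset_frag by (metis imageI rels_zero)
  then show "a - b \<in> rels I" by auto
next
  have sub: "(\<lambda>h. h + a) ` rels I \<subseteq> (\<lambda>h. h + b) ` rels I" if "a - b \<in> rels I" for a b
  proof
    fix x assume "x \<in> (\<lambda>h. h + a) ` rels I"
    then obtain h where h: "h \<in> rels I" "x = h + a" by blast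
    then have "x = (h + (a - b)) + b" by simp
    with rels_add[OF h(1) that] show "x \<in> (\<lambda>h. h + b) ` rels I" by blast
  qed
  assume "a - b \<in> rels I"
  moreover from this have "b - a \<in> rels I" using rels_uminus by force
  ultimately show "rels I #>\<^bsub>G I\<^esub> a = rels I #>\<^bsub>G I\<^esub> b"
    unfolding r_coset_frag using sub by blast
qed

lemma frag_of_zero: "n \<in> carrier N \<Longrightarrow> frag_of (n, \<zero>\<^bsub>F I\<^esub>) \<in> rels I"
proof -
  assume n: "n \<in> carrier N"
  interpret F: left_module R "F I" by (rule left_module_free)
  have "frag_of (n, \<zero>\<^bsub>F I\<^esub> \<oplus>\<^bsub>F I\<^esub> \<zero>\<^bsub>F I\<^esub>) - frag_of (n, \<zero>\<^bsub>F I\<^esub>) - frag_of (n, \<zero>\<^bsub>F I\<^esub>) \<in> rels I"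
    using n by (intro rels_add_right F.M.zero_closed)
  then show ?thesis
    using rels_uminus by (force simp del: add_free zero_free)
qed

lemma frag_of_chi_zero:
  assumes "p \<in> carrier (F I)" "\<And>i. \<chi> (p i) = 0"
  shows "frag_of (n0, p) \<in> rels I"
  using assms(1)
proof (induction rule: free_induct_chi_zero)
  case (chi i)
  show ?case by fact
next
  case zero
  show ?case using frag_of_zero[OF n0_closed, of I] by simp
next
  case (add p r i)
  have u: "monomial R \<one> i \<in> carrier (F I)" using add.hyps by simp
  have z: "\<zero> \<odot>\<^bsub>N\<^esub> n0 \<in> carrier N" by (intro N_smult_closed) auto
  have "r \<odot>\<^bsub>N\<^esub> n0 = \<zero> \<odot>\<^bsub>N\<^esub> n0"
    using add.hyps by (intro psi_inj N_smult_closed) (auto simp: psi_smult)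
  moreover have "frag_of (\<zero> \<odot>\<^bsub>N\<^esub> n0, monomial R \<one> i) \<in> rels I"
  proof -
    have "(\<zero> \<odot>\<^bsub>N\<^esub> n0) \<oplus>\<^bsub>N\<^esub> (\<zero> \<odot>\<^bsub>N\<^esub> n0) = \<zero> \<odot>\<^bsub>N\<^esub> n0"
      using z by (intro psi_inj N_add_closed) (auto simp: psi_add psi_smult)
    then show ?thesis
      using rels_uminus[OF rels_add_left[OF z z u]] by simp
  qed
  moreover have "frag_of (r \<odot>\<^bsub>N\<^esub> n0, monomial R \<one> i) - frag_of (n0, monomial R r i) \<in> rels I"
    using rels_smult[OF n0_closed add.hyps(2) u] monomial_eq_smult[OF add.hyps(2), of i I] by simp
  ultimately have "frag_of (n0, monomial R r i) \<in> rels I"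
    using rels_diff by force
  moreover note add.IH
  moreover have "frag_of (n0, p \<oplus>\<^bsub>F I\<^esub> monomial R r i) - frag_of (n0, p) - frag_of (n0, monomial R r i) \<in> rels I"
    using add.hyps by (intro rels_add_right) auto
  ultimately show ?case
    using rels_add by (metis diff_add_cancel)
qed

text \<open>Coordinates on the tensor product, which show that \<open>frag_of_chi_zero\<close> is sharp.\<close>

definition coord :: "'i \<Rightarrow> ('n \<times> ('i \<Rightarrow> 'r) \<Rightarrow>\<^sub>0 int) \<Rightarrow> complex" where
  "coord i c = (\<Sum>x\<in>Poly_Mapping.keys c.
     of_int (Poly_Mapping.lookup c x) * (\<psi> (fst x) * \<chi> (snd x i)))"

lemma coord_add: "coord i (a + b) = coord i a + coord i b"
  unfolding coord_def by (rule setsum_keys_plus_distrib) (auto simp: algebra_simps)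

lemma coord_uminus: "coord i (- a) = - coord i a"
proof -
  have "coord i (a + - a) = 0" by (simp add: coord_def)
  then show ?thesis unfolding coord_add by (simp add: add_eq_0_iff)
qed

lemma coord_diff: "coord i (a - b) = coord i a - coord i b"
  using coord_add[of i a "- b"] coord_uminus[of i b] by simp

lemma coord_frag_of [simp]: "coord i (frag_of (n, p)) = \<psi> n * \<chi> (p i)"
  by (simp add: coord_def keys_frag_of)

lemma coord_rels: "c \<in> rels I \<Longrightarrow> coord i c = 0"
proof -
  have *: "coord i c = 0 \<and> Poly_Mapping.keys c \<subseteq> carrier N \<times> carrier (F I)" if "c \<in> rels I"
    using that unfolding tensor_relations_def
  proof induction
    case (incl h)
    then have "h \<in> rels I" unfolding tensor_relations_def by (rule generate.incl)
    then have "Poly_Mapping.keys h \<subseteq> carrier N \<times> carrier (F I)" by (rule rels_keys)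
    moreover have "coord i h = 0"
      using incl by (elim UnE; clarify)
        (simp_all add: coord_diff psi_add psi_smult chi_add chi_mult distrib_left distrib_right mult.left_commute)
    ultimately show ?case by simp
  next
    case (inv h)
    then have "h \<in> rels I" unfolding tensor_relations_def by (rule generate.incl)
    then have "Poly_Mapping.keys h \<subseteq> carrier N \<times> carrier (F I)" by (rule rels_keys)
    moreover have "coord i h = 0"
      using inv by (elim UnE; clarify)
        (simp_all add: coord_diff psi_add psi_smult chi_add chi_mult distrib_left distrib_right mult.left_commute)
    ultimately show ?case by (simp add: coord_uminus)
  next
    case (eng h1 h2)
    then show ?case
      using keys_add[of h1 h2] by (auto simp: coord_add)
  qed (simp add: coord_def)
  assume "c \<in> rels I"
  with * show ?thesis by blast
qed

lemma cls_eq_iff: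
  assumes p: "p \<in> carrier (F I)" and q: "q \<in> carrier (F I)"
  shows "cls I p = cls I q \<longleftrightarrow> (\<forall>i. \<chi> (p i) = \<chi> (q i))"
  unfolding cls_def r_coset_rels_eq_iff
proof
  assume "frag_of (n0, p) - frag_of (n0, q) \<in> rels I"
  then have "coord i (frag_of (n0, p) - frag_of (n0, q)) = 0" for i by (rule coord_rels)
  then show "\<forall>i. \<chi> (p i) = \<chi> (q i)" by (simp add: coord_diff)
next
  interpret F: left_module R "F I" by (rule left_module_free)
  let ?r = "p \<ominus>\<^bsub>F I\<^esub> q"
  assume "\<forall>i. \<chi> (p i) = \<chi> (q i)"
  then have A: "frag_of (n0, ?r) \<in> rels I"
    using F.M.minus_closed[OF p q] p q by (intro frag_of_chi_zero) (auto simp: minus_free chi_minus)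
  moreover have "frag_of (n0, ?r \<oplus>\<^bsub>F I\<^esub> q) - frag_of (n0, ?r) - frag_of (n0, q) \<in> rels I"
    using F.M.minus_closed[OF p q] q by (intro rels_add_right) auto
  moreover have "?r \<oplus>\<^bsub>F I\<^esub> q = p"
    using p q by (rule F.M.minus_add_cancel)
  ultimately have "frag_of (n0, p) - frag_of (n0, ?r) - frag_of (n0, q) \<in> rels I"
    by simp
  from rels_add[OF A this] show "frag_of (n0, p) - frag_of (n0, q) \<in> rels I"
    by (simp add: algebra_simps)
qed

lemma frag_eq_frag_of:
  assumes "Poly_Mapping.keys c \<subseteq> carrier N \<times> carrier (F I)"
  shows "\<exists>p\<in>carrier (F I). c - frag_of (n0, p) \<in> rels I"
  using assms
proof (induction rule: frag_induction)
  case zero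
  interpret F: left_module R "F I" by (rule left_module_free)
  show ?case using rels_uminus[OF frag_of_zero[OF n0_closed]] F.M.zero_closed
    by (metis diff_0)
next
  case (one x)
  interpret F: left_module R "F I" by (rule left_module_free)
  obtain n p where x: "x = (n, p)" "n \<in> carrier N" "p \<in> carrier (F I)" using one by auto
  obtain r where r: "r \<in> carrier R" "n = r \<odot>\<^bsub>N\<^esub> n0" using x(2) by (rule smult_n0)
  show ?case
    using rels_smult[OF n0_closed r(1) x(3)] r x F.smult_closed[OF r(1) x(3)] by blast
next
  case (diff a b)
  interpret F: left_module R "F I" by (rule left_module_free)
  obtain p q where p: "p \<in> carrier (F I)" "a - frag_of (n0, p) \<in> rels I"
    and q: "q \<in> carrier (F I)" "b - frag_of (n0, q) \<in> rels I"
    using diff by blast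
  let ?r = "p \<ominus>\<^bsub>F I\<^esub> q"
  have r: "?r \<in> carrier (F I)" using p q by (intro F.M.minus_closed)
  have "frag_of (n0, ?r \<oplus>\<^bsub>F I\<^esub> q) - frag_of (n0, ?r) - frag_of (n0, q) \<in> rels I"
    using r q by (intro rels_add_right) auto
  moreover have "?r \<oplus>\<^bsub>F I\<^esub> q = p"
    using p(1) q(1) by (rule F.M.minus_add_cancel)
  ultimately have "frag_of (n0, p) - frag_of (n0, ?r) - frag_of (n0, q) \<in> rels I" by simp
  from rels_add[OF rels_diff[OF p(2) q(2)] this] have "a - b - frag_of (n0, ?r) \<in> rels I"
    by (simp add: algebra_simps)
  with r show ?case by blast
qed

lemma carrier_tensor_product: "carrier (tensor_product R N (F I)) = cls I ` carrier (F I)"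
proof -
  have cls_closed: "rels I #>\<^bsub>G I\<^esub> c \<in> cls I ` carrier (F I)" if "c \<in> carrier (G I)" for c
  proof -
    have k: "Poly_Mapping.keys c \<subseteq> carrier N \<times> carrier (F I)"
      using that by (simp only: carrier_free_Abelian_group_iff)
    obtain p where p: "p \<in> carrier (F I)" "c - frag_of (n0, p) \<in> rels I"
      using frag_eq_frag_of[OF k] by (rule bexE)
    have "rels I #>\<^bsub>G I\<^esub> c = rels I #>\<^bsub>G I\<^esub> frag_of (n0, p)"
      using p(2) by (simp only: r_coset_rels_eq_iff)
    then show ?thesis
      using imageI[OF p(1), of "cls I"] by (simp only: cls_def)
  qed
  have "frag_of (n0, p) \<in> carrier (G I)" if "p \<in> carrier (F I)" for p
    using that by simp
  then have cls_mem: "cls I p \<in> (\<Union>c\<in>carrier (G I). {rels I #>\<^bsub>G I\<^esub> c})" if "p \<in> carrier (F I)" for p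
    using that unfolding cls_def by blast
  have "carrier (tensor_product R N (F I)) = (\<Union>c\<in>carrier (G I). {rels I #>\<^bsub>G I\<^esub> c})"
    by (simp add: tensor_product_def FactGroup_def RCOSETS_def)
  also have "\<dots> \<subseteq> cls I ` carrier (F I)"
    by (rule UN_least) (simp add: cls_closed del: carrier_free_Abelian_group_iff)
  finally have "carrier (tensor_product R N (F I)) \<subseteq> cls I ` carrier (F I)" .
  moreover have "cls I ` carrier (F I) \<subseteq> carrier (tensor_product R N (F I))"
    using cls_mem by (simp add: tensor_product_def FactGroup_def RCOSETS_def image_subset_iff)
  ultimately show ?thesis by (rule equalityI)
qed

lemma one_tensor_product: "\<one>\<^bsub>tensor_product R N (F I)\<^esub> = cls I (\<lambda>_. \<zero>)"
proof -
  have "rels I = rels I #>\<^bsub>G I\<^esub> 0" by (simp add: r_coset_frag)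
  also have "\<dots> = cls I (\<lambda>_. \<zero>)"
    unfolding cls_def r_coset_rels_eq_iff
    using rels_uminus[OF frag_of_zero[OF n0_closed, of I]] by simp
  finally show ?thesis by (simp add: tensor_product_def FactGroup_def)
qed

lemma mult_cls:
  assumes p: "p \<in> carrier (F I)" and q: "q \<in> carrier (F I)"
  shows "cls I p \<otimes>\<^bsub>tensor_product R N (F I)\<^esub> cls I q = cls I (p \<oplus>\<^bsub>F I\<^esub> q)"
proof -
  have "rels I \<lhd> G I"
    using comm_group.normal_iff_subgroup[OF abelian_free_Abelian_group] rels_subgroup by blast
  then have "cls I p \<otimes>\<^bsub>tensor_product R N (F I)\<^esub> cls I q
      = rels I #>\<^bsub>G I\<^esub> (frag_of (n0, p) + frag_of (n0, q))"
    unfolding tensor_product_def FactGroup_def cls_def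
    using normal.rcos_sum[of "rels I" "G I" "frag_of (n0, p)" "frag_of (n0, q)"] p q by simp
  also have "\<dots> = cls I (p \<oplus>\<^bsub>F I\<^esub> q)"
    unfolding cls_def r_coset_rels_eq_iff
    using rels_uminus[OF rels_add_right[OF n0_closed p q]] by (simp add: algebra_simps)
  finally show ?thesis .
qed

lemma tensor_map_cls:
  assumes f: "f \<in> left_module_hom R (F I) (F J)" and p: "p \<in> carrier (F I)"
  shows "tensor_map R N (F J) f (cls I p) = cls J (f p)"
proof -
  note fr = left_module_homD[OF left_module_free left_module_free f]
  let ?\<phi> = "frag_extend (\<lambda>(n, m). frag_of (n, f m))"
  interpret F: left_module R "F I" by (rule left_module_free)
  have gens: "?\<phi> h \<in> rels J" if h: "h \<in>
       {frag_of (n \<oplus>\<^bsub>N\<^esub> n', m) - frag_of (n, m) - frag_of (n', m) | n n' m.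
          n \<in> carrier N \<and> n' \<in> carrier N \<and> m \<in> carrier (F I)} \<union>
       {frag_of (n, m \<oplus>\<^bsub>F I\<^esub> m') - frag_of (n, m) - frag_of (n, m') | n m m'.
          n \<in> carrier N \<and> m \<in> carrier (F I) \<and> m' \<in> carrier (F I)} \<union>
       {frag_of (r \<odot>\<^bsub>N\<^esub> n, m) - frag_of (n, r \<odot>\<^bsub>F I\<^esub> m) | n r m.
          n \<in> carrier N \<and> r \<in> carrier R \<and> m \<in> carrier (F I)}" for h
    using h by (elim UnE; clarify)
      (simp_all add: frag_extend_diff fr rels_add_left rels_add_right rels_smult
        del: add_free smult_free)
  have rels: "?\<phi> h \<in> rels J" if "h \<in> rels I" for h
    using that[unfolded tensor_relations_def]
  proof induction
    case one
    then show ?case by simp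
  next
    case (incl h)
    then show ?case by (rule gens)
  next
    case (inv h)
    then have "h \<in> rels I" unfolding tensor_relations_def by (rule generate.incl)
    then have "inv\<^bsub>G I\<^esub> h = - h" by (intro inv_free_Abelian_group rels_keys)
    then show ?case using rels_uminus[OF gens[OF inv]] by (simp add: frag_extend_minus)
  next
    case (eng h1 h2)
    then show ?case by (simp add: frag_extend_add rels_add)
  qed
  have "rels J #>\<^bsub>G J\<^esub> ?\<phi> c = cls J (f p)" if "c \<in> cls I p" for c
  proof -
    from that obtain h where "h \<in> rels I" "c = h + frag_of (n0, p)"
      by (auto simp: cls_def r_coset_frag)
    then show ?thesis
      unfolding cls_def r_coset_rels_eq_iff by (simp add: frag_extend_add rels)
  qed
  moreover have "frag_of (n0, p) \<in> cls I p"
    using rels_zero[of I] unfolding cls_def r_coset_frag by force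
  ultimately have "(\<lambda>c. rels J #>\<^bsub>G J\<^esub> ?\<phi> c) ` cls I p = {cls J (f p)}"
    by (metis (no_types, lifting) image_cong image_constant)
  then show ?thesis
    by (simp add: tensor_map_def)
qed

lemma tensor_homology_trivial_iff:
  assumes d: "\<And>k. d k \<in> left_module_hom R (F (B (Suc k))) (F (B k))"
  shows "carrier (tensor_homology R N B d k) = {\<one>\<^bsub>tensor_homology R N B d k\<^esub>} \<longleftrightarrow> chi_exact B d k"
proof -
  note dr = left_module_homD[OF left_module_free left_module_free d]
  interpret F: left_module R "F I" for I :: "'a set" by (rule left_module_free)
  let ?T = "\<lambda>k. tensor_product R N (F (B k))"
  let ?Z = "{p \<in> carrier (F (B k)). \<forall>j i. k = Suc j \<longrightarrow> \<chi> (d j p i) = 0}"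
  let ?bd = "(\<lambda>q. cls (B k) (d k q)) ` carrier (F (B (Suc k)))"
  let ?co = "\<lambda>p. (\<lambda>q. cls (B k) (d k q \<oplus>\<^bsub>F (B k)\<^esub> p)) ` carrier (F (B (Suc k)))"
  have cyc: "tensor_cycles R N B d k = cls (B k) ` ?Z"
  proof (cases k)
    case 0
    then show ?thesis by (simp add: tensor_cycles_def carrier_tensor_product)
  next
    case (Suc j)
    have "tensor_map R N (F (B j)) (d j) (cls (B k) p) = \<one>\<^bsub>?T j\<^esub> \<longleftrightarrow> (\<forall>i. \<chi> (d j p i) = 0)"
      if "p \<in> carrier (F (B k))" for p
      using that dr(1)[of p j] F.M.zero_closed[of "B j"] Suc
      by (simp add: tensor_map_cls[OF d] one_tensor_product cls_eq_iff)
    then show ?thesis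
      using Suc by (auto simp: tensor_cycles_def kernel_def carrier_tensor_product)
  qed
  have bd: "tensor_map R N (F (B k)) (d k) ` carrier (?T (Suc k)) = ?bd"
    unfolding carrier_tensor_product image_image
    by (intro image_cong refl tensor_map_cls d)
  let ?H = "tensor_homology R N B d k"
  have one: "\<one>\<^bsub>?H\<^esub> = ?bd"
    by (simp add: tensor_homology_def FactGroup_def bd)
  have coset: "?bd #>\<^bsub>(?T k)\<lparr>carrier := tensor_cycles R N B d k\<rparr>\<^esub> cls (B k) p
      = ?co p"
    if "p \<in> carrier (F (B k))" for p
    using that dr(1)
    by (auto simp: r_coset_def mult_cls simp del: add_free)
  have car: "carrier ?H = ?co ` ?Z"
    unfolding tensor_homology_def Let_def bd FactGroup_def RCOSETS_def
    using coset by (auto simp: cyc simp del: add_free)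
  show ?thesis
  proof
    assume triv: "carrier ?H = {\<one>\<^bsub>?H\<^esub>}"
    show "chi_exact B d k"
      unfolding chi_exact_def
    proof (intro ballI impI)
      fix p assume p: "p \<in> carrier (F (B k))" "\<forall>j i. k = Suc j \<longrightarrow> \<chi> (d j p i) = 0"
      then have "?co p \<in> carrier ?H"
        unfolding car by (intro imageI CollectI conjI)
      then have "?co p = ?bd"
        unfolding triv one by (rule singletonD)
      moreover have "cls (B k) (d k \<zero>\<^bsub>F (B (Suc k))\<^esub> \<oplus>\<^bsub>F (B k)\<^esub> p)
          \<in> ?co p"
        by (rule imageI[OF F.M.zero_closed])
      ultimately have "cls (B k) p \<in> ?bd"
        using p(1) by (simp add: dr(4) del: add_free zero_free)
      then obtain q where q: "cls (B k) p = cls (B k) (d k q)" "q \<in> carrier (F (B (Suc k)))"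
        by (rule imageE)
      then have "\<forall>i. \<chi> (d k q i) = \<chi> (p i)"
        using cls_eq_iff[OF p(1) dr(1)[OF q(2)]] by simp
      then show "\<exists>q\<in>carrier (F (B (Suc k))). \<forall>i. \<chi> (d k q i) = \<chi> (p i)"
        by (rule bexI[OF _ q(2)])
    qed
  next
    assume exact: "chi_exact B d k"
    have "?co p = ?bd" if p: "p \<in> ?Z" for p
    proof -
      have pc: "p \<in> carrier (F (B k))" using p by blast
      obtain q0 where q0: "q0 \<in> carrier (F (B (Suc k)))" "\<And>i. \<chi> (d k q0 i) = \<chi> (p i)"
        using exact p unfolding chi_exact_def by blast
      have eq: "cls (B k) (d k q \<oplus>\<^bsub>F (B k)\<^esub> p) = cls (B k) (d k (q \<oplus>\<^bsub>F (B (Suc k))\<^esub> q0))"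
        if q: "q \<in> carrier (F (B (Suc k)))" for q
      proof -
        have "\<chi> ((d k q \<oplus>\<^bsub>F (B k)\<^esub> p) i) = \<chi> ((d k q \<oplus>\<^bsub>F (B k)\<^esub> d k q0) i)" for i
          using free_coord[OF dr(1)[OF q]] free_coord[OF dr(1)[OF q0(1)]] free_coord[OF pc] q0(2)
          by (simp add: chi_add)
        then have "cls (B k) (d k q \<oplus>\<^bsub>F (B k)\<^esub> p) = cls (B k) (d k q \<oplus>\<^bsub>F (B k)\<^esub> d k q0)"
          using dr(1)[OF q] dr(1)[OF q0(1)] pc by (subst cls_eq_iff) (auto simp del: add_free)
        then show ?thesis
          using q q0(1) by (simp add: dr(2) del: add_free)
      qed
      show ?thesis
      proof
        show "?co p \<subseteq> ?bd"
          using eq q0(1) by (auto simp del: add_free)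
        show "?bd \<subseteq> ?co p"
        proof
          fix X assume "X \<in> ?bd"
          then obtain q where q: "q \<in> carrier (F (B (Suc k)))" "X = cls (B k) (d k q)" by blast
          let ?q = "q \<ominus>\<^bsub>F (B (Suc k))\<^esub> q0"
          have "?q \<oplus>\<^bsub>F (B (Suc k))\<^esub> q0 = q"
            using q(1) q0(1) by (rule F.M.minus_add_cancel)
          with eq[of ?q] q q0(1)
          show "X \<in> ?co p"
            by (intro image_eqI[of _ _ ?q]) (simp_all del: add_free)
        qed
      qed
    qed
    moreover have "(\<lambda>_. \<zero>) \<in> ?Z"
      using F.M.zero_closed[of "B k"] dr(4) by auto
    ultimately show "carrier ?H = {\<one>\<^bsub>?H\<^esub>}"
      unfolding car one by (rule image_eq_singletonI)
  qed
qed

end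

section \<open>Modules over a nilpotent Lie algebra\<close>

context lie_module
begin

lemma mspace_add [simp]: "\<lbrakk>v \<in> mspace V; w \<in> mspace V\<rbrakk> \<Longrightarrow> v + w \<in> mspace V"
  using V.subspace_add[OF subspace_mspace] .

lemma mspace_diff [simp]: "\<lbrakk>v \<in> mspace V; w \<in> mspace V\<rbrakk> \<Longrightarrow> v - w \<in> mspace V"
  using V.subspace_diff[OF subspace_mspace] .

lemma mspace_scale [simp]: "v \<in> mspace V \<Longrightarrow> mscale V c v \<in> mspace V"
  using V.subspace_scale[OF subspace_mspace] .

lemma mspace_zero [simp]: "0 \<in> mspace V"
  using V.subspace_0[OF subspace_mspace] .

lemma act_zero_left [simp]: "v \<in> mspace V \<Longrightarrow> mact V 0 v = 0"
  using act_scale_left[of v 0 0] by simp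

lemma act_zero_right [simp]: "mact V x 0 = 0"
  using act_scale_right[of 0 x 0] by simp

lemma act_diff_right:
  "\<lbrakk>v \<in> mspace V; w \<in> mspace V\<rbrakk> \<Longrightarrow> mact V x (v - w) = mact V x v - mact V x w"
  using act_add_right[of "v - w" w x] by simp

lemma submoduleD:
  assumes "lie_submodule V W"
  shows "w \<in> W \<Longrightarrow> w \<in> mspace V" and "0 \<in> W" and "\<lbrakk>v \<in> W; w \<in> W\<rbrakk> \<Longrightarrow> v + w \<in> W"
    and "\<lbrakk>v \<in> W; w \<in> W\<rbrakk> \<Longrightarrow> v - w \<in> W" and "w \<in> W \<Longrightarrow> mscale V c w \<in> W"
    and "w \<in> W \<Longrightarrow> mact V x w \<in> W"
  using assms unfolding lie_submodule_def
  by (auto simp: V.subspace_0 V.subspace_add V.subspace_diff V.subspace_scale)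

lemma submodule_scale_iff: "lie_submodule V W \<Longrightarrow> c \<noteq> 0 \<Longrightarrow> mscale V c w \<in> W \<longleftrightarrow> w \<in> W"
  using submoduleD(5)[of W "mscale V c w" "inverse c"] submoduleD(5)[of W w c] by auto

lemma submodule_mspace: "lie_submodule V (mspace V)"
  using subspace_mspace act_closed by (auto simp: lie_submodule_def)

lemma submodule_zero: "lie_submodule V {0}"
  by (auto simp: lie_submodule_def)

lemma dim_strict_mono:
  assumes "module_finite_dim V" "V.subspace U" "V.subspace W" "U \<subset> W" "W \<subseteq> mspace V"
  shows "V.dim U < V.dim W"
proof -
  obtain B0 where B0: "finite B0" "V.span B0 = mspace V"
    using assms(1) by (auto simp: module_finite_dim_def)
  obtain B where B: "B \<subseteq> U" "V.independent B" "U \<subseteq> V.span B" "card B = V.dim U"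
    using V.basis_exists[of U] by metis
  obtain C where C: "C \<subseteq> W" "V.independent C" "W \<subseteq> V.span C" "card C = V.dim W"
    using V.basis_exists[of W] by metis
  have finC: "finite C"
    using V.independent_span_bound[OF B0(1) C(2)] C(1) assms(5) B0(2) by blast
  obtain v where v: "v \<in> W" "v \<notin> U" using assms(4) by blast
  have "V.span B \<subseteq> U" by (rule V.span_minimal[OF B(1) assms(2)])
  then have vB: "v \<notin> V.span B" using v(2) by blast
  then have ind: "V.independent (insert v B)" using B(2) by (rule V.independent_insertI)
  have "insert v B \<subseteq> V.span C" using v(1) B(1) C(3) assms(4) by blast
  then have "finite (insert v B) \<and> card (insert v B) \<le> card C"
    by (rule V.independent_span_bound[OF finC ind])
  moreover have "v \<notin> B" using vB V.span_base by blast
  ultimately have "Suc (card B) \<le> card C" by (auto simp: card_insert_disjoint)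
  then show ?thesis unfolding B(4) C(4) by simp
qed

definition weight_vector :: "('g \<Rightarrow> complex) \<Rightarrow> 'v \<Rightarrow> bool" where
  "weight_vector \<mu> v \<longleftrightarrow> v \<in> mspace V \<and> v \<noteq> 0 \<and> (\<forall>x. mact V x v = mscale V (\<mu> x) v)"

subsection \<open>Polynomials in an operator\<close>

definition poly_act :: "'g \<Rightarrow> 'v \<Rightarrow> complex poly \<Rightarrow> 'v" where
  "poly_act x u p = (\<Sum>i\<le>degree p. mscale V (coeff p i) ((mact V x ^^ i) u))"

context
  fixes x :: 'g and u :: 'v
  assumes u: "u \<in> mspace V"
begin

lemma pow_act_closed [simp]: "(mact V x ^^ i) u \<in> mspace V"
  by (induction i) (auto simp: u act_closed)

lemma act_sum: "(\<And>i. i \<in> I \<Longrightarrow> f i \<in> mspace V) \<Longrightarrow> mact V y (\<Sum>i\<in>I. f i) = (\<Sum>i\<in>I. mact V y (f i))"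
  by (induction I rule: infinite_finite_induct)
    (auto simp: act_add_right V.subspace_sum[OF subspace_mspace])

lemma poly_act_bound:
  "degree p \<le> n \<Longrightarrow> poly_act x u p = (\<Sum>i\<le>n. mscale V (coeff p i) ((mact V x ^^ i) u))"
  unfolding poly_act_def by (rule sum.mono_neutral_left) (auto simp: coeff_eq_0)

lemma poly_act_add: "poly_act x u (p + q) = poly_act x u p + poly_act x u q"
proof -
  let ?n = "max (degree p) (degree q)"
  have "poly_act x u (p + q) = (\<Sum>i\<le>?n. mscale V (coeff (p + q) i) ((mact V x ^^ i) u))"
    by (rule poly_act_bound) (rule degree_add_le_max)
  then show ?thesis
    by (simp add: poly_act_bound[of _ ?n] V.scale_left_distrib sum.distrib)
qed

lemma poly_act_smult: "poly_act x u (smult c p) = mscale V c (poly_act x u p)"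
  by (simp add: poly_act_bound[of _ "degree p"] V.scale_sum_right degree_smult_le)

lemma poly_act_pCons: "poly_act x u (pCons c p) = mscale V c u + mact V x (poly_act x u p)"
proof -
  have "poly_act x u (pCons c p)
      = (\<Sum>i\<le>Suc (degree p). mscale V (coeff (pCons c p) i) ((mact V x ^^ i) u))"
    by (rule poly_act_bound) (rule degree_pCons_le)
  also have "\<dots> = mscale V c u + (\<Sum>i\<le>degree p. mscale V (coeff p i) (mact V x ((mact V x ^^ i) u)))"
    by (subst sum.atMost_Suc_shift) simp
  also have "\<dots> = mscale V c u + mact V x (poly_act x u p)"
    by (simp add: poly_act_def act_sum act_scale_right)
  finally show ?thesis .
qed

lemma poly_act_0 [simp]: "poly_act x u 0 = 0"
  by (simp add: poly_act_def)

lemma poly_act_linear_factor: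
  "poly_act x u ([:- a, 1:] * q) = mact V x (poly_act x u q) - mscale V a (poly_act x u q)"
proof -
  have "[:- a, 1:] * q = pCons 0 q + smult (- a) q" by simp
  then show ?thesis
    by (simp only: poly_act_add poly_act_smult poly_act_pCons) (simp add: V.scale_minus_left)
qed

lemma poly_act_monom: "poly_act x u (monom 1 i) = (mact V x ^^ i) u"
  by (induction i) (simp_all add: monom_Suc poly_act_pCons one_poly_eq_simps poly_act_def[of _ _ 1])

lemma poly_annihilator:
  assumes "module_finite_dim V"
  obtains p where "p \<noteq> 0" "poly_act x u p = 0"
proof -
  obtain B0 where B0: "finite B0" "V.span B0 = mspace V"
    using assms(1) by (auto simp: module_finite_dim_def)
  define w where "w i = (mact V x ^^ i) u" for i
  have w_closed: "w i \<in> mspace V" for i by (simp add: w_def)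
  have "\<exists>k. w k \<in> V.span (w ` {..<k})"
  proof (rule ccontr)
    assume "\<nexists>k. w k \<in> V.span (w ` {..<k})"
    then have *: "w k \<notin> V.span (w ` {..<k})" for k by blast
    have "V.independent (w ` {..<k}) \<and> card (w ` {..<k}) = k" for k
    proof (induction k)
      case (Suc k)
      have "w k \<notin> w ` {..<k}" using * V.span_base[of "w k" "w ` {..<k}"] by blast
      then show ?case
        using Suc V.independent_insertI[OF *, of k] unfolding lessThan_Suc image_insert
        by (subst card_insert_disjoint) auto
    qed (simp add: V.independent_empty)
    note ind = this[of "Suc (card B0)"]
    have "w ` {..<Suc (card B0)} \<subseteq> V.span B0" using B0(2) w_closed by blast
    from V.independent_span_bound[OF B0(1) conjunct1[OF ind] this] conjunct2[OF ind]
    show False by linarith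
  qed
  then obtain k where k: "w k \<in> V.span (w ` {..<k})" by blast
  let ?E = "{poly_act x u q |q. degree q < k \<or> q = 0}"
  have E: "poly_act x u q \<in> ?E" if "degree q < k \<or> q = 0" for q
    using that by blast
  have "V.subspace ?E"
  proof (rule V.subspaceI)
    show "0 \<in> ?E" using E[of 0] by simp
    fix v v' assume "v \<in> ?E" "v' \<in> ?E"
    then obtain p q where pq: "v = poly_act x u p" "v' = poly_act x u q"
      "degree p < k \<or> p = 0" "degree q < k \<or> q = 0" by blast
    then have "degree (p + q) < k \<or> p + q = 0"
      by (auto intro: degree_add_less)
    from E[OF this] pq show "v + v' \<in> ?E" by (simp only: poly_act_add)
    fix c
    have "degree (smult c p) < k \<or> smult c p = 0"
      using pq(3) by (auto intro: le_less_trans[OF degree_smult_le])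
    from E[OF this] pq show "mscale V c v \<in> ?E" by (simp only: poly_act_smult)
  qed
  moreover have "w ` {..<k} \<subseteq> ?E"
  proof
    fix v assume "v \<in> w ` {..<k}"
    then obtain i where i: "i < k" "v = w i" by blast
    then have "degree (monom 1 i :: complex poly) < k" by (simp add: degree_monom_eq)
    then show "v \<in> ?E" using E[of "monom 1 i"] i by (simp add: poly_act_monom w_def)
  qed
  ultimately have "w k \<in> ?E" using subsetD[OF V.span_minimal k] by blast
  then obtain q where q: "w k = poly_act x u q" "degree q < k \<or> q = 0" by blast
  have "coeff (monom 1 k + smult (- 1) q) k = 1"
    using q(2) by (auto simp: coeff_eq_0)
  then have "monom 1 k + smult (- 1) q \<noteq> 0" by (metis coeff_0 zero_neq_one)
  moreover have "poly_act x u (monom 1 k + smult (- 1) q) = 0"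
    using q(1) by (simp only: poly_act_add poly_act_smult poly_act_monom w_def) (simp add: V.scale_minus_left)
  ultimately show ?thesis by (rule that)
qed

lemma eigenvector_mod:
  assumes "module_finite_dim V" and W: "lie_submodule V W" "u \<notin> W"
    and M: "lie_submodule V M" "u \<in> M"
  shows "\<exists>a v. v \<in> M \<and> v \<notin> W \<and> mact V x v - mscale V a v \<in> W"
proof -
  have closed: "poly_act x u p \<in> M" for p
  proof (induction p)
    case (pCons c p)
    then show ?case using submoduleD[OF M(1)] M(2) by (simp add: poly_act_pCons)
  qed (simp add: submoduleD[OF M(1)])
  have "\<exists>a v. v \<in> M \<and> v \<notin> W \<and> mact V x v - mscale V a v \<in> W"
    if "p \<noteq> 0" "poly_act x u p \<in> W" for p
    using that
  proof (induction "degree p" arbitrary: p rule: less_induct)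
    case less
    show ?case
    proof (cases "degree p = 0")
      case True
      then obtain c where c: "p = [:c:]" by (rule degree_eq_zeroE)
      then have "mscale V c u \<in> W" using less.prems(2) by (simp add: poly_act_pCons)
      then show ?thesis using c less.prems(1) W submodule_scale_iff by auto
    next
      case False
      then have "\<not> constant (poly p)" by (simp add: constant_degree)
      then obtain a where "poly p a = 0" using fundamental_theorem_of_algebra by blast
      then obtain q where q: "p = [:- a, 1:] * q" by (auto simp: poly_eq_0_iff_dvd)
      then have "q \<noteq> 0" using less.prems(1) by auto
      then have deg: "degree q < degree p" unfolding q by (subst degree_mult_eq) auto
      show ?thesis
      proof (cases "poly_act x u q \<in> W")
        case True
        then show ?thesis using less.hyps[OF deg \<open>q \<noteq> 0\<close>] by blast
      next
        case False
        moreover have "mact V x (poly_act x u q) - mscale V a (poly_act x u q) \<in> W"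
          using less.prems(2) unfolding q poly_act_linear_factor .
        ultimately show ?thesis using closed by blast
      qed
    qed
  qed
  moreover obtain p where p: "p \<noteq> 0" "poly_act x u p = 0" using poly_annihilator[OF assms(1)] .
  moreover have "poly_act x u p \<in> W" unfolding p(2) by (rule submoduleD(2)[OF W(1)])
  ultimately show ?thesis by blast
qed

end

end

locale nilpotent_lie_module = lie_module L V
  for L :: "'g::ab_group_add lie_algebra" and V :: "('g, 'v::ab_group_add) lie_module" +
  assumes nilpotent: "lie_nilpotent L" and finite_dim: "module_finite_dim V"
begin

lemma lower_central_induct [consumes 0, case_names zero step]:
  assumes "Q 0"
    and "\<And>i z. \<lbrakk>z \<in> lower_central L i; \<And>y. Q (bracket L y z)\<rbrakk> \<Longrightarrow> Q z"
  shows "Q x"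
proof -
  obtain n where n: "lower_central L n = {0}"
    using nilpotent by (auto simp: lie_nilpotent_def)
  have "\<forall>z\<in>lower_central L i. Q z" if "i \<le> n" for i
    using that
  proof (induction i rule: inc_induct)
    case base
    then show ?case using n assms(1) by simp
  next
    case (step i)
    show ?case
    proof
      fix z assume z: "z \<in> lower_central L i"
      have "bracket L y z \<in> lower_central L (Suc i)" for y
        using z by (auto intro: span_base)
      then show "Q z" using step.IH z by (blast intro: assms(2))
    qed
  qed
  from this[of 0] show ?thesis by simp
qed

subsection \<open>Generalized eigenspaces\<close>

primrec eigenspace_level :: "'v set \<Rightarrow> 'v set \<Rightarrow> 'g \<Rightarrow> complex \<Rightarrow> nat \<Rightarrow> 'v set" where
  "eigenspace_level M W y a 0 = W"
| "eigenspace_level M W y a (Suc k) =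
     {m \<in> M. mact V y m - mscale V a m \<in> eigenspace_level M W y a k}"

definition gen_eigenspace :: "'v set \<Rightarrow> 'v set \<Rightarrow> 'g \<Rightarrow> complex \<Rightarrow> 'v set" where
  "gen_eigenspace M W y a = (\<Union>k. eigenspace_level M W y a k)"

context
  fixes M W :: "'v set" and y :: 'g and a :: complex
  assumes M: "lie_submodule V M" and W: "lie_submodule V W" and sub: "W \<subseteq> M"
begin

abbreviation E :: "nat \<Rightarrow> 'v set" where "E k \<equiv> eigenspace_level M W y a k"

lemma shifted_add: "\<lbrakk>m \<in> M; n \<in> M\<rbrakk> \<Longrightarrow>
  mact V y (m + n) - mscale V a (m + n) = (mact V y m - mscale V a m) + (mact V y n - mscale V a n)"
  using submoduleD(1)[OF M] by (simp add: act_add_right V.scale_right_distrib)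

lemma shifted_scale: "m \<in> M \<Longrightarrow>
  mact V y (mscale V c m) - mscale V a (mscale V c m) = mscale V c (mact V y m - mscale V a m)"
  using submoduleD(1)[OF M] by (simp add: act_scale_right V.scale_right_diff_distrib mult.commute)

lemma level_subset: "E k \<subseteq> M"
  using sub by (cases k) auto

lemma level_Suc: "E k \<subseteq> E (Suc k)"
proof (induction k)
  case 0
  show ?case using submoduleD[OF W] sub by auto
next
  case (Suc k)
  then show ?case by auto
qed

lemma level_mono: "i \<le> j \<Longrightarrow> E i \<subseteq> E j"
  using lift_Suc_mono_le[of E i j] level_Suc by blast

lemma level_closed:
  "0 \<in> E k" "\<lbrakk>m \<in> E k; n \<in> E k\<rbrakk> \<Longrightarrow> m + n \<in> E k" "m \<in> E k \<Longrightarrow> mscale V c m \<in> E k"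
proof -
  have "0 \<in> E k \<and> (\<forall>m\<in>E k. \<forall>n\<in>E k. m + n \<in> E k) \<and> (\<forall>m\<in>E k. mscale V c m \<in> E k)"
  proof (induction k)
    case 0
    show ?case using submoduleD[OF W] by auto
  next
    case (Suc k)
    then show ?case using submoduleD(2,3,5)[OF M] by (auto simp: shifted_add shifted_scale simp del: V.scale_scale)
  qed
  then show "0 \<in> E k" "\<lbrakk>m \<in> E k; n \<in> E k\<rbrakk> \<Longrightarrow> m + n \<in> E k" "m \<in> E k \<Longrightarrow> mscale V c m \<in> E k"
    by auto
qed

lemma gen_eigenspace_step:
  "\<lbrakk>m \<in> M; mact V y m - mscale V a m \<in> gen_eigenspace M W y a\<rbrakk> \<Longrightarrow> m \<in> gen_eigenspace M W y a"
proof -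
  assume m: "m \<in> M" "mact V y m - mscale V a m \<in> gen_eigenspace M W y a"
  then obtain k where "mact V y m - mscale V a m \<in> E k" by (auto simp: gen_eigenspace_def)
  with m(1) have "m \<in> E (Suc k)" by simp
  then show ?thesis unfolding gen_eigenspace_def by blast
qed

lemma gen_eigenspace_induct [consumes 1, case_names base shift]:
  assumes "m \<in> gen_eigenspace M W y a" and "\<And>m. m \<in> W \<Longrightarrow> Q m"
    and "\<And>m. \<lbrakk>m \<in> M; mact V y m - mscale V a m \<in> gen_eigenspace M W y a;
      Q (mact V y m - mscale V a m)\<rbrakk> \<Longrightarrow> Q m"
  shows "Q m"
proof -
  obtain k where "m \<in> E k" using assms(1) by (auto simp: gen_eigenspace_def)
  then show ?thesis
  proof (induction k arbitrary: m)
    case 0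
    then show ?case using assms(2) by simp
  next
    case (Suc k)
    then have m: "mact V y m - mscale V a m \<in> E k" "m \<in> M" by auto
    then have "mact V y m - mscale V a m \<in> gen_eigenspace M W y a"
      unfolding gen_eigenspace_def by blast
    from m(2) this Suc.IH[OF m(1)] show ?case by (rule assms(3))
  qed
qed

lemma gen_eigenspace_subset: "gen_eigenspace M W y a \<subseteq> M"
  and subset_gen_eigenspace: "W \<subseteq> gen_eigenspace M W y a"
proof -
  show "gen_eigenspace M W y a \<subseteq> M"
    using level_subset by (auto simp: gen_eigenspace_def)
  have "E 0 \<subseteq> gen_eigenspace M W y a" unfolding gen_eigenspace_def by blast
  then show "W \<subseteq> gen_eigenspace M W y a" by simp
qed

lemma gen_eigenspace_add:
  assumes "m \<in> gen_eigenspace M W y a" "n \<in> gen_eigenspace M W y a"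
  shows "m + n \<in> gen_eigenspace M W y a"
proof -
  obtain i j where "m \<in> E i" "n \<in> E j"
    using assms by (auto simp: gen_eigenspace_def)
  then have "m \<in> E (max i j)" "n \<in> E (max i j)"
    using level_mono[of i "max i j"] level_mono[of j "max i j"] by auto
  then have "m + n \<in> E (max i j)" by (rule level_closed(2))
  then show ?thesis unfolding gen_eigenspace_def by blast
qed

text \<open>The generalized eigenspaces of \<open>y\<close> are stable under \<open>z\<close> since \<open>ad y\<close> is nilpotent.\<close>

lemma gen_eigenspace_act:
  assumes "m \<in> gen_eigenspace M W y a"
  shows "mact V z m \<in> gen_eigenspace M W y a"
proof -
  let ?G = "gen_eigenspace M W y a"
  have "\<forall>m\<in>?G. mact V z m \<in> ?G"
  proof (induction z rule: lower_central_induct)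
    case zero
    have "0 \<in> ?G" using level_closed(1)[of 0] unfolding gen_eigenspace_def by blast
    then show ?case using gen_eigenspace_subset submoduleD(1)[OF M] by auto
  next
    case (step i z)
    show ?case
    proof
      fix m assume "m \<in> ?G"
      then show "mact V z m \<in> ?G"
      proof (induction rule: gen_eigenspace_induct)
        case (base m)
        then show ?case using submoduleD(6)[OF W] subset_gen_eigenspace by blast
      next
        case (shift m)
        have mM: "m \<in> M" by fact
        have mG: "m \<in> ?G" by (rule gen_eigenspace_step[OF shift(1,2)])
        have mV: "m \<in> mspace V" using mM submoduleD(1)[OF M] by blast
        have "mact V y (mact V z m) - mscale V a (mact V z m)
            = mact V z (mact V y m - mscale V a m) + mact V (bracket L y z) m"
          using mV act_closed by (simp add: act_bracket act_diff_right act_scale_right)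
        moreover have "mact V (bracket L y z) m \<in> ?G" using step.IH mG by blast
        ultimately have "mact V y (mact V z m) - mscale V a (mact V z m) \<in> ?G"
          using shift.IH gen_eigenspace_add by simp
        then show ?case by (rule gen_eigenspace_step[OF submoduleD(6)[OF M mM]])
      qed
    qed
  qed
  with assms show ?thesis by blast
qed

lemma gen_eigenspace_submodule: "lie_submodule V (gen_eigenspace M W y a)"
  unfolding lie_submodule_def
proof (intro conjI)
  show "gen_eigenspace M W y a \<subseteq> mspace V"
    using gen_eigenspace_subset submoduleD(1)[OF M] by blast
  show "V.subspace (gen_eigenspace M W y a)"
  proof (rule V.subspaceI)
    show "0 \<in> gen_eigenspace M W y a"
      using submoduleD(2)[OF W] subset_gen_eigenspace by blast
    show "mscale V c m \<in> gen_eigenspace M W y a" if "m \<in> gen_eigenspace M W y a" for c m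
      using that level_closed(3) unfolding gen_eigenspace_def by blast
  qed (rule gen_eigenspace_add)
  show "\<forall>x. \<forall>w\<in>gen_eigenspace M W y a. mact V x w \<in> gen_eigenspace M W y a"
    using gen_eigenspace_act by blast
qed

end

subsection \<open>Weights\<close>

definition scalar_mod :: "('g \<Rightarrow> complex) \<Rightarrow> 'v set \<Rightarrow> 'v set \<Rightarrow> bool" where
  "scalar_mod \<mu> M W \<longleftrightarrow> (\<forall>x. \<forall>m\<in>M. mact V x m - mscale V (\<mu> x) m \<in> W)"

text \<open>If \<open>z\<close> does not commute with \<open>y\<close> on \<open>M / W\<close>, then their commutator \<open>[z, y] = - c\<close> is a nonzero
  scalar there, so that \<open>z\<close> acts on polynomials in \<open>y\<close>, applied to an eigenvector of \<open>z\<close>, as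
  a multiple of the derivative. This reduces the degree of the minimal polynomial of \<open>y\<close> there.\<close>

lemma commutator_scalar_zero:
  assumes M: "lie_submodule V M" and W: "lie_submodule V W" and sub: "W \<subseteq> M"
    and v: "v \<in> M" "v \<notin> W" "mact V z v - mscale V a v \<in> W"
    and c: "\<And>m. m \<in> M \<Longrightarrow> mact V (bracket L y z) m - mscale V c m \<in> W"
  shows "c = 0"
proof (rule ccontr)
  assume "c \<noteq> 0"
  note Mr = submoduleD[OF M] and Wr = submoduleD[OF W]
  have vV: "v \<in> mspace V" using v(1) Mr(1) by blast
  let ?D = "\<lambda>m. mact V z m - mscale V a m"
  let ?p = "poly_act y v"
  have pM: "?p p \<in> M" for p
    by (induction p) (use Mr v(1) vV in \<open>auto simp: poly_act_pCons poly_act_0\<close>)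
  have key: "?D (?p p) + mscale V c (?p (pderiv p)) \<in> W" for p
  proof (induction p)
    case 0
    show ?case using Wr(2) vV by (simp add: poly_act_0)
  next
    case (pCons b p)
    let ?q = "?p p" and ?q' = "?p (pderiv p)"
    have V: "?q \<in> mspace V" "?q' \<in> mspace V" "mact V y ?q \<in> mspace V" "mact V z ?q \<in> mspace V"
      using pM Mr(1) act_closed by blast+
    have "?D (?p (pCons b p)) + mscale V c (?p (pderiv (pCons b p)))
        = mscale V b (?D v) + (mact V z (mact V y ?q) - mscale V a (mact V y ?q))
          + (mscale V c ?q + mscale V c (mact V y ?q'))"
      using vV V by (simp add: poly_act_pCons pderiv_pCons poly_act_add act_add_right act_scale_right
          V.scale_right_distrib V.scale_right_diff_distrib mult.commute)
    also have "\<dots> = mscale V b (?D v) + mact V y (?D ?q + mscale V c ?q')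
          - (mact V (bracket L y z) ?q - mscale V c ?q)"
      using V by (simp add: act_bracket act_add_right act_diff_right act_scale_right)
    also have "\<dots> \<in> W"
      by (rule Wr(4)[OF Wr(3)[OF Wr(5)[OF v(3)] Wr(6)[OF pCons.IH]] c[OF pM]])
    finally show ?case .
  qed
  have "p = 0" if "?p p \<in> W" for p
    using that
  proof (induction "degree p" arbitrary: p rule: less_induct)
    case less
    have "mscale V c (?p (pderiv p)) = (?D (?p p) + mscale V c (?p (pderiv p))) - ?D (?p p)" by simp
    also have "\<dots> \<in> W"
      by (rule Wr(4)[OF key Wr(4)[OF Wr(6)[OF less.prems] Wr(5)[OF less.prems]]])
    finally have d: "?p (pderiv p) \<in> W"
      using submodule_scale_iff[OF W \<open>c \<noteq> 0\<close>] by simp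
    show ?case
    proof (cases "degree p = 0")
      case True
      then obtain b where b: "p = [:b:]" by (rule degree_eq_zeroE)
      then have "mscale V b v \<in> W" using less.prems vV by (simp add: poly_act_pCons poly_act_0)
      then show ?thesis using b v(2) submodule_scale_iff[OF W] by (cases "b = 0") auto
    next
      case False
      then have "pderiv p = 0" using less.hyps[OF _ d] by (simp add: degree_pderiv)
      then show ?thesis using False by (simp add: pderiv_eq_0_iff)
    qed
  qed
  moreover obtain p where p: "p \<noteq> 0" "?p p = 0" using poly_annihilator[OF vV finite_dim] .
  moreover have "?p p \<in> W" unfolding p(2) by (rule Wr(2))
  ultimately show False by blast
qed

lemma scalar_mod_maximal:
  assumes M: "lie_submodule V M" and W: "lie_submodule V W" and sub: "W \<subset> M"
    and max: "\<And>N. \<lbrakk>lie_submodule V N; W \<subseteq> N; N \<subseteq> M\<rbrakk> \<Longrightarrow> N = W \<or> N = M"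
  obtains \<mu> where "scalar_mod \<mu> M W"
proof -
  note Mr = submoduleD[OF M] and Wr = submoduleD[OF W]
  have ex: "\<exists>a. \<forall>m\<in>M. mact V x m - mscale V a m \<in> W" for x
  proof (induction x rule: lower_central_induct)
    case zero
    show ?case using Mr(1) Wr(2) by (intro exI[of _ 0]) auto
  next
    case (step i z)
    obtain u where u: "u \<in> M" "u \<notin> W" using sub by blast
    then have uV: "u \<in> mspace V" using Mr(1) by blast
    have "\<exists>a v. v \<in> M \<and> v \<notin> W \<and> mact V z v - mscale V a v \<in> W"
      by (rule eigenvector_mod[OF uV finite_dim W u(2) M u(1)])
    then obtain a v where v: "v \<in> M" "v \<notin> W" "mact V z v - mscale V a v \<in> W"
      by (elim exE conjE)
    let ?N = "{m \<in> M. mact V z m - mscale V a m \<in> W}"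
    note lc = level_closed[OF M W psubset_imp_subset[OF sub], where k = "Suc 0" and y = z and a = a,
        unfolded eigenspace_level.simps]
    have comm: "mact V (bracket L y z) m \<in> W" if "m \<in> M" for y m
    proof -
      obtain c where c: "\<forall>m\<in>M. mact V (bracket L y z) m - mscale V c m \<in> W"
        using step(2)[of y] by (rule exE)
      have "c = 0"
        by (rule commutator_scalar_zero[OF M W psubset_imp_subset[OF sub] v bspec[OF c]])
      then show ?thesis using bspec[OF c that] by simp
    qed
    have "lie_submodule V ?N"
      unfolding lie_submodule_def
    proof (intro conjI allI ballI)
      show "?N \<subseteq> mspace V" using Mr(1) by blast
      show "V.subspace ?N"
      proof (rule V.subspaceI)
        show "0 \<in> ?N" by (rule lc(1))
        show "m + n \<in> ?N" if "m \<in> ?N" "n \<in> ?N" for m n using that by (rule lc(2))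
        show "mscale V c m \<in> ?N" if "m \<in> ?N" for c m using that by (rule lc(3))
      qed
      fix y m assume m: "m \<in> ?N"
      then have mV: "m \<in> mspace V" using Mr(1) by blast
      have "mact V z (mact V y m) - mscale V a (mact V y m)
          = mact V y (mact V z m - mscale V a m) - mact V (bracket L y z) m"
        using mV act_closed by (simp add: act_bracket act_diff_right act_scale_right)
      also have "\<dots> \<in> W"
        by (rule Wr(4)[OF Wr(6) comm]) (use m in \<open>simp_all only: mem_Collect_eq simp_thms\<close>)
      finally show "mact V y m \<in> ?N" using m Mr(6) by simp
    qed
    moreover have "W \<subseteq> ?N"
    proof
      fix w assume w: "w \<in> W"
      have "mact V z w - mscale V a w \<in> W" by (rule Wr(4)[OF Wr(6)[OF w] Wr(5)[OF w]])
      with w sub show "w \<in> ?N" by blast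
    qed
    moreover have "?N \<noteq> W" using v by blast
    ultimately have "?N = M" using max[of ?N] by blast
    then show ?case by blast
  qed
  define \<mu> where "\<mu> x = (SOME a. \<forall>m\<in>M. mact V x m - mscale V a m \<in> W)" for x
  have "scalar_mod \<mu> M W"
    unfolding scalar_mod_def \<mu>_def
  proof
    fix x
    from someI_ex[OF ex[of x]]
    show "\<forall>m\<in>M. mact V x m - mscale V (SOME a. \<forall>m\<in>M. mact V x m - mscale V a m \<in> W) m \<in> W" .
  qed
  then show ?thesis by (rule that)
qed

lemma adjoin_submodule:
  assumes M: "lie_submodule V M" and W: "lie_submodule V W" and sub: "W \<subseteq> M"
    and \<mu>: "scalar_mod \<mu> M W" and v: "v \<in> M"
  shows "lie_submodule V {w + mscale V c v |w c. w \<in> W}"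
proof -
  note Mr = submoduleD[OF M] and Wr = submoduleD[OF W]
  let ?N = "{w + mscale V c v |w c. w \<in> W}"
  have I: "w + mscale V c v \<in> ?N" if "w \<in> W" for w c using that by blast
  show ?thesis
    unfolding lie_submodule_def
  proof (intro conjI allI ballI)
    show "?N \<subseteq> mspace V"
    proof
      fix m assume "m \<in> ?N"
      then obtain w c where m: "m = w + mscale V c v" "w \<in> W" by blast
      show "m \<in> mspace V"
        unfolding m(1) using m(2) sub by (intro Mr(1) Mr(3) Mr(5) v) auto
    qed
    show "V.subspace ?N"
    proof (rule V.subspaceI)
      show "0 \<in> ?N" using I[OF Wr(2), of 0] by simp
      fix m n assume "m \<in> ?N" "n \<in> ?N"
      then obtain w c w' c' where m: "m = w + mscale V c v" "w \<in> W" "n = w' + mscale V c' v" "w' \<in> W"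
        by blast
      then show "m + n \<in> ?N" using I[OF Wr(3)[OF m(2,4)], of "c + c'"]
        by (simp add: V.scale_left_distrib algebra_simps)
      show "mscale V b m \<in> ?N" for b
        using m I[OF Wr(5)[OF m(2)], of b "b * c"] by (simp add: V.scale_right_distrib)
    qed
    fix y m assume "m \<in> ?N"
    then obtain w c where m: "m = w + mscale V c v" "w \<in> W" by blast
    have vV: "v \<in> mspace V" "w \<in> mspace V" using v m sub Mr(1) by blast+
    have "mact V y m = (mact V y w + mscale V c (mact V y v - mscale V (\<mu> y) v)) + mscale V (c * \<mu> y) v"
      using vV by (simp add: m act_add_right act_scale_right V.scale_right_diff_distrib)
    moreover have "mact V y w + mscale V c (mact V y v - mscale V (\<mu> y) v) \<in> W"
      using \<mu> v unfolding scalar_mod_def by (intro Wr(3)[OF Wr(6)[OF m(2)] Wr(5)]) blast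
    ultimately show "mact V y m \<in> ?N" using I by simp
  qed
qed

lemma maximal_submodule_eq_adjoin:
  assumes M: "lie_submodule V M" and W: "lie_submodule V W" and sub: "W \<subset> M"
    and max: "\<And>N. \<lbrakk>lie_submodule V N; W \<subseteq> N; N \<subseteq> M\<rbrakk> \<Longrightarrow> N = W \<or> N = M"
    and \<mu>: "scalar_mod \<mu> M W" and v: "v \<in> M" "v \<notin> W"
  shows "M = {w + mscale V c v |w c. w \<in> W}"
proof -
  note Mr = submoduleD[OF M] and Wr = submoduleD[OF W]
  let ?N = "{w + mscale V c v |w c. w \<in> W}"
  have I: "w + mscale V c v \<in> ?N" if "w \<in> W" for w c using that by blast
  have N: "lie_submodule V ?N"
    by (rule adjoin_submodule[OF M W psubset_imp_subset[OF sub] \<mu> v(1)])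
  have "w \<in> ?N" if "w \<in> W" for w
    using I[OF that, of 0] by simp
  then have WN: "W \<subseteq> ?N" by (rule subsetI)
  have NM: "?N \<subseteq> M"
  proof
    fix m assume "m \<in> ?N"
    then obtain w c where m: "m = w + mscale V c v" "w \<in> W" by blast
    have "w \<in> M" using m(2) sub by blast
    then show "m \<in> M" unfolding m(1) by (rule Mr(3)[OF _ Mr(5)[OF v(1)]])
  qed
  have vN: "v \<in> ?N" using I[OF Wr(2), of 1] by simp
  from max[OF N WN NM] show ?thesis
  proof
    assume "?N = W"
    then have "v \<in> W" using vN by (simp only:)
    with v(2) show ?thesis by (rule notE)
  qed (rule sym)
qed

end

context nilpotent_lie_module
begin

inductive flag :: "'v set \<Rightarrow> ('g \<Rightarrow> complex) set \<Rightarrow> bool" where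
  flag_zero: "flag {0} {}"
| flag_step: "\<lbrakk>flag W \<Lambda>; lie_submodule V M; W \<subseteq> M; v \<in> M; v \<notin> W;
    M = {w + mscale V c v |w c. w \<in> W}; scalar_mod \<mu> M W\<rbrakk> \<Longrightarrow> flag M (insert \<mu> \<Lambda>)"

lemma flag_submodule: "flag M \<Lambda> \<Longrightarrow> lie_submodule V M"
  by (induction rule: flag.induct) (auto intro: submodule_zero)

lemma flag_finite: "flag M \<Lambda> \<Longrightarrow> finite \<Lambda>"
  by (induction rule: flag.induct) auto

lemma submodule_subspace: "lie_submodule V M \<Longrightarrow> V.subspace M"
  and submodule_subset: "lie_submodule V M \<Longrightarrow> M \<subseteq> mspace V"
  by (auto simp: lie_submodule_def)

lemma submodule_dim_less:
  "\<lbrakk>lie_submodule V U; lie_submodule V M; U \<subset> M\<rbrakk> \<Longrightarrow> V.dim U < V.dim M"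
  by (intro dim_strict_mono finite_dim submodule_subspace submodule_subset)

lemma maximal_submodule_exists:
  assumes M: "lie_submodule V M" "M \<noteq> {0}"
  obtains W where "lie_submodule V W" "W \<subset> M"
    and "\<And>N. \<lbrakk>lie_submodule V N; W \<subseteq> N; N \<subseteq> M\<rbrakk> \<Longrightarrow> N = W \<or> N = M"
proof -
  let ?P = "\<lambda>W. lie_submodule V W \<and> W \<subset> M"
  have P0: "?P {0}" using M submodule_zero submoduleD(2)[OF M(1)] by auto
  have bound: "V.dim W \<le> V.dim M" if "?P W" for W
    using submodule_dim_less[OF _ M(1), of W] that by (simp add: less_imp_le)
  have "\<forall>N. ?P N \<longrightarrow> V.dim N < Suc (V.dim M)"
    using bound le_imp_less_Suc by blast
  with P0 have "\<exists>W. ?P W \<and> (\<forall>N. ?P N \<longrightarrow> V.dim N \<le> V.dim W)"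
    by (rule ex_has_greatest_nat)
  then obtain W where W: "?P W" "\<forall>N. ?P N \<longrightarrow> V.dim N \<le> V.dim W" by blast
  have "N = W \<or> N = M" if "lie_submodule V N" "W \<subseteq> N" "N \<subseteq> M" for N
    
  proof (rule ccontr)
    assume ne: "\<not> (N = W \<or> N = M)"
    then have "V.dim N \<le> V.dim W" using W(2) that by blast
    moreover have "V.dim W < V.dim N"
      using W(1) that ne by (intro submodule_dim_less) auto
    ultimately show False by simp
  qed
  with W(1) that show ?thesis by blast
qed

lemma flag_exists: "lie_submodule V M \<Longrightarrow> \<exists>\<Lambda>. flag M \<Lambda>"
proof (induction "V.dim M" arbitrary: M rule: less_induct)
  case less
  show ?case
  proof (cases "M = {0}")
    case True
    then show ?thesis using flag_zero by blast
  next
    case False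
    obtain W where W: "lie_submodule V W" "W \<subset> M"
      "\<And>N. \<lbrakk>lie_submodule V N; W \<subseteq> N; N \<subseteq> M\<rbrakk> \<Longrightarrow> N = W \<or> N = M"
      using maximal_submodule_exists[OF less.prems False] by blast
    obtain \<Lambda> where \<Lambda>: "flag W \<Lambda>"
      using less.hyps[OF submodule_dim_less[OF W(1) less.prems W(2)] W(1)] by blast
    obtain \<mu> where \<mu>: "scalar_mod \<mu> M W"
      by (rule scalar_mod_maximal[OF less.prems W])
    obtain v where v: "v \<in> M" "v \<notin> W" using W(2) by blast
    have "M = {w + mscale V c v |w c. w \<in> W}"
      by (rule maximal_submodule_eq_adjoin[OF less.prems W \<mu> v])
    with \<Lambda> less.prems W(2) v \<mu> have "flag M (insert \<mu> \<Lambda>)"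
      by (intro flag_step[of W]) auto
    then show ?thesis by blast
  qed
qed

definition linear_form :: "('g \<Rightarrow> complex) \<Rightarrow> bool" where
  "linear_form \<mu> \<longleftrightarrow> (\<forall>x y. \<mu> (x + y) = \<mu> x + \<mu> y) \<and> (\<forall>c x. \<mu> (lscale L c x) = c * \<mu> x)"

lemma scalar_mod_linear:
  assumes M: "lie_submodule V M" and W: "lie_submodule V W"
    and \<mu>: "scalar_mod \<mu> M W" and v: "v \<in> M" "v \<notin> W"
  shows "linear_form \<mu>"
proof -
  note Wr = submoduleD[OF W]
  have vV: "v \<in> mspace V" using v M submoduleD(1) by blast
  let ?r = "\<lambda>x. mact V x v - mscale V (\<mu> x) v"
  have r: "?r x \<in> W" for x using \<mu> v(1) by (auto simp: scalar_mod_def)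
  have zero: "a = 0" if "mscale V a v \<in> W" for a
    using that v(2) submodule_scale_iff[OF W] by blast
  have "\<mu> (x + y) = \<mu> x + \<mu> y" for x y
  proof -
    have "mscale V (\<mu> (x + y) - (\<mu> x + \<mu> y)) v = (?r x + ?r y) - ?r (x + y)"
      using vV by (simp add: act_add_left V.scale_left_distrib V.scale_left_diff_distrib)
    also have "\<dots> \<in> W" by (rule Wr(4)[OF Wr(3)[OF r r] r])
    finally show ?thesis using zero by force
  qed
  moreover have "\<mu> (lscale L c x) = c * \<mu> x" for c x
  proof -
    have "mscale V (\<mu> (lscale L c x) - c * \<mu> x) v = mscale V c (?r x) - ?r (lscale L c x)"
      using vV by (simp add: act_scale_left V.scale_right_diff_distrib V.scale_left_diff_distrib)
    also have "\<dots> \<in> W" by (rule Wr(4)[OF Wr(5)[OF r] r])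
    finally show ?thesis using zero by force
  qed
  ultimately show ?thesis by (simp add: linear_form_def)
qed

lemma weight_vector_linear:
  assumes "weight_vector \<mu> v"
  shows "linear_form \<mu>"
proof (rule scalar_mod_linear[OF _ submodule_zero])
  show "lie_submodule V {mscale V c v |c. True}"
    using assms unfolding lie_submodule_def weight_vector_def
    by (auto intro!: V.subspaceI simp: act_scale_right V.scale_left_distrib[symmetric])
  show "scalar_mod \<mu> {mscale V c v |c. True} {0}"
    using assms by (auto simp: scalar_mod_def weight_vector_def act_scale_right mult.commute)
  show "v \<in> {mscale V c v |c. True}" by (metis (mono_tags) V.scale_one mem_Collect_eq)
  show "v \<notin> {0}" using assms by (simp add: weight_vector_def)
qed

lemma flag_linear: "\<lbrakk>flag M \<Lambda>; \<mu> \<in> \<Lambda>\<rbrakk> \<Longrightarrow> linear_form \<mu>"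
  by (induction rule: flag.induct) (auto intro: scalar_mod_linear flag_submodule)

lemma separating_element:
  assumes "finite \<Lambda>" "\<And>\<mu>. \<mu> \<in> \<Lambda> \<Longrightarrow> linear_form \<mu>" "linear_form \<kappa>" "\<kappa> \<notin> \<Lambda>"
  obtains x where "\<And>\<mu>. \<mu> \<in> \<Lambda> \<Longrightarrow> \<mu> x \<noteq> \<kappa> x"
proof -
  have "\<exists>x. \<forall>\<mu>\<in>\<Lambda>. \<mu> x \<noteq> \<kappa> x"
    using assms
  proof (induction rule: finite_induct)
    case (insert \<mu> \<Lambda>)
    then obtain x where x: "\<forall>\<nu>\<in>\<Lambda>. \<nu> x \<noteq> \<kappa> x" by auto
    have "\<mu> \<noteq> \<kappa>" using insert.prems by auto
    then obtain y where y: "\<mu> y \<noteq> \<kappa> y" by auto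
    let ?B = "(\<lambda>\<nu>. - (\<nu> x - \<kappa> x) / (\<nu> y - \<kappa> y)) ` insert \<mu> \<Lambda>"
    have "finite ?B" using insert.hyps by simp
    then obtain t where t: "t \<notin> ?B" using ex_new_if_finite[OF infinite_UNIV_char_0] by blast
    have "\<nu> (x + lscale L t y) \<noteq> \<kappa> (x + lscale L t y)" if \<nu>: "\<nu> \<in> insert \<mu> \<Lambda>" for \<nu>
    proof
      assume eq: "\<nu> (x + lscale L t y) = \<kappa> (x + lscale L t y)"
      have "linear_form \<nu>" using insert.prems \<nu> by blast
      then have *: "(\<nu> x - \<kappa> x) + t * (\<nu> y - \<kappa> y) = 0"
        using eq insert.prems(2) by (simp add: linear_form_def algebra_simps)
      show False
      proof (cases "\<nu> y = \<kappa> y")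
        case True
        then have "\<nu> \<in> \<Lambda>" using \<nu> y by auto
        with * True x show False by simp
      next
        case False
        with * have "t = - (\<nu> x - \<kappa> x) / (\<nu> y - \<kappa> y)"
          by (simp add: field_simps)
        then show False using t \<nu> by blast
      qed
    qed
    then show ?case by blast
  qed simp
  then show ?thesis using that by blast
qed

lemma shifted_bij:
  assumes "flag M \<Lambda>" and "\<And>\<mu>. \<mu> \<in> \<Lambda> \<Longrightarrow> \<mu> x \<noteq> a"
  shows "bij_betw (\<lambda>m. mact V x m - mscale V a m) M M"
proof -
  let ?D = "\<lambda>m. mact V x m - mscale V a m"
  have M: "lie_submodule V M" using assms(1) by (rule flag_submodule)
  have "(\<forall>m\<in>M. ?D m = 0 \<longrightarrow> m = 0) \<and> M \<subseteq> ?D ` M"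
    using assms
  proof (induction rule: flag.induct)
    case flag_zero
    show ?case by simp
  next
    case (flag_step W \<Lambda> M v \<mu>)
    have W: "lie_submodule V W" using flag_step.hyps(1) by (rule flag_submodule)
    note Mr = submoduleD[OF flag_step.hyps(2)] and Wr = submoduleD[OF W]
    have IH: "\<And>m. m \<in> W \<Longrightarrow> ?D m = 0 \<Longrightarrow> m = 0" "W \<subseteq> ?D ` W"
      using flag_step by auto
    have b: "\<mu> x - a \<noteq> 0" using flag_step.prems by simp
    have r: "mact V x m - mscale V (\<mu> x) m \<in> W" if "m \<in> M" for m
      using flag_step.hyps(7) that by (auto simp: scalar_mod_def)
    have "m = 0" if m: "m \<in> M" "?D m = 0" for m
    proof -
      have "mscale V (\<mu> x - a) m = ?D m - (mact V x m - mscale V (\<mu> x) m)"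
        by (simp add: V.scale_left_diff_distrib)
      also have "\<dots> \<in> W" unfolding m(2) by (rule Wr(4)[OF Wr(2) r[OF m(1)]])
      finally have "m \<in> W" using submodule_scale_iff[OF W b] by simp
      then show ?thesis using IH(1) m(2) by blast
    qed
    moreover have "m \<in> ?D ` M" if m: "m \<in> M" for m
    proof -
      obtain w c where wc: "m = w + mscale V c v" "w \<in> W"
        using m flag_step.hyps(6) by blast
      let ?r = "mact V x v - mscale V (\<mu> x) v"
      let ?c = "c / (\<mu> x - a)"
      have "w - mscale V ?c ?r \<in> W"
        by (rule Wr(4)[OF wc(2) Wr(5)[OF r[OF flag_step.hyps(4)]]])
      then obtain w' where w': "w' \<in> W" "?D w' = w - mscale V ?c ?r" using IH(2) by force
      have V: "w' \<in> mspace V" "v \<in> mspace V"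
        using w'(1) flag_step.hyps(4) Wr(1) Mr(1) by auto
      have c: "c = ?c * (\<mu> x - a)" using b by simp
      have "?D (w' + mscale V ?c v) = ?D w' + mscale V ?c (?D v)"
        using V by (simp add: act_add_right act_scale_right V.scale_right_distrib
            V.scale_right_diff_distrib mult.commute)
      also have "\<dots> = w + mscale V ?c (?D v - ?r)"
        unfolding w'(2) by (simp only: V.scale_right_diff_distrib) simp
      also have "?D v - ?r = mscale V (\<mu> x - a) v"
        by (simp add: V.scale_left_diff_distrib)
      also have "w + mscale V ?c \<dots> = m"
        unfolding wc(1) V.scale_scale by (subst (2) c) (rule refl)
      finally have "m = ?D (w' + mscale V ?c v)" by (rule sym)
      moreover have "w' + mscale V ?c v \<in> M"
        using w'(1) flag_step.hyps(3,4) by (intro Mr(3) Mr(5)) auto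
      ultimately show ?thesis by (rule image_eqI)
    qed
    ultimately show ?case by blast
  qed
  then have ker: "\<And>m. m \<in> M \<Longrightarrow> ?D m = 0 \<Longrightarrow> m = 0" and surj: "M \<subseteq> ?D ` M" by auto
  note Mr = submoduleD[OF M]
  have "inj_on ?D M"
  proof (rule inj_onI)
    fix m n assume mn: "m \<in> M" "n \<in> M" "?D m = ?D n"
    have "?D (m - n) = ?D m - ?D n"
      using mn(1,2) Mr(1) by (simp add: act_diff_right V.scale_right_diff_distrib)
    also have "\<dots> = 0" using mn(3) by simp
    finally have "m - n = 0" using ker Mr(4)[OF mn(1,2)] by blast
    then show "m = n" by simp
  qed
  moreover have "?D ` M \<subseteq> M" using Mr(4,5,6) by blast
  ultimately show ?thesis using surj unfolding bij_betw_def by blast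
qed

lemma flag_weight_vector:
  "\<lbrakk>flag M \<Lambda>; \<kappa> \<in> \<Lambda>\<rbrakk> \<Longrightarrow> \<exists>v\<in>M. weight_vector \<kappa> v"
proof (induction rule: flag.induct)
  case (flag_step W \<Lambda> M v \<mu>)
  show ?case
  proof (cases "\<kappa> \<in> \<Lambda>")
    case True
    then show ?thesis using flag_step by blast
  next
    case False
    then have \<kappa>: "\<kappa> = \<mu>" using flag_step.prems by blast
    have W: "lie_submodule V W" using flag_step.hyps(1) by (rule flag_submodule)
    note M = flag_step.hyps(2)
    note Mr = submoduleD[OF M] and Wr = submoduleD[OF W]
    have lin: "linear_form \<kappa>"
      unfolding \<kappa> by (rule scalar_mod_linear[OF M W flag_step.hyps(7,4,5)])
    obtain x where x: "\<And>\<nu>. \<nu> \<in> \<Lambda> \<Longrightarrow> \<nu> x \<noteq> \<kappa> x"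
      using separating_element[OF flag_finite[OF flag_step.hyps(1)] flag_linear[OF flag_step.hyps(1)] lin False]
      by blast
    let ?D = "\<lambda>m. mact V x m - mscale V (\<kappa> x) m"
    have bij: "bij_betw ?D W W"
      using flag_step.hyps(1) x by (rule shifted_bij)
    have r: "mact V y m - mscale V (\<kappa> y) m \<in> W" if "m \<in> M" for y m
      using flag_step.hyps(7) that \<kappa> by (auto simp: scalar_mod_def)
    obtain w where w: "w \<in> W" "?D v = ?D w"
      using bij r[OF flag_step.hyps(4), of x] unfolding bij_betw_def by blast
    have wM: "w \<in> M" using w(1) flag_step.hyps(3) by blast
    define u where "u = v - w"
    have uM: "u \<in> M" unfolding u_def by (rule Mr(4)[OF flag_step.hyps(4) wM])
    have "u \<notin> W" using flag_step.hyps(5) Wr(3)[OF _ w(1), of u] by (auto simp: u_def)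
    then have "u \<noteq> 0" using Wr(2) by auto
    have "?D u = ?D v - ?D w"
      using Mr(1) wM flag_step.hyps(4) by (simp add: u_def act_diff_right V.scale_right_diff_distrib)
    then have Du: "?D u = 0" using w(2) by simp
    let ?G = "gen_eigenspace M {0} x (\<kappa> x)"
    have G: "lie_submodule V ?G"
      by (rule gen_eigenspace_submodule[OF M submodule_zero]) (simp add: Mr(2))
    have 0: "{0} \<subseteq> M" using Mr(2) by simp
    have G0: "0 \<in> ?G" using submoduleD(2)[OF G] .
    have uG: "u \<in> ?G"
      by (rule gen_eigenspace_step[OF M submodule_zero 0 uM]) (simp only: Du G0)
    have GW: "g = 0" if "g \<in> ?G" "g \<in> W" for g
      using that
    proof (induction rule: gen_eigenspace_induct[OF M submodule_zero 0, consumes 1, case_names base shift])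
      case (shift g)
      have "?D g \<in> W" using Wr(4)[OF Wr(6)[OF shift.prems] Wr(5)[OF shift.prems]] .
      then have "?D g = ?D 0" using shift.IH by simp
      then show ?case
        using inj_onD[OF bij_betw_imp_inj_on[OF bij]] shift.prems Wr(2) by blast
    qed simp
    have "mact V y u = mscale V (\<kappa> y) u" for y
    proof -
      have "mact V y u - mscale V (\<kappa> y) u \<in> ?G"
        by (rule submoduleD(4)[OF G submoduleD(6)[OF G uG] submoduleD(5)[OF G uG]])
      from GW[OF this r[OF uM]] show ?thesis by simp
    qed
    then have "weight_vector \<kappa> u"
      using uM Mr(1) \<open>u \<noteq> 0\<close> by (simp add: weight_vector_def)
    then show ?thesis using uM by blast
  qed
qed simp

lemma weight_vector_in_flag:
  "\<lbrakk>flag M \<Lambda>; w \<in> M; weight_vector \<kappa> w\<rbrakk> \<Longrightarrow> \<kappa> \<in> \<Lambda>"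
proof (induction rule: flag.induct)
  case flag_zero
  then show ?case by (simp add: weight_vector_def)
next
  case (flag_step W \<Lambda> M v \<mu>)
  show ?case
  proof (cases "w \<in> W")
    case True
    then show ?thesis using flag_step by blast
  next
    case False
    have W: "lie_submodule V W" using flag_step.hyps(1) by (rule flag_submodule)
    have "\<kappa> y = \<mu> y" for y
    proof -
      have "mact V y w - mscale V (\<mu> y) w \<in> W"
        using flag_step.hyps(7) flag_step.prems(1) by (auto simp: scalar_mod_def)
      then have "mscale V (\<kappa> y - \<mu> y) w \<in> W"
        using flag_step.prems(2) by (simp add: weight_vector_def V.scale_left_diff_distrib)
      then show ?thesis using False submodule_scale_iff[OF W, of "\<kappa> y - \<mu> y"] by fastforce
    qed
    then have "\<kappa> = \<mu>" by auto
    then show ?thesis by simp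
  qed
qed

lemma flag_quotient:
  "\<lbrakk>flag M \<Lambda>; \<kappa> \<in> \<Lambda>\<rbrakk> \<Longrightarrow> \<exists>N. lie_submodule V N \<and> N \<subset> M \<and> scalar_mod \<kappa> M N"
proof (induction rule: flag.induct)
  case (flag_step W \<Lambda> M v \<mu>)
  have W: "lie_submodule V W" using flag_step.hyps(1) by (rule flag_submodule)
  note M = flag_step.hyps(2) and sub = flag_step.hyps(3)
  note Mr = submoduleD[OF M] and Wr = submoduleD[OF W]
  show ?case
  proof (cases "\<kappa> = \<mu>")
    case True
    then show ?thesis using W sub flag_step.hyps(4,5,7) by blast
  next
    case False
    then obtain N where N: "lie_submodule V N" "N \<subset> W" "scalar_mod \<kappa> W N"
      using flag_step by blast
    note Nr = submoduleD[OF N(1)]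
    have NM: "N \<subseteq> M" using N(2) sub by blast
    obtain y where y: "\<mu> y \<noteq> \<kappa> y" using False by (metis ext)
    let ?D = "\<lambda>m. mact V y m - mscale V (\<mu> y) m"
    let ?E = "gen_eigenspace M N y (\<mu> y)"
    have E: "lie_submodule V ?E"
      by (rule gen_eigenspace_submodule[OF M N(1) NM])
    note Er = submoduleD[OF E]
    have NE: "N \<subseteq> ?E" by (rule subset_gen_eigenspace[OF M N(1) NM])
    have rW: "mact V z m - mscale V (\<kappa> z) m \<in> N" if "m \<in> W" for z m
      using N(3) that by (auto simp: scalar_mod_def)
    have EW: "g \<in> N" if "g \<in> ?E" "g \<in> W" for g
      using that
    proof (induction rule: gen_eigenspace_induct[OF M N(1) NM, consumes 1, case_names base shift])
      case (shift g)
      have "?D g \<in> W" using Wr(4)[OF Wr(6)[OF shift.prems] Wr(5)[OF shift.prems]] .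
      then have "?D g \<in> N" by (rule shift.IH)
      from Nr(4)[OF rW[OF shift.prems, of y] this]
      have "mscale V (\<mu> y - \<kappa> y) g \<in> N" by (simp add: V.scale_left_diff_distrib)
      then show ?case using submodule_scale_iff[OF N(1)] y by simp
    qed
    let ?b = "inverse (\<mu> y - \<kappa> y)"
    have vM: "v \<in> M" by fact
    have Dv: "?D v \<in> W" using flag_step.hyps(7) vM by (auto simp: scalar_mod_def)
    define v' where "v' = v + mscale V ?b (?D v)"
    have DvM: "?D v \<in> M" using Dv sub by blast
    have v'M: "v' \<in> M" unfolding v'_def by (rule Mr(3)[OF vM Mr(5)[OF DvM]])
    have "?D v' = ?D v + mscale V ?b (?D (?D v))"
      unfolding v'_def
      by (simp only: shifted_add[OF M N(1) NM vM Mr(5)[OF DvM]] shifted_scale[OF M N(1) NM DvM])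
    also have "?D (?D v) = (mact V y (?D v) - mscale V (\<kappa> y) (?D v)) - mscale V (\<mu> y - \<kappa> y) (?D v)"
      by (simp only: V.scale_left_diff_distrib) simp
    also have "?D v + mscale V ?b \<dots> = mscale V ?b (mact V y (?D v) - mscale V (\<kappa> y) (?D v))"
      using y by (simp only: V.scale_right_diff_distrib[of ?b "_ - _"] V.scale_scale) simp
    also have "\<dots> \<in> N" by (rule Nr(5)[OF rW[OF Dv]])
    finally have "?D v' \<in> ?E" using NE by blast
    then have v'E: "v' \<in> ?E" by (rule gen_eigenspace_step[OF M N(1) NM v'M])
    have "scalar_mod \<kappa> M ?E"
      unfolding scalar_mod_def
    proof (intro allI ballI)
      fix z m assume m: "m \<in> M"
      then obtain w c where wc: "m = w + mscale V c v" "w \<in> W"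
        using flag_step.hyps(6) by blast
      define w' where "w' = w - mscale V (c * ?b) (?D v)"
      have w'W: "w' \<in> W" unfolding w'_def by (rule Wr(4)[OF wc(2) Wr(5)[OF Dv]])
      have m': "m = w' + mscale V c v'"
        by (simp add: wc(1) w'_def v'_def V.scale_right_distrib)
      have V: "w' \<in> mspace V" "v' \<in> mspace V" using w'W v'M Wr(1) Mr(1) by auto
      have "mact V z m - mscale V (\<kappa> z) m
          = (mact V z w' - mscale V (\<kappa> z) w') + mscale V c (mact V z v' - mscale V (\<kappa> z) v')"
        using V by (simp add: m' act_add_right act_scale_right V.scale_right_distrib
            V.scale_right_diff_distrib mult.commute)
      also have "\<dots> \<in> ?E"
        by (rule Er(3)[OF subsetD[OF NE rW[OF w'W]] Er(5)[OF Er(4)[OF Er(6)[OF v'E] Er(5)[OF v'E]]]])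
      finally show "mact V z m - mscale V (\<kappa> z) m \<in> ?E" .
    qed
    moreover have "?E \<subseteq> M" by (rule gen_eigenspace_subset[OF M N(1) NM])
    moreover have "?E \<noteq> M" using EW N(2) sub by blast
    ultimately show ?thesis using E by blast
  qed
qed simp

lemma weight_quotient:
  assumes "weight_vector \<kappa> w"
  obtains N where "lie_submodule V N" "N \<subset> mspace V" "scalar_mod \<kappa> (mspace V) N"
proof -
  obtain \<Lambda> where \<Lambda>: "flag (mspace V) \<Lambda>" using flag_exists[OF submodule_mspace] by blast
  have "\<kappa> \<in> \<Lambda>" using weight_vector_in_flag[OF \<Lambda> _ assms] assms by (simp add: weight_vector_def)
  then show ?thesis using flag_quotient[OF \<Lambda>] that by blast
qed

lemma nonweight_bij:
  assumes "linear_form \<kappa>" and "\<And>v. \<not> weight_vector \<kappa> v"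
  obtains x where "bij_betw (\<lambda>v. mact V x v - mscale V (\<kappa> x) v) (mspace V) (mspace V)"
proof -
  obtain \<Lambda> where \<Lambda>: "flag (mspace V) \<Lambda>" using flag_exists[OF submodule_mspace] by blast
  have "\<kappa> \<notin> \<Lambda>" using flag_weight_vector[OF \<Lambda>] assms(2) by blast
  then obtain x where "\<And>\<mu>. \<mu> \<in> \<Lambda> \<Longrightarrow> \<mu> x \<noteq> \<kappa> x"
    using separating_element[OF flag_finite[OF \<Lambda>] flag_linear[OF \<Lambda>] assms(1)] by blast
  then show ?thesis using shifted_bij[OF \<Lambda>] that by blast
qed

lemma simple_one_dim:
  assumes "lie_simple V"
  obtains v \<mu> where "weight_vector \<mu> v" "mspace V = {mscale V c v |c. True}"
proof -
  have ne: "mspace V \<noteq> {0}" and simp: "\<And>W. lie_submodule V W \<Longrightarrow> W = {0} \<or> W = mspace V"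
    using assms by (auto simp: lie_simple_def)
  have sub: "{0} \<subset> mspace V" using ne by auto
  obtain \<mu> where \<mu>: "scalar_mod \<mu> (mspace V) {0}"
    by (rule scalar_mod_maximal[OF submodule_mspace submodule_zero sub]) (use simp in blast)+
  obtain v where v: "v \<in> mspace V" "v \<noteq> 0" using sub by auto
  have "mspace V = {w + mscale V c v |w c. w \<in> {0}}"
    by (rule maximal_submodule_eq_adjoin[OF submodule_mspace submodule_zero sub _ \<mu> v(1)])
      (use simp v in blast)+
  then have "mspace V = {mscale V c v |c. True}" by auto
  moreover have "weight_vector \<mu> v"
    using \<mu> v by (auto simp: weight_vector_def scalar_mod_def)
  ultimately show ?thesis using that by blast
qed

end

section \<open>The universal enveloping algebra and its modules\<close>

lemma poly_mapping_induct_add [case_names single add]: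
  assumes single: "\<And>k c. Q (Poly_Mapping.single k c)" and add: "\<And>f g. Q f \<Longrightarrow> Q g \<Longrightarrow> Q (f + g)"
  shows "Q (p :: 'a \<Rightarrow>\<^sub>0 'b::comm_monoid_add)"
proof (induction p rule: update_induct)
  case const
  show ?case using single[of undefined 0] by simp
next
  case (update f a b)
  have "Poly_Mapping.update a b f = f + Poly_Mapping.single a b"
    using update(1) by (intro poly_mapping_eqI)
      (auto simp: lookup_update lookup_add lookup_single when_def in_keys_iff)
  then show ?case using add[OF update(3) single] by simp
qed

lemma free_algebra_simps [simp]:
  "carrier free_algebra = UNIV" "p \<otimes>\<^bsub>free_algebra\<^esub> q = p * q" "\<one>\<^bsub>free_algebra\<^esub> = 1"
  "\<zero>\<^bsub>free_algebra\<^esub> = 0" "p \<oplus>\<^bsub>free_algebra\<^esub> q = p + q"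
  by (simp_all add: free_algebra_def)

lemma ring_free_algebra: "ring free_algebra"
proof (rule ringI)
  show "abelian_group (free_algebra :: 'g free_alg ring)"
  proof (rule abelian_groupI)
    fix p :: "'g free_alg"
    show "\<exists>q\<in>carrier free_algebra. q \<oplus>\<^bsub>free_algebra\<^esub> p = \<zero>\<^bsub>free_algebra\<^esub>"
      by (intro bexI[of _ "- p"]) simp_all
  qed (simp_all add: ac_simps)
  show "Group.monoid (free_algebra :: 'g free_alg ring)"
    by (rule Group.monoidI) (simp_all add: mult.assoc)
qed (simp_all add: algebra_simps)

lemma Letters_Cons: "Letters (x # xs) = Letters [x] + Letters xs"
  by (simp add: plus_free_word_def)

lemma single_Letters_Cons: "Poly_Mapping.single (Letters (x # xs)) c = gen x * Poly_Mapping.single (Letters xs) c"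
  by (simp add: gen_def mult_single Letters_Cons[of x xs])

lemma scalar_commutes: "Poly_Mapping.single 0 c * p = p * Poly_Mapping.single 0 (c :: complex)"
  for p :: "'g free_alg"
  by (induction p rule: poly_mapping_induct_add) (simp_all add: mult_single distrib_left distrib_right mult.commute)

definition uea_ideal :: "'g::ab_group_add lie_algebra \<Rightarrow> 'g free_alg set" where
  "uea_ideal L = Idl\<^bsub>free_algebra\<^esub> (uea_relations L)"

definition uea_class :: "'g::ab_group_add lie_algebra \<Rightarrow> 'g free_alg \<Rightarrow> 'g free_alg set" where
  "uea_class L p = uea_ideal L +>\<^bsub>free_algebra\<^esub> p"

lemma ideal_uea_ideal: "ideal (uea_ideal L) free_algebra"
  unfolding uea_ideal_def by (rule ring.genideal_ideal[OF ring_free_algebra]) simp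

lemma ring_uea: "ring (uea L)"
  using ideal.quotient_is_ring[OF ideal_uea_ideal] by (simp add: uea_def uea_ideal_def)

lemma uea_class_hom: "uea_class L \<in> ring_hom free_algebra (uea L)"
proof -
  have "uea_class L = (+>\<^bsub>free_algebra\<^esub>) (uea_ideal L)"
    by (simp add: fun_eq_iff uea_class_def)
  then show ?thesis
    using ideal.rcos_ring_hom[OF ideal_uea_ideal] by (simp add: uea_def uea_ideal_def)
qed

lemma uea_class_closed [simp]: "uea_class L p \<in> carrier (uea L)"
  and uea_class_add: "uea_class L (p + q) = uea_class L p \<oplus>\<^bsub>uea L\<^esub> uea_class L q"
  and uea_class_mult: "uea_class L (p * q) = uea_class L p \<otimes>\<^bsub>uea L\<^esub> uea_class L q"
  and uea_class_one: "uea_class L 1 = \<one>\<^bsub>uea L\<^esub>"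
  using ring_hom_closed[OF uea_class_hom, of p] ring_hom_add[OF uea_class_hom, of p q]
    ring_hom_mult[OF uea_class_hom, of p q] ring_hom_one[OF uea_class_hom] by simp_all

lemma uea_class_zero: "uea_class L 0 = \<zero>\<^bsub>uea L\<^esub>"
  using ring_hom_zero[OF uea_class_hom ring_free_algebra ring_uea] by simp

lemma uea_class_diff: "uea_class L (p - q) = uea_class L p \<ominus>\<^bsub>uea L\<^esub> uea_class L q"
proof -
  interpret U: ring "uea L" by (rule ring_uea)
  have "uea_class L p = uea_class L q \<oplus>\<^bsub>uea L\<^esub> uea_class L (p - q)"
    by (simp add: uea_class_add[symmetric])
  then show ?thesis
    using U.add_minus_cancel[of "uea_class L q" "uea_class L (p - q)"] by simp
qed

lemma carrier_uea: "carrier (uea L) = range (uea_class L)"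
  unfolding uea_def FactRing_def A_RCOSETS_def' uea_class_def uea_ideal_def by auto

lemma uea_class_eq_image: "uea_class L p = (\<lambda>h. h + p) ` uea_ideal L"
  unfolding uea_class_def a_r_coset_def r_coset_def by auto

lemma uea_class_relation: "r \<in> uea_relations L \<Longrightarrow> uea_class L r = \<zero>\<^bsub>uea L\<^esub>"
proof -
  assume "r \<in> uea_relations L"
  then have "r \<in> uea_ideal L"
    unfolding uea_ideal_def using ring.genideal_self[OF ring_free_algebra] by auto
  then have "uea_class L r = uea_ideal L"
    unfolding uea_class_def
    using abelian_subgroup.a_rcos_const[of "uea_ideal L" free_algebra r] ideal_uea_ideal[of L]
      abelian_subgroupI3[of "uea_ideal L" free_algebra] ideal.axioms(1)[OF ideal_uea_ideal[of L]]
      ring.is_abelian_group[OF ring_free_algebra]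
    by blast
  also have "\<dots> = uea_class L 0" by (simp add: uea_class_eq_image)
  finally show ?thesis by (simp add: uea_class_zero)
qed

lemma uea_class_eqI: "p - q \<in> uea_relations L \<Longrightarrow> uea_class L p = uea_class L q"
proof -
  interpret U: ring "uea L" by (rule ring_uea)
  assume "p - q \<in> uea_relations L"
  then have "uea_class L (p - q) = \<zero>\<^bsub>uea L\<^esub>" by (rule uea_class_relation)
  then show ?thesis
    unfolding uea_class_diff by (rule U.minus_eq_zeroD) simp_all
qed

lemma uea_class_gen_add: "uea_class L (gen (x + y)) = uea_class L (gen x + gen y)"
  by (rule uea_class_eqI) (auto simp: uea_relations_def diff_diff_eq[symmetric])

lemma uea_class_gen_zero: "uea_class L (gen 0) = \<zero>\<^bsub>uea L\<^esub>"
proof -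
  interpret U: ring "uea L" by (rule ring_uea)
  have "uea_class L (gen 0) = uea_class L (gen 0) \<oplus>\<^bsub>uea L\<^esub> uea_class L (gen 0)"
    using uea_class_gen_add[of L 0 0] by (simp add: uea_class_add)
  then show ?thesis by (metis U.add.l_cancel_one' uea_class_closed)
qed

lemma uea_class_gen_bracket:
  "uea_class L (gen x * gen y - gen y * gen x) = uea_class L (gen (bracket L x y))"
  by (rule uea_class_eqI) (auto simp: uea_relations_def)

lemma uea_induct [consumes 1, case_names gen scalar add mult]:
  assumes "a \<in> carrier (uea L)"
    and gen: "\<And>x. Q (uea_class L (gen x))"
    and scalar: "\<And>c. Q (uea_class L (Poly_Mapping.single 0 c))"
    and add: "\<And>a b. \<lbrakk>a \<in> carrier (uea L); b \<in> carrier (uea L); Q a; Q b\<rbrakk> \<Longrightarrow> Q (a \<oplus>\<^bsub>uea L\<^esub> b)"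
    and mult: "\<And>a b. \<lbrakk>a \<in> carrier (uea L); b \<in> carrier (uea L); Q a; Q b\<rbrakk> \<Longrightarrow> Q (a \<otimes>\<^bsub>uea L\<^esub> b)"
  shows "Q a"
proof -
  obtain p where p: "a = uea_class L p" using assms(1) by (auto simp: carrier_uea)
  have "Q (uea_class L p)" for p
  proof (induction p rule: poly_mapping_induct_add)
    case (single w c)
    have "Q (uea_class L (Poly_Mapping.single (Letters xs) c))" for xs
    proof (induction xs)
      case Nil
      show ?case using scalar[of c] by (simp add: zero_free_word_def)
    next
      case (Cons x xs)
      show ?case
        unfolding single_Letters_Cons uea_class_mult by (intro mult gen Cons.IH uea_class_closed)
    qed
    from this[of "letters w"] show ?case by simp
  next
    case (add f g)
    then show ?case unfolding uea_class_add by (intro assms(4) uea_class_closed)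
  qed
  then show ?thesis by (simp add: p)
qed

context lie_module
begin

lemma word_act:
  assumes "v \<in> mspace V"
  shows "foldr (mact V) xs v \<in> mspace V"
    and "w \<in> mspace V \<Longrightarrow> foldr (mact V) xs (v + w) = foldr (mact V) xs v + foldr (mact V) xs w"
    and "foldr (mact V) xs (mscale V c v) = mscale V c (foldr (mact V) xs v)"
proof -
  have closed: "foldr (mact V) xs v \<in> mspace V" if "v \<in> mspace V" for v xs
    using that by (induction xs) (auto simp: act_closed)
  show "foldr (mact V) xs v \<in> mspace V" using assms by (rule closed)
  show "foldr (mact V) xs (v + w) = foldr (mact V) xs v + foldr (mact V) xs w" if "w \<in> mspace V"
    using assms that by (induction xs) (auto simp: act_add_right closed)
  show "foldr (mact V) xs (mscale V c v) = mscale V c (foldr (mact V) xs v)"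
    using assms by (induction xs) (auto simp: act_scale_right closed)
qed

lemma free_alg_act_single:
  "free_alg_act V (Poly_Mapping.single w c) v = mscale V c (foldr (mact V) (letters w) v)"
  by (cases "c = 0") (simp_all add: free_alg_act_def)

lemma free_alg_act_add: "free_alg_act V (p + q) v = free_alg_act V p v + free_alg_act V q v"
  unfolding free_alg_act_def
  by (rule setsum_keys_plus_distrib[of "\<lambda>w c. mscale V c (foldr (mact V) (letters w) v)"])
    (simp_all add: V.scale_left_distrib)

lemma free_alg_act_closed: "v \<in> mspace V \<Longrightarrow> free_alg_act V p v \<in> mspace V"
  by (induction p rule: poly_mapping_induct_add) (simp_all add: free_alg_act_single free_alg_act_add word_act)

lemma free_alg_act_add_right:
  "\<lbrakk>v \<in> mspace V; w \<in> mspace V\<rbrakk> \<Longrightarrow> free_alg_act V p (v + w) = free_alg_act V p v + free_alg_act V p w"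
  by (induction p rule: poly_mapping_induct_add)
    (simp_all add: free_alg_act_single free_alg_act_add word_act V.scale_right_distrib)

lemma free_alg_act_scale_right:
  "v \<in> mspace V \<Longrightarrow> free_alg_act V p (mscale V c v) = mscale V c (free_alg_act V p v)"
  by (induction p rule: poly_mapping_induct_add)
    (simp_all add: free_alg_act_single free_alg_act_add word_act V.scale_right_distrib mult.commute)

lemma free_alg_act_zero_right [simp]: "free_alg_act V p 0 = 0"
  using free_alg_act_scale_right[of 0 p 0] by simp

lemma free_alg_act_mult:
  assumes v: "v \<in> mspace V"
  shows "free_alg_act V (p * q) v = free_alg_act V p (free_alg_act V q v)"
proof (induction p rule: poly_mapping_induct_add)
  case (single w c)
  show ?case
  proof (induction q rule: poly_mapping_induct_add)
    case (single w' c')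
    show ?case
      using v by (simp add: mult_single free_alg_act_single plus_free_word_def word_act)
  next
    case (add f g)
    then show ?case
      using v by (simp add: distrib_left free_alg_act_add free_alg_act_add_right free_alg_act_closed)
  qed
next
  case (add f g)
  then show ?case by (simp add: distrib_right free_alg_act_add)
qed

lemma free_alg_act_gen [simp]: "free_alg_act V (gen x) v = mact V x v"
  by (simp add: gen_def free_alg_act_single)

lemma free_alg_act_scalar [simp]: "free_alg_act V (Poly_Mapping.single 0 c) v = mscale V c v"
  by (simp add: free_alg_act_single zero_free_word_def)

lemma free_alg_act_zero [simp]: "free_alg_act V 0 v = 0"
  by (simp add: free_alg_act_def)

lemma free_alg_act_diff: "free_alg_act V (p - q) v = free_alg_act V p v - free_alg_act V q v"
  using free_alg_act_add[of "p - q" q v] by simp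

lemma free_alg_act_uea_ideal:
  assumes "p \<in> uea_ideal L" "v \<in> mspace V"
  shows "free_alg_act V p v = 0"
proof -
  let ?A = "{p. \<forall>v\<in>mspace V. free_alg_act V p v = 0}"
  have "ideal ?A free_algebra"
  proof (rule idealI[OF ring_free_algebra])
    show "subgroup ?A (add_monoid free_algebra)"
    proof (rule group.subgroupI[OF abelian_group.a_group[OF ring.is_abelian_group[OF ring_free_algebra]]])
      fix p assume p: "p \<in> ?A"
      have "inv\<^bsub>add_monoid free_algebra\<^esub> p = - p"
        by (rule group.inv_equality[OF abelian_group.a_group[OF ring.is_abelian_group[OF ring_free_algebra]]])
          simp_all
      then show "inv\<^bsub>add_monoid free_algebra\<^esub> p \<in> ?A"
        using p free_alg_act_diff[of 0 p] by simp
    qed (auto simp: free_alg_act_add intro: exI[of _ 0])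
  qed (auto simp: free_alg_act_mult free_alg_act_closed)
  moreover have "uea_relations L \<subseteq> ?A"
    unfolding uea_relations_def
    by (auto simp: free_alg_act_diff free_alg_act_mult act_closed act_add_left act_scale_left act_bracket)
  ultimately have "uea_ideal L \<subseteq> ?A"
    unfolding uea_ideal_def by (rule ring.genideal_minimal[OF ring_free_algebra])
  with assms show ?thesis by blast
qed

lemma uea_act_class:
  assumes "v \<in> mspace V"
  shows "uea_act V (uea_class L p) v = free_alg_act V p v"
proof -
  have "0 \<in> uea_ideal L"
    using additive_subgroup.zero_closed[OF ideal.axioms(1)[OF ideal_uea_ideal]] by auto
  moreover have "free_alg_act V (h + p) v = free_alg_act V p v" if "h \<in> uea_ideal L" for h
    using that assms by (simp add: free_alg_act_add free_alg_act_uea_ideal)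
  ultimately have "(\<lambda>p. free_alg_act V p v) ` uea_class L p = {free_alg_act V p v}"
    unfolding uea_class_eq_image image_image by (intro image_eq_singletonI)
  then show ?thesis by (simp add: uea_act_def)
qed

lemma uea_left_module_simps [simp]:
  "carrier (uea_left_module V) = mspace V" "\<zero>\<^bsub>uea_left_module V\<^esub> = 0"
  "v \<oplus>\<^bsub>uea_left_module V\<^esub> w = v + w" "a \<odot>\<^bsub>uea_left_module V\<^esub> v = uea_act V a v"
  by (simp_all add: uea_left_module_def)

lemma left_module_uea: "left_module (uea L) (uea_left_module V)"
proof -
  have "abelian_group (uea_left_module V)"
  proof (rule abelian_groupI)
    fix v assume "v \<in> carrier (uea_left_module V)"
    then show "\<exists>w\<in>carrier (uea_left_module V). w \<oplus>\<^bsub>uea_left_module V\<^esub> v = \<zero>\<^bsub>uea_left_module V\<^esub>"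
      using mspace_diff[of 0 v] by (intro bexI[of _ "- v"]) simp_all
  qed (simp_all add: ac_simps)
  then show ?thesis
    by (intro left_module.intro left_module_axioms.intro ring_uea)
      (auto simp: carrier_uea uea_act_class free_alg_act_closed free_alg_act_add free_alg_act_mult
        free_alg_act_add_right uea_class_add[symmetric] uea_class_mult[symmetric]
        uea_class_one[symmetric] single_one[symmetric] simp del: single_one)
qed

end

lemma (in nilpotent_lie_module) ad_nilpotent_uea:
  "ad_nilpotent (uea L) (uea_class L (gen x - Poly_Mapping.single 0 c))"
proof -
  interpret U: ring "uea L" by (rule ring_uea)
  let ?a = "uea_class L (gen x - Poly_Mapping.single 0 c)"
  let ?nil = "iter_zero (carrier (uea L)) (ad (uea L) ?a) \<zero>\<^bsub>uea L\<^esub>"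
  have ad_class: "ad (uea L) ?a (uea_class L p) = uea_class L (gen x * p - p * gen x)" for p
  proof -
    have "ad (uea L) ?a (uea_class L p)
        = uea_class L ((gen x - Poly_Mapping.single 0 c) * p - p * (gen x - Poly_Mapping.single 0 c))"
      by (simp add: ad_def uea_class_diff uea_class_mult)
    also have "(gen x - Poly_Mapping.single 0 c) * p - p * (gen x - Poly_Mapping.single 0 c)
        = gen x * p - p * gen x"
      by (simp add: algebra_simps scalar_commutes)
    finally show ?thesis .
  qed
  have gen_nil: "uea_class L (gen y) \<in> ?nil" for y
  proof (induction y rule: lower_central_induct)
    case zero
    show ?case by (simp add: uea_class_gen_zero iter_zero.zero)
  next
    case (step i z)
    have "ad (uea L) ?a (uea_class L (gen z)) \<in> ?nil"
      unfolding ad_class uea_class_gen_bracket by (rule step)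
    with uea_class_closed show ?case by (rule iter_zero.step)
  qed
  have "r \<in> ?nil" if "r \<in> carrier (uea L)" for r
    using that
  proof (induction rule: uea_induct)
    case (gen y)
    show ?case by (rule gen_nil)
  next
    case (scalar c')
    have "ad (uea L) ?a (uea_class L (Poly_Mapping.single 0 c')) \<in> ?nil"
      unfolding ad_class scalar_commutes by (simp add: uea_class_zero iter_zero.zero)
    with uea_class_closed show ?case by (rule iter_zero.step)
  next
    case (add r s)
    then show ?case by (intro U.iter_zero_add) (simp_all add: U.ad_add)
  next
    case (mult r s)
    then show ?case by (intro U.iter_zero_ad_mult) simp_all
  qed
  then show ?thesis by (auto simp: ad_nilpotent_def)
qed

section \<open>The Taylor spectrum\<close>

lemma Tor_trivial_iff:
  fixes R :: "('r, 'x) ring_scheme" and M :: "('r, 'm) module"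
  assumes "one_dim_right_module R \<chi> N n0 \<psi>" and "left_module R M"
  shows "\<exists>(B :: nat \<Rightarrow> ('r \<times> 'm) list set) d e. resolution R M B d e \<and>
    (\<forall>k. carrier (Tor R k N M) = {\<one>\<^bsub>Tor R k N M\<^esub>} \<longleftrightarrow> ring_character.chi_exact R \<chi> B d k)"
proof -
  interpret N: one_dim_right_module R \<chi> N n0 \<psi> by fact
  define Q where "Q = (\<lambda>(B :: nat \<Rightarrow> ('r \<times> 'm) list set, d, e). free_resolution R M B d e)"
  obtain B0 :: "nat \<Rightarrow> ('r \<times> 'm) list set" and d0 e0 where "resolution R M B0 d0 e0"
    by (rule N.free_resolution_exists[OF assms(2)])
  then have "Q (B0, d0, e0)"
    by (simp add: Q_def resolution.free_resolution)
  then have some: "Q (SOME x. Q x)" by (rule someI)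
  obtain B d e where Bde: "(SOME x. Q x) = (B, d, e)"
    by (rule prod_cases3)
  then have "free_resolution R M B d e" using some by (simp add: Q_def)
  then have res: "resolution R M B d e"
    using assms(2) by (intro resolution.intro resolution_axioms.intro N.ring_axioms)
  have "Tor R k N M = tensor_homology R N B d k" for k
    using Bde by (simp add: Tor_def Q_def)
  then show ?thesis
    using res N.tensor_homology_trivial_iff[of d B, OF resolution.d_hom[OF res]]
    by (intro exI[of _ B] exI[of _ d] exI[of _ e]) simp
qed

locale one_dim_module = lie_module L S
  for L :: "'g::ab_group_add lie_algebra" and S :: "('g, 's::ab_group_add) lie_module" +
  fixes \<kappa> :: "'g \<Rightarrow> complex" and s :: 's
  assumes mspace_eq: "mspace S = {mscale S c s |c. True}" and s_nonzero: "s \<noteq> 0"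
    and act_s: "\<And>x. mact S x s = mscale S (\<kappa> x) s"
begin

lemma s_mem [simp]: "s \<in> mspace S"
  unfolding mspace_eq by (intro CollectI exI[of _ 1]) simp

definition char :: "'g free_alg set \<Rightarrow> complex" where
  "char a = (SOME c. uea_act S a s = mscale S c s)"

lemma char_eq:
  assumes "a \<in> carrier (uea L)"
  shows "uea_act S a s = mscale S (char a) s"
proof -
  have "uea_act S a s \<in> mspace S"
    using left_module.smult_closed[OF left_module_uea assms, of s] by simp
  then have "\<exists>c. uea_act S a s = mscale S c s" unfolding mspace_eq by blast
  then show ?thesis unfolding char_def by (rule someI_ex)
qed

lemma char_unique: "\<lbrakk>a \<in> carrier (uea L); uea_act S a s = mscale S c s\<rbrakk> \<Longrightarrow> char a = c"
  using char_eq s_nonzero by simp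

lemma char_gen: "char (uea_class L (gen x)) = \<kappa> x"
  by (rule char_unique) (simp_all add: uea_act_class act_s)

lemma char_scalar: "char (uea_class L (Poly_Mapping.single 0 c)) = c"
  by (rule char_unique) (simp_all add: uea_act_class)

lemma ring_character: "ring_character (uea L) char"
proof (intro ring_character.intro ring_character_axioms.intro ring_uea)
  interpret M: left_module "uea L" "uea_left_module S" by (rule left_module_uea)
  fix a b assume ab: "a \<in> carrier (uea L)" "b \<in> carrier (uea L)"
  show "char (a \<oplus>\<^bsub>uea L\<^esub> b) = char a + char b"
    using ab M.smult_l_distr[OF ab, of s]
    by (intro char_unique M.add.m_closed) (simp_all add: char_eq V.scale_left_distrib)
  show "char (a \<otimes>\<^bsub>uea L\<^esub> b) = char a * char b"
  proof (rule char_unique)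
    have "uea_act S a (mscale S (char b) s) = mscale S (char b) (uea_act S a s)"
      using ab(1) by (auto simp: carrier_uea uea_act_class free_alg_act_scale_right)
    then show "uea_act S (a \<otimes>\<^bsub>uea L\<^esub> b) s = mscale S (char a * char b) s"
      using ab M.smult_assoc[OF ab, of s] by (simp add: char_eq mult.commute)
  qed (use ab in simp)
next
  interpret M: left_module "uea L" "uea_left_module S" by (rule left_module_uea)
  show "char \<one>\<^bsub>uea L\<^esub> = 1"
    using M.smult_one[of s] by (intro char_unique) simp_all
qed

definition dual_basis :: "'s \<Rightarrow> complex" where
  "dual_basis v = (if v \<in> mspace S then SOME c. v = mscale S c s else 0)"

lemma dual_basis_scale [simp]: "dual_basis (mscale S c s) = c"
proof -
  have "(SOME c'. mscale S c s = mscale S c' s) = c"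
    using s_nonzero by (intro some_equality) simp_all
  then show ?thesis by (simp add: dual_basis_def)
qed

lemma dual_simps [simp]:
  "f \<in> carrier (dual_right_module S) \<longleftrightarrow>
     (\<forall>u\<in>mspace S. \<forall>v\<in>mspace S. f (u + v) = f u + f v) \<and>
     (\<forall>c. \<forall>v\<in>mspace S. f (mscale S c v) = c * f v) \<and> (\<forall>v. v \<notin> mspace S \<longrightarrow> f v = 0)"
  "f \<oplus>\<^bsub>dual_right_module S\<^esub> g = (\<lambda>v. f v + g v)"
  "a \<odot>\<^bsub>dual_right_module S\<^esub> f = (\<lambda>v. if v \<in> mspace S then f (uea_act S a v) else 0)"
  by (simp_all add: dual_right_module_def)

lemma one_dim_right_module_dual:
  "one_dim_right_module (uea L) char (dual_right_module S) dual_basis (\<lambda>f. f s)"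
proof (intro one_dim_right_module.intro one_dim_right_module_axioms.intro ring_character)
  interpret M: left_module "uea L" "uea_left_module S" by (rule left_module_uea)
  show "\<exists>r\<in>carrier (uea L). char r = c" for c
    using char_scalar[of c] by (intro bexI[of _ "uea_class L (Poly_Mapping.single 0 c)"]) simp_all
  show "dual_basis \<in> carrier (dual_right_module S)"
  proof -
    have el: "\<exists>c. v = mscale S c s" if "v \<in> mspace S" for v using that mspace_eq by blast
    have "dual_basis (u + v) = dual_basis u + dual_basis v" if uv: "u \<in> mspace S" "v \<in> mspace S" for u v
    proof -
      obtain b c where "u = mscale S b s" "v = mscale S c s" using el uv by blast
      then show ?thesis
        using dual_basis_scale[of "b + c"] by (simp add: V.scale_left_distrib)
    qed
    moreover have "dual_basis (mscale S c v) = c * dual_basis v" if v: "v \<in> mspace S" for c v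
      using el[OF v] by auto
    ultimately show ?thesis by (simp add: dual_basis_def)
  qed
  show "dual_basis s = 1" using dual_basis_scale[of 1] by simp
  fix f g assume f: "f \<in> carrier (dual_right_module S)" and g: "g \<in> carrier (dual_right_module S)"
  then show "f \<oplus>\<^bsub>dual_right_module S\<^esub> g \<in> carrier (dual_right_module S)"
    by (simp add: algebra_simps)
  show "(f \<oplus>\<^bsub>dual_right_module S\<^esub> g) s = f s + g s" by simp
  show "f = g" if "f s = g s"
  proof
    fix v
    show "f v = g v"
    proof (cases "v \<in> mspace S")
      case True
      then obtain c where "v = mscale S c s" using mspace_eq by blast
      then show ?thesis using f g that by simp
    qed (use f g in simp)
  qed
  fix a assume a: "a \<in> carrier (uea L)"
  have closed: "uea_act S a v \<in> mspace S" if "v \<in> mspace S" for v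
    using M.smult_closed[OF a, of v] that by simp
  have add: "uea_act S a (u + v) = uea_act S a u + uea_act S a v" if "u \<in> mspace S" "v \<in> mspace S" for u v
    using M.smult_r_distr[OF a, of u v] that by simp
  have scale: "uea_act S a (mscale S c v) = mscale S c (uea_act S a v)" if "v \<in> mspace S" for c v
    using a that by (auto simp: carrier_uea uea_act_class free_alg_act_scale_right)
  show "a \<odot>\<^bsub>dual_right_module S\<^esub> f \<in> carrier (dual_right_module S)"
    using f by (simp add: closed add scale)
  show "(a \<odot>\<^bsub>dual_right_module S\<^esub> f) s = char a * f s"
    using f a by (simp add: char_eq)
qed

lemma iso_if_same_weight:
  fixes T :: "('g, 't::ab_group_add) lie_module"
  assumes "one_dim_module L T \<kappa> t"
  shows "lie_isomorphic S T"
proof -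
  interpret T: one_dim_module L T \<kappa> t by fact
  let ?f = "\<lambda>v. mscale T (dual_basis v) t"
  have f: "?f (mscale S c s) = mscale T c t" for c by simp
  have el: "\<exists>c. v = mscale S c s" if "v \<in> mspace S" for v using that mspace_eq by blast
  have "bij_betw ?f (mspace S) (mspace T)"
    unfolding bij_betw_def
  proof
    show "inj_on ?f (mspace S)"
      using el T.s_nonzero by (intro inj_onI) (metis T.V.scale_right_imp_eq f)
    show "?f ` mspace S = mspace T"
      unfolding mspace_eq T.mspace_eq using f by (auto intro!: image_eqI)
  qed
  moreover have "?f (u + v) = ?f u + ?f v" if uv: "u \<in> mspace S" "v \<in> mspace S" for u v
  proof -
    obtain b c where "u = mscale S b s" "v = mscale S c s" using el uv by blast
    then show ?thesis
      using f[of "b + c"] by (simp add: V.scale_left_distrib T.V.scale_left_distrib)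
  qed
  moreover have "?f (mscale S c v) = mscale T c (?f v)" if v: "v \<in> mspace S" for c v
    using el[OF v] by auto
  moreover have "?f (mact S x v) = mact T x (?f v)" if v: "v \<in> mspace S" for x v
    using el[OF v] by (auto simp: act_scale_right act_s T.act_scale_right T.act_s)
  ultimately show ?thesis unfolding lie_isomorphic_def by blast
qed

end

lemma lie_isomorphic_trans:
  assumes "lie_isomorphic X Y" "lie_isomorphic Y Z"
  shows "lie_isomorphic X Z"
proof -
  obtain f where f: "bij_betw f (mspace X) (mspace Y)"
    "\<forall>u\<in>mspace X. \<forall>v\<in>mspace X. f (u + v) = f u + f v"
    "\<forall>c. \<forall>v\<in>mspace X. f (mscale X c v) = mscale Y c (f v)"
    "\<forall>x. \<forall>v\<in>mspace X. f (mact X x v) = mact Y x (f v)"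
    using assms(1) unfolding lie_isomorphic_def by blast
  obtain g where g: "bij_betw g (mspace Y) (mspace Z)"
    "\<forall>u\<in>mspace Y. \<forall>v\<in>mspace Y. g (u + v) = g u + g v"
    "\<forall>c. \<forall>v\<in>mspace Y. g (mscale Y c v) = mscale Z c (g v)"
    "\<forall>x. \<forall>v\<in>mspace Y. g (mact Y x v) = mact Z x (g v)"
    using assms(2) unfolding lie_isomorphic_def by blast
  have "f v \<in> mspace Y" if "v \<in> mspace X" for v
    using f(1) that by (rule bij_betwE[rule_format])
  then show ?thesis
    unfolding lie_isomorphic_def using f g
    by (intro exI[of _ "g \<circ> f"]) (auto intro: bij_betw_trans)
qed

lemma iso_class_eq:
  assumes "one_dim_module L S \<kappa> s" "one_dim_module L T \<kappa> t"
  shows "iso_class L S = iso_class L T"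
  unfolding iso_class_def
  using one_dim_module.iso_if_same_weight[OF assms] one_dim_module.iso_if_same_weight[OF assms(2,1)]
  by (blast intro: lie_isomorphic_trans)

lemma (in lie_module) one_dim_submodule:
  assumes "v \<in> mspace V" "v \<noteq> 0" "\<And>x. mact V x v = mscale V (\<kappa> x) v"
  shows "lie_submodule V {mscale V c v |c. True}"
    and "one_dim_module L (V\<lparr>mspace := {mscale V c v |c. True}\<rparr>) \<kappa> v"
proof -
  let ?W = "{mscale V c v |c. True}"
  have sub: "V.subspace ?W"
  proof -
    have "?W = V.span {v}" by (auto simp: V.span_singleton)
    then show ?thesis by (simp only: V.subspace_span)
  qed
  have WV: "?W \<subseteq> mspace V" using assms(1) by auto
  have act: "mact V x w \<in> ?W" if "w \<in> ?W" for x w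
    using that assms by (auto simp: act_scale_right)
  show "lie_submodule V ?W"
    using sub WV act by (simp add: lie_submodule_def)
  have "lie_module L (V\<lparr>mspace := ?W\<rparr>)"
    using lie_module_axioms sub act WV unfolding lie_module_def lie_module_axioms_def
    by (simp add: subset_iff)
  then show "one_dim_module L (V\<lparr>mspace := ?W\<rparr>) \<kappa> v"
    using assms by (intro one_dim_module.intro one_dim_module_axioms.intro) simp_all
qed

definition std_one_dim :: "('g \<Rightarrow> complex) \<Rightarrow> 'g std_module" where
  "std_one_dim \<kappa> = \<lparr>mspace = range (Poly_Mapping.single 0), mscale = \<lambda>c p. Poly_Mapping.single 0 c * p,
     mact = \<lambda>x p. Poly_Mapping.single 0 (\<kappa> x) * p\<rparr>"

lemma one_dim_module_std:
  assumes "one_dim_module L T \<kappa> t"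
  shows "one_dim_module L (std_one_dim \<kappa> :: 'g::ab_group_add std_module) \<kappa> (Poly_Mapping.single 0 1)"
proof -
  interpret T: one_dim_module L T \<kappa> t by fact
  let ?S = "std_one_dim \<kappa> :: 'g std_module"
  have zero: "a = b" if "mscale T a t = mscale T b t" for a b
    using that T.s_nonzero by simp
  have \<kappa>: "\<kappa> (x + y) = \<kappa> x + \<kappa> y" "\<kappa> (lscale L c x) = c * \<kappa> x" "\<kappa> (bracket L x y) = 0" for x y c
  proof -
    show "\<kappa> (x + y) = \<kappa> x + \<kappa> y"
      by (rule zero) (simp add: T.act_s[symmetric] T.act_add_left T.V.scale_left_distrib)
    show "\<kappa> (lscale L c x) = c * \<kappa> x"
      using T.act_scale_left[OF T.s_mem, of c x] by (intro zero) (simp add: T.act_s)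
    show "\<kappa> (bracket L x y) = 0"
      using T.act_bracket[OF T.s_mem, of x y]
      by (intro zero) (simp add: T.act_s T.act_scale_right mult.commute)
  qed
  have vs: "vector_space (mscale ?S)"
    by unfold_locales (simp_all add: std_one_dim_def single_add distrib_left distrib_right
        mult.assoc[symmetric] mult_single)
  interpret S: vector_space "mscale ?S" by (rule vs)
  have sub: "S.subspace (mspace ?S)"
    by (rule S.subspaceI)
      (auto simp: std_one_dim_def mult_single single_add[symmetric] intro: range_eqI[of _ _ 0])
  have "lie_module L ?S"
    using vs sub T.lie_algebra_axioms
    by (intro lie_module.intro lie_module_axioms.intro)
      (auto simp: std_one_dim_def mult_single single_add[symmetric] single_diff[symmetric] \<kappa>
        algebra_simps)
  then show ?thesis
    by (intro one_dim_module.intro one_dim_module_axioms.intro)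
      (auto simp: std_one_dim_def mult_single)
qed

lemma (in one_dim_module) simple: "lie_simple S"
  unfolding lie_simple_def
proof (intro conjI allI impI)
  show "mspace S \<noteq> {0}" using s_mem s_nonzero by (metis singletonD)
  fix W assume W: "lie_submodule S W"
  show "W = {0} \<or> W = mspace S"
  proof (cases "W = {0}")
    case False
    then obtain w where w: "w \<in> W" "w \<noteq> 0" using submoduleD(2)[OF W] by blast
    have "w \<in> mspace S" using w(1) by (rule submoduleD(1)[OF W])
    then obtain c where c: "w = mscale S c s" unfolding mspace_eq by blast
    with w have "c \<noteq> 0" by auto
    then have sW: "s \<in> W" using w(1) submodule_scale_iff[OF W, of c s] unfolding c by simp
    have "mspace S \<subseteq> W"
    proof
      fix v assume "v \<in> mspace S"
      then obtain b where b: "v = mscale S b s" unfolding mspace_eq by blast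
      show "v \<in> W" unfolding b by (rule submoduleD(5)[OF W sW])
    qed
    moreover have "W \<subseteq> mspace S" using W by (simp add: lie_submodule_def)
    ultimately show ?thesis by blast
  qed simp
qed

lemma (in one_dim_module) finite_dim: "module_finite_dim S"
proof -
  have "V.span {s} = mspace S" by (auto simp: V.span_singleton mspace_eq)
  then show ?thesis unfolding module_finite_dim_def by blast
qed

text \<open>The augmentation ideal of \<open>\<kappa>\<close> maps \<open>V\<close> into the proper submodule \<open>N\<close>, so that already
  \<open>Tor\<^sub>0\<close> is nonzero.\<close>

lemma not_chi_exact_weight:
  fixes S :: "('g::ab_group_add, 's::ab_group_add) lie_module"
    and V :: "('g, 'v::ab_group_add) lie_module"
  assumes "one_dim_module L S \<kappa> s" and "nilpotent_lie_module L V"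
    and v: "lie_module.weight_vector V \<kappa> v"
    and res: "resolution (uea L) (uea_left_module V) B d e"
  shows "\<not> ring_character.chi_exact (uea L) (one_dim_module.char S s) B d 0"
proof
  interpret S: one_dim_module L S \<kappa> s by fact
  interpret V: nilpotent_lie_module L V by fact
  interpret ring_character "uea L" S.char by (rule S.ring_character)
  interpret P: resolution "uea L" "uea_left_module V" B d e by (rule res)
  obtain N where N: "lie_submodule V N" "N \<subset> mspace V" "V.scalar_mod \<kappa> (mspace V) N"
    using V.weight_quotient[OF v] by blast
  note Nr = V.submoduleD[OF N(1)]
  assume exact: "chi_exact B d 0"
  have act_N: "uea_act V a n \<in> N" if "a \<in> carrier (uea L)" "n \<in> N" for a n
    using that
  proof (induction arbitrary: n rule: uea_induct)
    case (gen x)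
    then show ?case using Nr(1,6) by (simp add: V.uea_act_class)
  next
    case (scalar c)
    then show ?case using Nr(1,5) by (simp add: V.uea_act_class)
  next
    case (add a b)
    then show ?case using Nr(1,3) P.M.smult_l_distr[of a b n] by simp
  next
    case (mult a b)
    then show ?case using Nr(1) P.M.smult_assoc[of a b n] by simp
  qed
  have act_mod: "uea_act V a m - mscale V (S.char a) m \<in> N" if "a \<in> carrier (uea L)" "m \<in> mspace V" for a m
    using that
  proof (induction arbitrary: m rule: uea_induct)
    case (gen x)
    then show ?case using N(3) by (simp add: V.uea_act_class S.char_gen V.scalar_mod_def)
  next
    case (scalar c)
    then show ?case using Nr(2) by (simp add: V.uea_act_class S.char_scalar)
  next
    case (add a b)
    have "uea_act V (a \<oplus>\<^bsub>uea L\<^esub> b) m - mscale V (S.char (a \<oplus>\<^bsub>uea L\<^esub> b)) m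
        = (uea_act V a m - mscale V (S.char a) m) + (uea_act V b m - mscale V (S.char b) m)"
      using add P.M.smult_l_distr[of a b m] by (simp add: chi_add V.V.scale_left_distrib)
    also have "\<dots> \<in> N" using add by (intro Nr(3)) auto
    finally show ?case .
  next
    case (mult a b)
    have bm: "uea_act V b m \<in> mspace V" using mult P.M.smult_closed[of b m] by simp
    have scale: "mscale V c m \<in> mspace V" for c using mult by simp
    let ?x = "uea_act V b m - mscale V (S.char b) m" and ?y = "mscale V (S.char b) m"
    have x: "?x \<in> N" by (rule mult.IH(2)[OF mult.prems])
    have "uea_act V (a \<otimes>\<^bsub>uea L\<^esub> b) m = uea_act V a ?x + uea_act V a ?y"
      using P.M.smult_r_distr[OF mult.hyps(1), of ?x ?y] P.M.smult_assoc[OF mult.hyps, of m]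
        bm scale mult.prems by simp
    then have "uea_act V (a \<otimes>\<^bsub>uea L\<^esub> b) m - mscale V (S.char (a \<otimes>\<^bsub>uea L\<^esub> b)) m
        = uea_act V a ?x + (uea_act V a ?y - mscale V (S.char a) ?y)"
      by (simp add: chi_mult[OF mult.hyps])
    also have "\<dots> \<in> N"
      by (rule Nr(3)[OF act_N[OF mult.hyps(1) x] mult.IH(1)[OF scale]])
    finally show ?case .
  qed
  have e_N: "e p \<in> N" if "p \<in> carrier (P.P 0)" "\<And>i. S.char (p i) = 0" for p
    using that(1)
  proof (induction rule: free_induct_chi_zero)
    case (chi i)
    show ?case by (rule that(2))
  next
    case zero
    show ?case using P.e_rules(4) Nr(2) by simp
  next
    case (add p r i)
    have u: "monomial (uea L) \<one>\<^bsub>uea L\<^esub> i \<in> carrier (P.P 0)" using add.hyps by simp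
    have "e (monomial (uea L) r i) = uea_act V r (e (monomial (uea L) \<one>\<^bsub>uea L\<^esub> i))"
      using P.e_rules(3)[OF add.hyps(2) u] monomial_eq_smult[OF add.hyps(2), of i "B 0"] by simp
    moreover have eu: "e (monomial (uea L) \<one>\<^bsub>uea L\<^esub> i) \<in> mspace V"
      using P.e_rules(1)[OF u] by simp
    ultimately have "e (monomial (uea L) r i) \<in> N"
      using act_mod[OF add.hyps(2) eu] add.hyps(3) by simp
    moreover have "e (p \<oplus>\<^bsub>P.P 0\<^esub> monomial (uea L) r i) = e p + e (monomial (uea L) r i)"
      using P.e_rules(2)[of p "monomial (uea L) r i"] add.hyps by simp
    ultimately show ?case
      using Nr(3) add.IH by simp
  qed
  obtain m where m: "m \<in> mspace V" "m \<notin> N" using N(2) by blast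
  have "m \<in> e ` carrier (P.P 0)" using P.e_surj m(1) by simp
  then obtain p where p: "p \<in> carrier (P.P 0)" "e p = m" by blast
  obtain q where q: "q \<in> carrier (P.P (Suc 0))" "\<And>i. S.char (d 0 q i) = S.char (p i)"
    using exact p(1) unfolding chi_exact_def by blast
  have dq: "d 0 q \<in> carrier (P.P 0)" using q(1) by (rule P.d_rules(1))
  let ?r = "p \<ominus>\<^bsub>P.P 0\<^esub> d 0 q"
  have r: "?r \<in> carrier (P.P 0)" using p(1) dq by (rule P.P.M.minus_closed)
  have "e ?r \<in> N"
    using r free_coord[OF p(1)] free_coord[OF dq] q(2)
    by (intro e_N) (simp_all add: minus_free[OF p(1) dq] chi_minus)
  moreover have "?r \<oplus>\<^bsub>P.P 0\<^esub> d 0 q = p"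
    using p(1) dq by (rule P.P.M.minus_add_cancel)
  then have "e p = e ?r + e (d 0 q)"
    using P.e_rules(2)[OF r dq] by simp
  ultimately show False
    using m(2) p(2) P.e_d[OF q(1)] by simp
qed

lemma chi_exact_nonweight:
  fixes S :: "('g::ab_group_add, 's::ab_group_add) lie_module"
    and V :: "('g, 'v::ab_group_add) lie_module"
  assumes "one_dim_module L S \<kappa> s" and "nilpotent_lie_module L S" "nilpotent_lie_module L V"
    and nonweight: "\<And>v. \<not> lie_module.weight_vector V \<kappa> v"
    and res: "resolution (uea L) (uea_left_module V) B d e"
  shows "ring_character.chi_exact (uea L) (one_dim_module.char S s) B d k"
proof -
  interpret S: one_dim_module L S \<kappa> s by fact
  interpret S': nilpotent_lie_module L S by fact
  interpret V: nilpotent_lie_module L V by fact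
  interpret ring_character "uea L" S.char by (rule S.ring_character)
  have "S.weight_vector \<kappa> s"
    using S.s_nonzero S.act_s by (simp add: S.weight_vector_def)
  then have "V.linear_form \<kappa>"
    by (rule S'.weight_vector_linear)
  then obtain x where x: "bij_betw (\<lambda>v. mact V x v - mscale V (\<kappa> x) v) (mspace V) (mspace V)"
    using V.nonweight_bij nonweight by blast
  let ?a = "uea_class L (gen x - Poly_Mapping.single 0 (\<kappa> x))"
  show ?thesis
  proof (rule chi_exact_if_bij[OF res])
    show "ad_nilpotent (uea L) ?a" by (rule V.ad_nilpotent_uea)
    show "S.char ?a = 0"
      by (simp add: uea_class_diff chi_minus S.char_gen S.char_scalar)
    have "?a \<odot>\<^bsub>uea_left_module V\<^esub> v = mact V x v - mscale V (\<kappa> x) v" if "v \<in> mspace V" for v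
      using that by (simp add: V.uea_act_class V.free_alg_act_diff)
    then have "bij_betw (\<lambda>v. ?a \<odot>\<^bsub>uea_left_module V\<^esub> v) (mspace V) (mspace V)
        = bij_betw (\<lambda>v. mact V x v - mscale V (\<kappa> x) v) (mspace V) (mspace V)"
      by (rule bij_betw_cong)
    with x show "bij_betw (\<lambda>v. ?a \<odot>\<^bsub>uea_left_module V\<^esub> v) (carrier (uea_left_module V))
        (carrier (uea_left_module V))"
      by simp
  qed simp
qed

lemma (in lie_module) dim_one_weight_vector:
  assumes W: "lie_submodule V W" and dim: "V.dim W = 1"
  obtains v \<kappa> where "weight_vector \<kappa> v" "W = {mscale V c v |c. True}"
proof -
  note Wr = submoduleD[OF W]
  have sub: "V.subspace W" using W by (simp add: lie_submodule_def)
  obtain B where B: "B \<subseteq> W" "V.independent B" "W \<subseteq> V.span B" "card B = V.dim W"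
    using V.basis_exists[of W] by metis
  obtain v where v: "B = {v}" using B(4) dim by (metis card_1_singletonE)
  have "W = V.span {v}"
    using B(1,3) V.span_minimal[OF _ sub, of B] v by blast
  then have W_eq: "W = {mscale V c v |c. True}" by (auto simp: V.span_singleton)
  have vW: "v \<in> W" "v \<noteq> 0" using B(1,2) v by auto
  have "\<exists>c. mact V x v = mscale V c v" for x
    using Wr(6)[OF vW(1), of x] unfolding W_eq by blast
  then obtain \<kappa> where "\<And>x. mact V x v = mscale V (\<kappa> x) v" by metis
  then have "weight_vector \<kappa> v"
    using vW Wr(1) by (simp add: weight_vector_def)
  then show ?thesis using W_eq by (rule that)
qed

theorem theorem4p4:
  fixes L :: "'g::ab_group_add lie_algebra"
    and V :: "('g, 'v::ab_group_add) lie_module"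
  assumes "lie_algebra L" and "lie_finite_dim L" and "lie_nilpotent L"
    and "lie_module L V" and "module_finite_dim V"
  shows "taylor_spectrum L V = one_dim_submodule_classes L V"
proof -
  interpret V: nilpotent_lie_module L V
    using assms by (intro nilpotent_lie_module.intro nilpotent_lie_module_axioms.intro)
  show ?thesis
  proof (intro equalityI subsetI)
    fix X assume "X \<in> taylor_spectrum L V"
    then obtain S :: "'g std_module" and k where X: "X = iso_class L S"
      and S: "lie_module L S" "module_finite_dim S" "lie_simple S"
      and Tor: "carrier (Tor (uea L) k (dual_right_module S) (uea_left_module V))
        \<noteq> {\<one>\<^bsub>Tor (uea L) k (dual_right_module S) (uea_left_module V)\<^esub>}"
      unfolding taylor_spectrum_def Let_def by blast
    interpret S: nilpotent_lie_module L S
      using assms(3) S by (intro nilpotent_lie_module.intro nilpotent_lie_module_axioms.intro)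
    obtain s \<kappa> where s: "S.weight_vector \<kappa> s" "mspace S = {mscale S c s |c. True}"
      using S.simple_one_dim[OF S(3)] by blast
    then have one: "one_dim_module L S \<kappa> s"
      using S(1) by (intro one_dim_module.intro one_dim_module_axioms.intro)
        (simp_all add: S.weight_vector_def)
    obtain B :: "nat \<Rightarrow> ('g free_alg set \<times> 'v) list set" and d e
      where Bde: "resolution (uea L) (uea_left_module V) B d e"
      "\<not> ring_character.chi_exact (uea L) (one_dim_module.char S s) B d k"
      using Tor_trivial_iff[OF one_dim_module.one_dim_right_module_dual[OF one] V.left_module_uea] Tor
      by blast
    have "\<exists>v. V.weight_vector \<kappa> v"
      using chi_exact_nonweight[OF one S.nilpotent_lie_module_axioms V.nilpotent_lie_module_axioms _ Bde(1)]
        Bde(2) by blast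
    then obtain v where v: "v \<in> mspace V" "v \<noteq> 0" "\<And>x. mact V x v = mscale V (\<kappa> x) v"
      by (auto simp: V.weight_vector_def)
    let ?W = "{mscale V c v |c. True}"
    have "?W = V.V.span {v}" by (auto simp: V.V.span_singleton)
    then have "V.V.dim ?W = 1"
      using V.V.dim_span_eq_card_independent[of "{v}"] v(2) by simp
    moreover have "X = iso_class L (V\<lparr>mspace := ?W\<rparr>)"
      unfolding X by (rule iso_class_eq[OF one V.one_dim_submodule(2)[OF v]])
    ultimately show "X \<in> one_dim_submodule_classes L V"
      unfolding one_dim_submodule_classes_def using V.one_dim_submodule(1)[OF v] by blast
  next
    fix X assume "X \<in> one_dim_submodule_classes L V"
    then obtain W where X: "X = iso_class L (V\<lparr>mspace := W\<rparr>)"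
      and W: "lie_submodule V W" "V.V.dim W = 1"
      unfolding one_dim_submodule_classes_def by blast
    obtain v \<kappa> where v: "V.weight_vector \<kappa> v" and W_eq: "W = {mscale V c v |c. True}"
      using V.dim_one_weight_vector[OF W] by blast
    have oneW: "one_dim_module L (V\<lparr>mspace := W\<rparr>) \<kappa> v"
      unfolding W_eq using v by (intro V.one_dim_submodule(2)) (simp_all add: V.weight_vector_def)
    let ?S = "std_one_dim \<kappa> :: 'g std_module" and ?s = "Poly_Mapping.single 0 1 :: nat \<Rightarrow>\<^sub>0 complex"
    have one: "one_dim_module L ?S \<kappa> ?s"
      using oneW by (rule one_dim_module_std)
    obtain B :: "nat \<Rightarrow> ('g free_alg set \<times> 'v) list set" and d e
      where res: "resolution (uea L) (uea_left_module V) B d e"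
        and iff: "\<forall>k. carrier (Tor (uea L) k (dual_right_module ?S) (uea_left_module V))
          = {\<one>\<^bsub>Tor (uea L) k (dual_right_module ?S) (uea_left_module V)\<^esub>} \<longleftrightarrow>
        ring_character.chi_exact (uea L) (one_dim_module.char ?S ?s) B d k"
      using Tor_trivial_iff[OF one_dim_module.one_dim_right_module_dual[OF one] V.left_module_uea]
      by (elim exE conjE)
    have "\<not> ring_character.chi_exact (uea L) (one_dim_module.char ?S ?s) B d 0"
      by (rule not_chi_exact_weight[OF one V.nilpotent_lie_module_axioms v res])
    then have "carrier (Tor (uea L) 0 (dual_right_module ?S) (uea_left_module V))
        \<noteq> {\<one>\<^bsub>Tor (uea L) 0 (dual_right_module ?S) (uea_left_module V)\<^esub>}"
      by (simp only: iff[rule_format] not_False_eq_True)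
    then have "\<exists>k. let T = Tor (uea L) k (dual_right_module ?S) (uea_left_module V)
        in carrier T \<noteq> {\<one>\<^bsub>T\<^esub>}"
      unfolding Let_def by (rule exI)
    moreover have "X = iso_class L ?S"
      unfolding X by (rule iso_class_eq[OF oneW one])
    moreover have "lie_module L ?S" using one by (rule one_dim_module.axioms)
    ultimately show "X \<in> taylor_spectrum L V"
      unfolding taylor_spectrum_def
      using one_dim_module.simple[OF one] one_dim_module.finite_dim[OF one] by blast
  qed
qed

end
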